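(* Let $L_T$ be an invertible trend-admissible operator and $L_S$ an invertible seasonal-admissible operator (that is, both admissible of order $0$). Let $L\ge1$, $\boldsymbol{y}\in\mathbb{R}^L$, $\lambda>0$, and let $\boldsymbol{\Phi}=(\phi_1,\ldots,\phi_L)$ be a family of generalized functions such that, for any $1\le\ell\le L$, $\phi_\ell\in L_T^*\{\mathcal{L}_2(\mathbb{R})\}$, $\phi_\ell$ is periodizable, and $\mathrm{Per}\{\phi_\ell\}\in L_S^*\{\mathcal{L}_2(\mathbb{T})\}$. Then the optimization problem $$\inf_{(f_T,f_S)\in\mathcal{L}_2(L_T,L_S)}\ \|\boldsymbol{y}-\boldsymbol{\Phi}(f_T,f_S)\|_2^2+\lambda\left(\|L_Tf_T\|_{\mathcal{L}_2(\mathbb{R})}^2+\|L_Sf_S\|_{\mathcal{L}_2(\mathbb{T})}^2\right)$$ admits a unique solution $(\tilde f_T,\tilde f_S)$, and $$\tilde f_T=\sum_{\ell=1}^L\alpha_\ell\,(\phi_\ell*\psi_{L_T^*L_T}),\qquad\tilde f_S=\sum_{\ell=1}^L\alpha_\ell\,(\mathrm{Per}\{\phi_\ell\}*\rho_{L_S^*L_S}),$$ where $\boldsymbol{\alpha}=(\alpha_1,\ldots,\alpha_L)=(\mathbf{G}+\lambda\,\mathrm{Id}_L)^{-1}\boldsymbol{y}$ and $\mathbf{G}\in\mathbb{R}^{L\times L}$ has entries $$G[\ell_1,\ell_2]=\langle L_T^{-1*}\phi_{\ell_1},L_T^{-1*}\phi_{\ell_2}\rangle_{\mathcal{L}_2(\mathbb{R})}+\langle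 L_S^{-1*}\mathrm{Per}\{\phi_{\ell_1}\},L_S^{-1*}\mathrm{Per}\{\phi_{\ell_2}\}\rangle_{\mathcal{L}_2(\mathbb{T})}.$$
   Context: Conventions: all functions and generalized functions are real-valued, and operators map real generalized functions to real ones. $\mathbb{T}=\mathbb{R}/\mathbb{Z}$; $\mathcal{S}'(\mathbb{R})$ is the space of tempered distributions and $\mathcal{S}'(\mathbb{T})$ the space of $1$-periodic distributions (dual of smooth $1$-periodic functions $\mathcal{S}(\mathbb{T})$), both with the weak*-topology. LSI means linear and shift-invariant. An invertible trend-admissible operator is an LSI continuous operator $L_T:\mathcal{S}'(\mathbb{R})\to\mathcal{S}'(\mathbb{R})$ with an LSI continuous inverse; an invertible seasonal-admissible operator is an LSI continuous operator $L_S:\mathcal{S}'(\mathbb{T})\to\mathcal{S}'(\mathbb{T})$ with an LSI continuous inverse. Adjoints $L_T^*,L_S^*$ are the operators of the same type with $\langle L\varphi_1,\varphi_2\rangle=\langle L^*\varphi_2,\varphi_1\rangle$ for test functions $\varphi_1,\varphi_2$; $L^{-1*}=(L^{-1})^*$. $\mathrm{III}=\sum_{k\in\mathbb{Z}}\delta(\cdot-k)$. $\phi\in\mathcal{S}'(\mathbb{R})$ is periodizable if $\sum_{|n|\le N}\phi(\cdot-n)$ converges in $\mathcal{S}'(\mathbb{R})$ as $N\to\infty$; the limit is $\mathrm{Per}\{\phi\}\in\mathcal{S}'(\mathbb{T})$. $\mathcal{L}_2(L_T,L_S)=L_T^{-1}\{\mathcal{L}_2(\mathbb{R})\}\times L_S^{-1}\{\mathcal{L}_2(\mathbb{T})\}$.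 The functionals act by $\phi_\ell(f_T,f_S)=\langle L_Tf_T,L_T^{-1*}\phi_\ell\rangle_{\mathcal{L}_2(\mathbb{R})}+\langle L_Sf_S,L_S^{-1*}\mathrm{Per}\{\phi_\ell\}\rangle_{\mathcal{L}_2(\mathbb{T})}$ and $\boldsymbol{\Phi}(f_T,f_S)=(\phi_\ell(f_T,f_S))_{1\le\ell\le L}$. Green's functions: $\psi_{L_T^*L_T}=(L_T^*L_T)^{-1}\delta=L_T^{-1}L_T^{-1*}\delta$ and $\rho_{L_S^*L_S}=(L_S^*L_S)^{-1}\mathrm{III}$. The convolutions are $\phi*\psi_{L_T^*L_T}=L_T^{-1}L_T^{-1*}\phi$ for $\phi\in\mathcal{S}'(\mathbb{R})$ (convolution on $\mathbb{R}$) and $g*\rho_{L_S^*L_S}=L_S^{-1}L_S^{-1*}g$ for $g\in\mathcal{S}'(\mathbb{T})$ (periodic convolution). *)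

theory Defs
  imports "HOL-Analysis.Analysis" "HOL-Probability.Sinc_Integral"
begin

section \<open>Spaces topologized by an increasing sequence of seminorms\<close>

definition seminorm_open :: "(nat \<Rightarrow> 'a::real_vector \<Rightarrow> real) \<Rightarrow> 'a set \<Rightarrow> bool"
  where "seminorm_open p U \<longleftrightarrow> (\<forall>x\<in>U. \<exists>N. \<exists>e>0. \<forall>y. p N (y - x) < e \<longrightarrow> y \<in> U)"

lemma seminorm_open_UNIV: "seminorm_open p UNIV"
  unfolding seminorm_open_def by (auto intro: exI[of _ 1])

lemma seminorm_open_Int:
  assumes mono: "\<And>M N x. M \<le> N \<Longrightarrow> p M x \<le> p N x"
    and S: "seminorm_open p S" and T: "seminorm_open p T"
  shows "seminorm_open p (S \<inter> T)"
  unfolding seminorm_open_def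
proof
  fix x assume x: "x \<in> S \<inter> T"
  obtain M d where M: "d > 0" "\<And>y. p M (y - x) < d \<Longrightarrow> y \<in> S"
    using S x unfolding seminorm_open_def by blast
  obtain N e where N: "e > 0" "\<And>y. p N (y - x) < e \<Longrightarrow> y \<in> T"
    using T x unfolding seminorm_open_def by blast
  have "y \<in> S \<inter> T" if "p (max M N) (y - x) < min d e" for y
    using M(2)[of y] N(2)[of y] that
      mono[of M "max M N" "y - x"] mono[of N "max M N" "y - x"] by fastforce
  then show "\<exists>K. \<exists>r>0. \<forall>y. p K (y - x) < r \<longrightarrow> y \<in> S \<inter> T"
    using M(1) N(1) by (intro exI[of _ "max M N"] exI[of _ "min d e"]) auto
qed

lemma seminorm_open_Union: "\<forall>S\<in>K. seminorm_open p S \<Longrightarrow> seminorm_open p (\<Union>K)"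
  unfolding seminorm_open_def by (meson UnionE UnionI)

class seminormed_space = real_vector + topological_space +
  fixes snorm :: "nat \<Rightarrow> 'a \<Rightarrow> real"
  assumes snorm_triangle: "snorm N (x + y) \<le> snorm N x + snorm N y"
    and snorm_scaleR: "snorm N (c *\<^sub>R x) = \<bar>c\<bar> * snorm N x"
    and snorm_mono: "M \<le> N \<Longrightarrow> snorm M x \<le> snorm N x"
    and open_snorm: "open U \<longleftrightarrow> (\<forall>x\<in>U. \<exists>N. \<exists>e>0. \<forall>y. snorm N (y - x) < e \<longrightarrow> y \<in> U)"

lemma snorm_zero [simp]: "snorm N (0 :: 'a::seminormed_space) = 0"
  using snorm_scaleR[of N 0 "0 :: 'a"] by simp

lemma snorm_nonneg: "0 \<le> snorm N (x :: 'a::seminormed_space)"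
  using snorm_triangle[of N x "(-1) *\<^sub>R x"] snorm_scaleR[of N "-1" x] by simp

lemma continuous_on_linear_snorm:
  fixes T :: "'a::seminormed_space \<Rightarrow> 'b::seminormed_space"
  assumes "linear T" and bound: "\<And>N. \<exists>C M. \<forall>x. snorm N (T x) \<le> C * snorm M x"
  shows "continuous_on UNIV T"
  unfolding continuous_on_open_vimage[OF open_UNIV]
proof (intro allI impI)
  fix B :: "'b set"
  assume B: "open B"
  have "open (T -` B)"
    unfolding open_snorm
  proof
    fix x assume "x \<in> T -` B"
    then obtain N e where N: "e > 0" "\<And>y. snorm N (y - T x) < e \<Longrightarrow> y \<in> B"
      using B unfolding open_snorm by (meson vimageD)
    obtain C M where C: "\<And>x. snorm N (T x) \<le> C * snorm M x"
      using bound by blast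
    have "y \<in> T -` B" if "snorm M (y - x) < e / (\<bar>C\<bar> + 1)" for y
    proof -
      have "snorm N (T y - T x) \<le> C * snorm M (y - x)"
        using C[of "y - x"] by (simp add: linear_diff[OF \<open>linear T\<close>])
      also have "\<dots> \<le> (\<bar>C\<bar> + 1) * snorm M (y - x)"
        by (intro mult_right_mono snorm_nonneg) simp
      also have "\<dots> < e"
        using that by (simp add: field_simps)
      finally show ?thesis
        using N(2) by simp
    qed
    then show "\<exists>N. \<exists>e>0. \<forall>y. snorm N (y - x) < e \<longrightarrow> y \<in> T -` B"
      using N(1) by (intro exI[of _ M] exI[of _ "e / (\<bar>C\<bar> + 1)"]) auto
  qed
  then show "open (T -` B \<inter> UNIV)" by simp
qed

lemma continuous_on_functional_snorm:
  fixes u :: "'a::seminormed_space \<Rightarrow> real"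
  assumes "linear u" and bound: "\<And>x. \<bar>u x\<bar> \<le> C * snorm M x"
  shows "continuous_on UNIV u"
  unfolding continuous_on_open_vimage[OF open_UNIV]
proof (intro allI impI)
  fix B :: "real set"
  assume B: "open B"
  have "open (u -` B)"
    unfolding open_snorm
  proof
    fix x assume "x \<in> u -` B"
    then obtain e where N: "e > 0" "\<And>y. \<bar>y - u x\<bar> < e \<Longrightarrow> y \<in> B"
      using B unfolding open_dist by (auto simp: dist_real_def)
    have "y \<in> u -` B" if "snorm M (y - x) < e / (\<bar>C\<bar> + 1)" for y
    proof -
      have "\<bar>u y - u x\<bar> \<le> C * snorm M (y - x)"
        using bound[of "y - x"] by (simp add: linear_diff[OF \<open>linear u\<close>])
      also have "\<dots> \<le> (\<bar>C\<bar> + 1) * snorm M (y - x)"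
        by (intro mult_right_mono snorm_nonneg) simp
      also have "\<dots> < e"
        using that by (simp add: field_simps)
      finally show ?thesis
        using N(2) by simp
    qed
    then show "\<exists>N. \<exists>e>0. \<forall>y. snorm N (y - x) < e \<longrightarrow> y \<in> u -` B"
      using N(1) by (intro exI[of _ M] exI[of _ "e / (\<bar>C\<bar> + 1)"]) auto
  qed
  then show "open (u -` B \<inter> UNIV)" by simp
qed

section \<open>Spaces of test functions\<close>

text \<open>
  The class covers both the Schwartz space on the real line and the smooth functions on the
  circle. \<open>dom_measure\<close> is Lebesgue measure on the line, respectively on the fundamental
  domain \<open>{0..<1}\<close> of the circle.
\<close>

class test_space = seminormed_space +
  fixes fun_of :: "'a \<Rightarrow> real \<Rightarrow> real"
    and translate :: "real \<Rightarrow> 'a \<Rightarrow> 'a"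
    and dom_measure :: "'a itself \<Rightarrow> real measure"
  assumes fun_of_inject: "fun_of \<phi> = fun_of \<psi> \<longleftrightarrow> \<phi> = \<psi>"
    and fun_of_add: "fun_of (\<phi> + \<psi>) x = fun_of \<phi> x + fun_of \<psi> x"
    and fun_of_scaleR: "fun_of (c *\<^sub>R \<phi>) x = c * fun_of \<phi> x"
    and fun_of_translate: "fun_of (translate a \<phi>) x = fun_of \<phi> (x - a)"
    and fun_of_bound: "\<bar>fun_of \<phi> x\<bar> \<le> snorm 0 \<phi>"
    and translate_bound: "\<exists>C M. \<forall>\<phi>. snorm N (translate a \<phi>) \<le> C * snorm M \<phi>"
    and fun_of_integrable: "integrable (dom_measure TYPE('a)) (fun_of \<phi>)"

lemma linear_fun_of: "linear (\<lambda>\<phi>. fun_of \<phi> x)"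
  by (intro linearI) (simp_all add: fun_of_add fun_of_scaleR)

lemma linear_translate: "linear (translate a)"
  by (intro linearI; subst fun_of_inject[symmetric])
     (simp_all add: fun_eq_iff fun_of_add fun_of_scaleR fun_of_translate)

lemma integrable_fun_of_mult:
  fixes \<phi> \<psi> :: "'a::test_space"
  shows "integrable (dom_measure TYPE('a)) (\<lambda>x. fun_of \<phi> x * fun_of \<psi> x)"
proof (rule Bochner_Integration.integrable_bound)
  show "integrable (dom_measure TYPE('a)) (\<lambda>x. snorm 0 \<psi> * fun_of \<phi> x)"
    by (intro integrable_mult_right fun_of_integrable)
  show "(\<lambda>x. fun_of \<phi> x * fun_of \<psi> x) \<in> borel_measurable (dom_measure TYPE('a))"
    using fun_of_integrable[of \<phi>] fun_of_integrable[of \<psi>] by (intro borel_measurable_times) auto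
  show "AE x in dom_measure TYPE('a).
      norm (fun_of \<phi> x * fun_of \<psi> x) \<le> norm (snorm 0 \<psi> * fun_of \<phi> x)"
  proof (rule AE_I2)
    fix x
    have "\<bar>fun_of \<phi> x\<bar> * \<bar>fun_of \<psi> x\<bar> \<le> \<bar>fun_of \<phi> x\<bar> * snorm 0 \<psi>"
      by (intro mult_left_mono fun_of_bound) simp
    then show "norm (fun_of \<phi> x * fun_of \<psi> x) \<le> norm (snorm 0 \<psi> * fun_of \<phi> x)"
      by (simp add: abs_mult snorm_nonneg mult.commute)
  qed
qed

section \<open>Distributions with the weak* topology\<close>

typedef (overloaded) 'a distribution =
  "{u :: 'a::seminormed_space \<Rightarrow> real. linear u \<and> continuous_on UNIV u}"
  morphisms dapply Distribution
  by (intro exI[of _ "\<lambda>_. 0"]) (simp add: linear_zero)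

setup_lifting type_definition_distribution

instantiation distribution :: (seminormed_space) real_vector
begin

lift_definition zero_distribution :: "'a distribution" is "\<lambda>_. 0"
  by (simp add: linear_zero)

lift_definition plus_distribution :: "'a distribution \<Rightarrow> 'a distribution \<Rightarrow> 'a distribution"
  is "\<lambda>u v \<phi>. u \<phi> + v \<phi>"
  by (auto intro: linear_compose_add continuous_on_add)

lift_definition minus_distribution :: "'a distribution \<Rightarrow> 'a distribution \<Rightarrow> 'a distribution"
  is "\<lambda>u v \<phi>. u \<phi> - v \<phi>"
  by (auto intro: linear_compose_sub continuous_on_diff)

lift_definition uminus_distribution :: "'a distribution \<Rightarrow> 'a distribution"
  is "\<lambda>u \<phi>. - u \<phi>"
  by (auto intro: linear_compose_neg continuous_on_minus)

lift_definition scaleR_distribution :: "real \<Rightarrow> 'a distribution \<Rightarrow> 'a distribution"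
  is "\<lambda>c u \<phi>. c * u \<phi>"
  using linear_compose_scale_right by (fastforce intro: continuous_on_mult_left)

instance
  by (standard; transfer) (auto simp: algebra_simps)

end

text \<open>The topology of pointwise convergence, induced from the product topology on \<open>'a \<Rightarrow> real\<close>.\<close>

instantiation distribution :: (seminormed_space) t2_space
begin

definition open_distribution :: "'a distribution set \<Rightarrow> bool"
  where "open_distribution U \<longleftrightarrow> (\<exists>V. open V \<and> U = dapply -` V)"

instance
proof
  show "open (UNIV :: 'a distribution set)"
    unfolding open_distribution_def by (auto intro: exI[of _ UNIV])
next
  fix S T :: "'a distribution set"
  assume "open S" "open T"
  then obtain V W where "open V" "S = dapply -` V" "open W" "T = dapply -` W"
    unfolding open_distribution_def by auto
  then show "open (S \<inter> T)"
    unfolding open_distribution_def by (intro exI[of _ "V \<inter> W"]) auto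
next
  fix K :: "'a distribution set set"
  assume "\<forall>S\<in>K. open S"
  then obtain F where "\<And>S. S \<in> K \<Longrightarrow> open (F S) \<and> S = dapply -` F S"
    unfolding open_distribution_def by metis
  then show "open (\<Union>K)"
    unfolding open_distribution_def by (intro exI[of _ "\<Union> (F ` K)"]) fastforce
next
  fix u v :: "'a distribution"
  assume "u \<noteq> v"
  then obtain \<phi> where "dapply u \<phi> \<noteq> dapply v \<phi>"
    by (metis dapply_inject ext)
  then obtain A B where AB: "open A" "open B" "dapply u \<phi> \<in> A" "dapply v \<phi> \<in> B" "A \<inter> B = {}"
    by (meson hausdorff)
  have "open ((\<lambda>f::'a \<Rightarrow> real. f \<phi>) -` A)" "open ((\<lambda>f::'a \<Rightarrow> real. f \<phi>) -` B)"
    using AB by (auto intro!: open_vimage)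
  then have "open (dapply -` ((\<lambda>f::'a \<Rightarrow> real. f \<phi>) -` A))"
    "open (dapply -` ((\<lambda>f::'a \<Rightarrow> real. f \<phi>) -` B))"
    unfolding open_distribution_def by blast+
  then show "\<exists>U V. open U \<and> open V \<and> u \<in> U \<and> v \<in> V \<and> U \<inter> V = {}"
    using AB by (intro exI conjI) (assumption+, auto)
qed

end

lift_definition delta :: "'a::test_space distribution" is "\<lambda>\<phi>. fun_of \<phi> 0"
  using continuous_on_functional_snorm[OF linear_fun_of, of 0 1 0] fun_of_bound
  by (auto simp: linear_fun_of)

lemma translate_dual:
  fixes u :: "'a::test_space \<Rightarrow> real"
  assumes "linear u" "continuous_on UNIV u"
  shows "linear (\<lambda>\<phi>. u (translate a \<phi>))" "continuous_on UNIV (\<lambda>\<phi>. u (translate a \<phi>))"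
proof -
  have "continuous_on UNIV (translate a :: 'a \<Rightarrow> 'a)"
    by (intro continuous_on_linear_snorm linear_translate translate_bound)
  then show "continuous_on UNIV (\<lambda>\<phi>. u (translate a \<phi>))"
    using continuous_on_compose2[OF assms(2)] by blast
  show "linear (\<lambda>\<phi>. u (translate a \<phi>))"
    using linear_compose[OF linear_translate assms(1)] by (simp add: o_def)
qed

lift_definition shift :: "real \<Rightarrow> 'a::test_space distribution \<Rightarrow> 'a distribution"
  is "\<lambda>a u \<phi>. u (translate (- a) \<phi>)"
  by (auto intro: translate_dual)

lemma of_test_dual:
  fixes \<phi> :: "'a::test_space"
  shows "linear (\<lambda>\<psi>::'a. \<integral>x. fun_of \<phi> x * fun_of \<psi> x \<partial>dom_measure TYPE('a)) \<and>
    continuous_on UNIV (\<lambda>\<psi>::'a. \<integral>x. fun_of \<phi> x * fun_of \<psi> x \<partial>dom_measure TYPE('a))"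
proof -
  let ?u = "\<lambda>\<psi>::'a. \<integral>x. fun_of \<phi> x * fun_of \<psi> x \<partial>dom_measure TYPE('a)"
  let ?C = "\<integral>x. \<bar>fun_of \<phi> x\<bar> \<partial>dom_measure TYPE('a)"
  have lin: "linear ?u"
  proof (rule linearI)
    fix \<psi> \<eta> :: 'a
    show "?u (\<psi> + \<eta>) = ?u \<psi> + ?u \<eta>"
      by (simp add: fun_of_add distrib_left integrable_fun_of_mult Bochner_Integration.integral_add)
  next
    fix c and \<psi> :: 'a
    show "?u (c *\<^sub>R \<psi>) = c *\<^sub>R ?u \<psi>"
      by (simp add: fun_of_scaleR mult.left_commute)
  qed
  have "\<bar>?u \<psi>\<bar> \<le> ?C * snorm 0 \<psi>" for \<psi> :: 'a
  proof -
    have "\<bar>?u \<psi>\<bar> \<le> (\<integral>x. \<bar>fun_of \<phi> x * fun_of \<psi> x\<bar> \<partial>dom_measure TYPE('a))"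
      by (rule integral_abs_bound)
    also have "\<dots> \<le> (\<integral>x. \<bar>fun_of \<phi> x\<bar> * snorm 0 \<psi> \<partial>dom_measure TYPE('a))"
      using integrable_abs[OF integrable_fun_of_mult[of \<phi> \<psi>]] fun_of_integrable[of \<phi>]
      by (intro integral_mono)
         (auto simp: abs_mult intro!: mult_left_mono fun_of_bound integrable_mult_left)
    finally show ?thesis by simp
  qed
  then have "continuous_on UNIV ?u"
    by (intro continuous_on_functional_snorm[OF lin])
  with lin show ?thesis by blast
qed

lift_definition of_test :: "'a::test_space \<Rightarrow> 'a distribution"
  is "\<lambda>\<phi> \<psi>. \<integral>x. fun_of \<phi> x * fun_of \<psi> x \<partial>dom_measure TYPE('a)"
  using of_test_dual by blast

definition lsi_continuous :: "('a::test_space distribution \<Rightarrow> 'a distribution) \<Rightarrow> bool"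
  where "lsi_continuous A \<longleftrightarrow>
    linear A \<and> (\<forall>a u. A (shift a u) = shift a (A u)) \<and> continuous_on UNIV A"

definition invertible_admissible :: "('a::test_space distribution \<Rightarrow> 'a distribution) \<Rightarrow> bool"
  where "invertible_admissible A \<longleftrightarrow> lsi_continuous A \<and> bij A \<and> lsi_continuous (inv A)"

definition lsi_adjoint ::
    "('a::test_space distribution \<Rightarrow> 'a distribution) \<Rightarrow> ('a distribution \<Rightarrow> 'a distribution)"
  where "lsi_adjoint A = (THE B. lsi_continuous B \<and>
    (\<forall>\<phi>\<^sub>1 \<phi>\<^sub>2. dapply (A (of_test \<phi>\<^sub>1)) \<phi>\<^sub>2 = dapply (B (of_test \<phi>\<^sub>2)) \<phi>\<^sub>1))"

text \<open>
  An LSI continuous operator is determined by its impulse response \<open>g\<close>, and it is the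
  convolution with \<open>g\<close>. This makes sense of \<open>u * g\<close> for every distribution \<open>u\<close>, whenever \<open>g\<close>
  is such an impulse response.
\<close>

definition lsi_convolution :: "'a::test_space distribution \<Rightarrow> 'a distribution \<Rightarrow> 'a distribution"
  where "lsi_convolution u g = (THE K. lsi_continuous K \<and> K delta = g) u"

definition green :: "('a::test_space distribution \<Rightarrow> 'a distribution) \<Rightarrow> 'a distribution"
  where "green A = inv A delta"

section \<open>Square-integrable distributions\<close>

definition represents :: "(real \<Rightarrow> real) \<Rightarrow> 'a::test_space distribution \<Rightarrow> bool"
  where "represents f u \<longleftrightarrow>
    f \<in> borel_measurable (dom_measure TYPE('a)) \<and>
    integrable (dom_measure TYPE('a)) (\<lambda>x. (f x)\<^sup>2) \<and>
    (\<forall>\<phi>. dapply u \<phi> = (\<integral>x. f x * fun_of \<phi> x \<partial>dom_measure TYPE('a)))"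

definition L2 :: "'a::test_space distribution set"
  where "L2 = {u. \<exists>f. represents f u}"

text \<open>
  The representing function is unique up to null sets, so the choice does not affect the
  inner product. The values below are meaningful on \<open>L2\<close> only.
\<close>

definition L2_inner :: "'a::test_space distribution \<Rightarrow> 'a distribution \<Rightarrow> real"
  where "L2_inner u v =
    (\<integral>x. (SOME f. represents f u) x * (SOME g. represents g v) x \<partial>dom_measure TYPE('a))"

definition L2_norm :: "'a::test_space distribution \<Rightarrow> real"
  where "L2_norm u = sqrt (L2_inner u u)"

section \<open>Schwartz functions on the real line\<close>

definition smooth :: "(real \<Rightarrow> real) \<Rightarrow> bool"
  where "smooth f \<longleftrightarrow> (\<forall>n x. (deriv ^^ n) f differentiable at x)"

lemma smooth_DERIV: "smooth f \<Longrightarrow> DERIV ((deriv ^^ n) f) x :> (deriv ^^ Suc n) f x"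
  unfolding smooth_def by (simp add: DERIV_deriv_iff_real_differentiable)

lemma smoothI_DERIV:
  assumes "F 0 = f" "\<And>n x. DERIV (F n) x :> F (Suc n) x"
  shows "smooth f" "(deriv ^^ n) f = F n"
proof -
  have *: "(deriv ^^ n) f = F n" for n
  proof (induction n)
    case (Suc n)
    then show ?case using assms(2) by (auto intro!: ext DERIV_imp_deriv)
  qed (simp add: assms(1))
  show "(deriv ^^ n) f = F n" by (rule *)
  show "smooth f"
    unfolding smooth_def * using assms(2) real_differentiable_def by blast
qed

lemma smooth_continuous: "smooth f \<Longrightarrow> continuous_on A ((deriv ^^ n) f)"
  using smooth_DERIV DERIV_isCont by (blast intro: continuous_at_imp_continuous_on)

lemma smooth_add:
  assumes "smooth f" "smooth g"
  shows "smooth (\<lambda>x. f x + g x)"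
    and "(deriv ^^ n) (\<lambda>x. f x + g x) = (\<lambda>x. (deriv ^^ n) f x + (deriv ^^ n) g x)"
proof -
  let ?F = "\<lambda>n x. (deriv ^^ n) f x + (deriv ^^ n) g x"
  have "?F 0 = (\<lambda>x. f x + g x)" "\<And>n x. DERIV (?F n) x :> ?F (Suc n) x"
    using assms by (auto intro!: DERIV_add smooth_DERIV simp del: funpow.simps simp: funpow_0)
  from smoothI_DERIV[of ?F, OF this]
  show "smooth (\<lambda>x. f x + g x)"
    and "(deriv ^^ n) (\<lambda>x. f x + g x) = (\<lambda>x. (deriv ^^ n) f x + (deriv ^^ n) g x)" by blast+
qed

lemma smooth_cmult:
  assumes "smooth f"
  shows "smooth (\<lambda>x. c * f x)"
    and "(deriv ^^ n) (\<lambda>x. c * f x) = (\<lambda>x. c * (deriv ^^ n) f x)"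
proof -
  let ?F = "\<lambda>n x. c * (deriv ^^ n) f x"
  have "?F 0 = (\<lambda>x. c * f x)" "\<And>n x. DERIV (?F n) x :> ?F (Suc n) x"
    using assms by (auto intro!: DERIV_cmult smooth_DERIV simp del: funpow.simps simp: funpow_0)
  from smoothI_DERIV[of ?F, OF this]
  show "smooth (\<lambda>x. c * f x)"
    and "(deriv ^^ n) (\<lambda>x. c * f x) = (\<lambda>x. c * (deriv ^^ n) f x)" by blast+
qed

lemma smooth_translate:
  assumes "smooth f"
  shows "smooth (\<lambda>x. f (x - a))"
    and "(deriv ^^ n) (\<lambda>x. f (x - a)) = (\<lambda>x. (deriv ^^ n) f (x - a))"
proof -
  let ?F = "\<lambda>n x. (deriv ^^ n) f (x - a)"
  have "DERIV (?F n) x :> ?F (Suc n) x" for n x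
    using DERIV_shift[of "(deriv ^^ n) f" "(deriv ^^ Suc n) f (x - a)" x "- a"]
      smooth_DERIV[OF assms, of n "x - a"] by simp
  moreover have "?F 0 = (\<lambda>x. f (x - a))" by simp
  ultimately show "smooth (\<lambda>x. f (x - a))"
    and "(deriv ^^ n) (\<lambda>x. f (x - a)) = (\<lambda>x. (deriv ^^ n) f (x - a))"
    using smoothI_DERIV[of ?F] by blast+
qed

lemma smooth_zero: "smooth (\<lambda>_. 0)" "(deriv ^^ n) (\<lambda>_. 0) = (\<lambda>_. 0 :: real)"
  using smoothI_DERIV[of "\<lambda>_ _. 0"] by auto

lemma bdd_above_rangeI: "(\<And>x. f x \<le> (M::real)) \<Longrightarrow> bdd_above (range f)"
  unfolding bdd_above_def by auto

lemma bdd_above_rangeD: "bdd_above (range f) \<Longrightarrow> \<exists>M. \<forall>x. f x \<le> (M::real)"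
  unfolding bdd_above_def by auto

definition schwartz_function :: "(real \<Rightarrow> real) \<Rightarrow> bool"
  where "schwartz_function f \<longleftrightarrow>
    smooth f \<and> (\<forall>m n. bdd_above (range (\<lambda>x. (1 + \<bar>x\<bar>) ^ m * \<bar>(deriv ^^ n) f x\<bar>)))"

lemma schwartz_function_add:
  "schwartz_function f \<Longrightarrow> schwartz_function g \<Longrightarrow> schwartz_function (\<lambda>x. f x + g x)"
proof -
  assume "schwartz_function f" "schwartz_function g"
  then have s: "smooth f" "smooth g" and
    b: "\<And>m n. bdd_above (range (\<lambda>x. (1 + \<bar>x\<bar>) ^ m * \<bar>(deriv ^^ n) f x\<bar>))"
      "\<And>m n. bdd_above (range (\<lambda>x. (1 + \<bar>x\<bar>) ^ m * \<bar>(deriv ^^ n) g x\<bar>))"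
    unfolding schwartz_function_def by auto
  have sm: "smooth (\<lambda>x. f x + g x)" by (rule smooth_add[OF s])
  have "bdd_above (range (\<lambda>x. (1 + \<bar>x\<bar>) ^ m * \<bar>(deriv ^^ n) (\<lambda>x. f x + g x) x\<bar>))" for m n
  proof -
    obtain A B where A: "\<And>x. (1 + \<bar>x\<bar>) ^ m * \<bar>(deriv ^^ n) f x\<bar> \<le> A"
      and B: "\<And>x. (1 + \<bar>x\<bar>) ^ m * \<bar>(deriv ^^ n) g x\<bar> \<le> B"
      using bdd_above_rangeD[OF b(1)] bdd_above_rangeD[OF b(2)] by metis
    have "(1 + \<bar>x\<bar>) ^ m * \<bar>(deriv ^^ n) f x + (deriv ^^ n) g x\<bar> \<le> A + B" for x
    proof -
      have "(1 + \<bar>x\<bar>) ^ m * \<bar>(deriv ^^ n) f x + (deriv ^^ n) g x\<bar>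
          \<le> (1 + \<bar>x\<bar>) ^ m * (\<bar>(deriv ^^ n) f x\<bar> + \<bar>(deriv ^^ n) g x\<bar>)"
        by (intro mult_left_mono abs_triangle_ineq) simp
      also have "\<dots> \<le> A + B" using A[of x] B[of x] by (simp add: distrib_left)
      finally show ?thesis .
    qed
    then show ?thesis
      unfolding smooth_add(2)[OF s] by (rule bdd_above_rangeI)
  qed
  with sm show ?thesis unfolding schwartz_function_def by blast
qed

lemma schwartz_function_cmult:
  "schwartz_function f \<Longrightarrow> schwartz_function (\<lambda>x. c * f x)"
proof -
  assume "schwartz_function f"
  then have s: "smooth f" and
    b: "\<And>m n. bdd_above (range (\<lambda>x. (1 + \<bar>x\<bar>) ^ m * \<bar>(deriv ^^ n) f x\<bar>))"
    unfolding schwartz_function_def by auto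
  have sm: "smooth (\<lambda>x. c * f x)" by (rule smooth_cmult[OF s])
  have "bdd_above (range (\<lambda>x. (1 + \<bar>x\<bar>) ^ m * \<bar>(deriv ^^ n) (\<lambda>x. c * f x) x\<bar>))" for m n
  proof -
    obtain A where A: "\<And>x. (1 + \<bar>x\<bar>) ^ m * \<bar>(deriv ^^ n) f x\<bar> \<le> A"
      using bdd_above_rangeD[OF b] by metis
    have "(1 + \<bar>x\<bar>) ^ m * \<bar>c * (deriv ^^ n) f x\<bar> \<le> \<bar>c\<bar> * A" for x
      using mult_left_mono[OF A[of x], of "\<bar>c\<bar>"] by (simp add: abs_mult mult.left_commute)
    then show ?thesis
      unfolding smooth_cmult(2)[OF s] by (rule bdd_above_rangeI)
  qed
  with sm show ?thesis unfolding schwartz_function_def by blast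
qed

lemma translate_weight: "(1 + \<bar>x\<bar>) ^ m \<le> (1 + \<bar>a\<bar>) ^ m * (1 + \<bar>x - a\<bar>) ^ m" for x a :: real
proof -
  have "1 + \<bar>x\<bar> \<le> (1 + \<bar>a\<bar>) * (1 + \<bar>x - a\<bar>)"
    by (simp add: algebra_simps) (smt (verit) mult_nonneg_nonneg)
  then have "(1 + \<bar>x\<bar>) ^ m \<le> ((1 + \<bar>a\<bar>) * (1 + \<bar>x - a\<bar>)) ^ m"
    by (intro power_mono) auto
  then show ?thesis by (simp add: power_mult_distrib)
qed

lemma schwartz_function_translate:
  "schwartz_function f \<Longrightarrow> schwartz_function (\<lambda>x. f (x - a))"
proof -
  assume "schwartz_function f"
  then have s: "smooth f" and
    b: "\<And>m n. bdd_above (range (\<lambda>x. (1 + \<bar>x\<bar>) ^ m * \<bar>(deriv ^^ n) f x\<bar>))"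
    unfolding schwartz_function_def by auto
  have sm: "smooth (\<lambda>x. f (x - a))" by (rule smooth_translate[OF s])
  have "bdd_above (range (\<lambda>x. (1 + \<bar>x\<bar>) ^ m * \<bar>(deriv ^^ n) (\<lambda>x. f (x - a)) x\<bar>))" for m n
  proof -
    obtain A where A: "\<And>x. (1 + \<bar>x\<bar>) ^ m * \<bar>(deriv ^^ n) f x\<bar> \<le> A"
      using bdd_above_rangeD[OF b] by metis
    have "(1 + \<bar>x\<bar>) ^ m * \<bar>(deriv ^^ n) f (x - a)\<bar> \<le> (1 + \<bar>a\<bar>) ^ m * A" for x
    proof -
      have "(1 + \<bar>x\<bar>) ^ m * \<bar>(deriv ^^ n) f (x - a)\<bar>
          \<le> ((1 + \<bar>a\<bar>) ^ m * (1 + \<bar>x - a\<bar>) ^ m) * \<bar>(deriv ^^ n) f (x - a)\<bar>"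
        by (intro mult_right_mono translate_weight) simp
      also have "\<dots> \<le> (1 + \<bar>a\<bar>) ^ m * A"
        unfolding mult.assoc by (intro mult_left_mono A) simp
      finally show ?thesis .
    qed
    then show ?thesis
      unfolding smooth_translate(2)[OF s] by (rule bdd_above_rangeI)
  qed
  with sm show ?thesis unfolding schwartz_function_def by blast
qed

typedef schwartz = "{f. schwartz_function f}"
  morphisms schwartz_fun Schwartz
  by (intro exI[of _ "\<lambda>_. 0"]) (simp add: schwartz_function_def smooth_zero)

setup_lifting type_definition_schwartz

instantiation schwartz :: real_vector
begin

lift_definition zero_schwartz :: schwartz is "\<lambda>_. 0"
  by (simp add: schwartz_function_def smooth_zero)

lift_definition plus_schwartz :: "schwartz \<Rightarrow> schwartz \<Rightarrow> schwartz" is "\<lambda>f g x. f x + g x"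
  by (rule schwartz_function_add)

lift_definition scaleR_schwartz :: "real \<Rightarrow> schwartz \<Rightarrow> schwartz" is "\<lambda>c f x. c * f x"
  by (rule schwartz_function_cmult)

definition uminus_schwartz :: "schwartz \<Rightarrow> schwartz" where "- (f :: schwartz) = (-1) *\<^sub>R f"

definition minus_schwartz :: "schwartz \<Rightarrow> schwartz \<Rightarrow> schwartz" where "(f :: schwartz) - g = f + (-1) *\<^sub>R g"

instance
  by (standard; (unfold uminus_schwartz_def minus_schwartz_def)?; transfer)
     (auto simp: algebra_simps)

end

lemma schwartz_bdd:
  "bdd_above (range (\<lambda>x. (1 + \<bar>x\<bar>) ^ m * \<bar>(deriv ^^ n) (schwartz_fun \<phi>) x\<bar>))"
  using schwartz_fun[of \<phi>] by (simp add: schwartz_function_def)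

lemma schwartz_smooth: "smooth (schwartz_fun \<phi>)"
  using schwartz_fun[of \<phi>] by (simp add: schwartz_function_def)

definition schwartz_seminorm :: "nat \<Rightarrow> nat \<Rightarrow> schwartz \<Rightarrow> real"
  where "schwartz_seminorm m n \<phi> = (SUP x. (1 + \<bar>x\<bar>) ^ m * \<bar>(deriv ^^ n) (schwartz_fun \<phi>) x\<bar>)"

lemma schwartz_seminorm_upper:
  "(1 + \<bar>x\<bar>) ^ m * \<bar>(deriv ^^ n) (schwartz_fun \<phi>) x\<bar> \<le> schwartz_seminorm m n \<phi>"
  unfolding schwartz_seminorm_def by (intro cSUP_upper schwartz_bdd) simp

lemma schwartz_seminorm_least:
  "(\<And>x. (1 + \<bar>x\<bar>) ^ m * \<bar>(deriv ^^ n) (schwartz_fun \<phi>) x\<bar> \<le> B) \<Longrightarrow> schwartz_seminorm m n \<phi> \<le> B"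
  unfolding schwartz_seminorm_def by (intro cSUP_least) auto

lemma schwartz_seminorm_nonneg: "0 \<le> schwartz_seminorm m n \<phi>"
  using schwartz_seminorm_upper[of 0 m n \<phi>] by (auto intro: order_trans[rotated])

lemma schwartz_seminorm_triangle:
  "schwartz_seminorm m n (\<phi> + \<psi>) \<le> schwartz_seminorm m n \<phi> + schwartz_seminorm m n \<psi>"
proof (rule schwartz_seminorm_least)
  fix x
  have "(1 + \<bar>x\<bar>) ^ m * \<bar>(deriv ^^ n) (schwartz_fun (\<phi> + \<psi>)) x\<bar>
      \<le> (1 + \<bar>x\<bar>) ^ m * (\<bar>(deriv ^^ n) (schwartz_fun \<phi>) x\<bar> + \<bar>(deriv ^^ n) (schwartz_fun \<psi>) x\<bar>)"
    unfolding plus_schwartz.rep_eq smooth_add(2)[OF schwartz_smooth schwartz_smooth]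
    by (intro mult_left_mono abs_triangle_ineq) simp
  also have "\<dots> \<le> schwartz_seminorm m n \<phi> + schwartz_seminorm m n \<psi>"
    using schwartz_seminorm_upper[of x m n \<phi>] schwartz_seminorm_upper[of x m n \<psi>]
    by (simp add: distrib_left)
  finally show "(1 + \<bar>x\<bar>) ^ m * \<bar>(deriv ^^ n) (schwartz_fun (\<phi> + \<psi>)) x\<bar>
      \<le> schwartz_seminorm m n \<phi> + schwartz_seminorm m n \<psi>" .
qed

lemma schwartz_seminorm_scaleR:
  "schwartz_seminorm m n (c *\<^sub>R \<phi>) = \<bar>c\<bar> * schwartz_seminorm m n \<phi>"
proof -
  have le: "schwartz_seminorm m n (c *\<^sub>R \<phi>) \<le> \<bar>c\<bar> * schwartz_seminorm m n \<phi>" for c \<phi>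
  proof (rule schwartz_seminorm_least)
    fix x
    show "(1 + \<bar>x\<bar>) ^ m * \<bar>(deriv ^^ n) (schwartz_fun (c *\<^sub>R \<phi>)) x\<bar> \<le> \<bar>c\<bar> * schwartz_seminorm m n \<phi>"
      unfolding scaleR_schwartz.rep_eq smooth_cmult(2)[OF schwartz_smooth]
      using mult_left_mono[OF schwartz_seminorm_upper[of x m n \<phi>], of "\<bar>c\<bar>"]
      by (simp add: abs_mult mult.left_commute)
  qed
  show ?thesis
  proof (cases "c = 0")
    case True
    then show ?thesis
      using le[of 0 \<phi>] schwartz_seminorm_nonneg[of m n "0 *\<^sub>R \<phi>"] by simp
  next
    case False
    then have "\<bar>c\<bar> * schwartz_seminorm m n \<phi> \<le> \<bar>c\<bar> * (\<bar>inverse c\<bar> * schwartz_seminorm m n (c *\<^sub>R \<phi>))"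
      using le[of "inverse c" "c *\<^sub>R \<phi>"] by (intro mult_left_mono) auto
    also have "\<dots> = schwartz_seminorm m n (c *\<^sub>R \<phi>)"
      using False by (simp add: field_simps abs_inverse)
    finally show ?thesis using le[of c \<phi>] by simp
  qed
qed

lemma schwartz_seminorm_mono: "m \<le> m' \<Longrightarrow> schwartz_seminorm m n \<phi> \<le> schwartz_seminorm m' n \<phi>"
proof (rule schwartz_seminorm_least)
  fix x assume "m \<le> m'"
  then have "(1 + \<bar>x\<bar>) ^ m * \<bar>(deriv ^^ n) (schwartz_fun \<phi>) x\<bar>
      \<le> (1 + \<bar>x\<bar>) ^ m' * \<bar>(deriv ^^ n) (schwartz_fun \<phi>) x\<bar>"
    by (intro mult_right_mono power_increasing) auto
  then show "(1 + \<bar>x\<bar>) ^ m * \<bar>(deriv ^^ n) (schwartz_fun \<phi>) x\<bar> \<le> schwartz_seminorm m' n \<phi>"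
    using schwartz_seminorm_upper order_trans by blast
qed

instantiation schwartz :: test_space
begin

definition snorm_schwartz :: "nat \<Rightarrow> schwartz \<Rightarrow> real"
  where "snorm_schwartz N \<phi> = (\<Sum>n\<le>N. schwartz_seminorm N n \<phi>)"

lemma snorm_schwartz_mono: "M \<le> N \<Longrightarrow> snorm M \<phi> \<le> snorm N (\<phi> :: schwartz)"
proof -
  assume MN: "M \<le> N"
  have "snorm M \<phi> \<le> (\<Sum>n\<le>M. schwartz_seminorm N n \<phi>)"
    unfolding snorm_schwartz_def by (intro sum_mono schwartz_seminorm_mono MN)
  also have "\<dots> \<le> snorm N \<phi>"
    unfolding snorm_schwartz_def using MN
    by (intro sum_mono2 schwartz_seminorm_nonneg) auto
  finally show ?thesis .
qed

definition open_schwartz :: "schwartz set \<Rightarrow> bool"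
  where "open_schwartz = seminorm_open (snorm :: nat \<Rightarrow> schwartz \<Rightarrow> real)"

definition fun_of_schwartz :: "schwartz \<Rightarrow> real \<Rightarrow> real"
  where "fun_of_schwartz = schwartz_fun"

definition dom_measure_schwartz :: "schwartz itself \<Rightarrow> real measure"
  where "dom_measure_schwartz _ = lborel"

lift_definition translate_schwartz :: "real \<Rightarrow> schwartz \<Rightarrow> schwartz" is "\<lambda>a f x. f (x - a)"
  by (rule schwartz_function_translate)

lemma schwartz_seminorm_translate:
  "schwartz_seminorm m n (translate a \<phi>) \<le> (1 + \<bar>a\<bar>) ^ m * schwartz_seminorm m n \<phi>"
proof (rule schwartz_seminorm_least)
  fix x
  have "(1 + \<bar>x\<bar>) ^ m * \<bar>(deriv ^^ n) (schwartz_fun \<phi>) (x - a)\<bar>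
      \<le> ((1 + \<bar>a\<bar>) ^ m * (1 + \<bar>x - a\<bar>) ^ m) * \<bar>(deriv ^^ n) (schwartz_fun \<phi>) (x - a)\<bar>"
    by (intro mult_right_mono translate_weight) simp
  also have "\<dots> \<le> (1 + \<bar>a\<bar>) ^ m * schwartz_seminorm m n \<phi>"
    unfolding mult.assoc by (intro mult_left_mono schwartz_seminorm_upper) simp
  finally show "(1 + \<bar>x\<bar>) ^ m * \<bar>(deriv ^^ n) (schwartz_fun (translate a \<phi>)) x\<bar>
      \<le> (1 + \<bar>a\<bar>) ^ m * schwartz_seminorm m n \<phi>"
    unfolding translate_schwartz.rep_eq smooth_translate(2)[OF schwartz_smooth] .
qed

lemma integrable_schwartz_fun: "integrable lborel (schwartz_fun \<phi>)"
proof (rule Bochner_Integration.integrable_bound)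
  show "integrable lborel (\<lambda>x. schwartz_seminorm 2 0 \<phi> * inverse (1 + x\<^sup>2))"
    using integrable_inverse_1_plus_square
    by (intro integrable_mult_right) (simp add: set_integrable_def)
  show "schwartz_fun \<phi> \<in> borel_measurable lborel"
    using smooth_continuous[OF schwartz_smooth, of UNIV 0 \<phi>]
    by (simp add: borel_measurable_continuous_onI)
  show "AE x in lborel. norm (schwartz_fun \<phi> x)
      \<le> norm (schwartz_seminorm 2 0 \<phi> * inverse (1 + x\<^sup>2))"
  proof (rule AE_I2)
    fix x :: real
    have pos: "0 < 1 + x\<^sup>2" by (simp add: add_pos_nonneg)
    have "(1 + x\<^sup>2) * \<bar>schwartz_fun \<phi> x\<bar> \<le> (1 + \<bar>x\<bar>)\<^sup>2 * \<bar>schwartz_fun \<phi> x\<bar>"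
      by (intro mult_right_mono) (auto simp: power2_sum)
    also have "\<dots> \<le> schwartz_seminorm 2 0 \<phi>"
      using schwartz_seminorm_upper[of x 2 0 \<phi>] by simp
    finally have "\<bar>schwartz_fun \<phi> x\<bar> \<le> schwartz_seminorm 2 0 \<phi> * inverse (1 + x\<^sup>2)"
      using pos by (simp add: field_simps)
    then show "norm (schwartz_fun \<phi> x) \<le> norm (schwartz_seminorm 2 0 \<phi> * inverse (1 + x\<^sup>2))"
      by (metis abs_ge_self order_trans real_norm_def)
  qed
qed

instance
proof
  fix \<phi> \<psi> :: schwartz and a c x :: real and M N :: nat and U :: "schwartz set"
  show "open (UNIV :: schwartz set)"
    unfolding open_schwartz_def by (rule seminorm_open_UNIV)
  show "open (U \<inter> V)" if "open U" "open V" for V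
    using that unfolding open_schwartz_def by (intro seminorm_open_Int snorm_schwartz_mono)
  show "open (\<Union>K)" if "\<forall>U\<in>K. open U" for K :: "schwartz set set"
    using that unfolding open_schwartz_def by (rule seminorm_open_Union)
  show "snorm N (\<phi> + \<psi>) \<le> snorm N \<phi> + snorm N \<psi>"
    unfolding snorm_schwartz_def sum.distrib[symmetric]
    by (intro sum_mono schwartz_seminorm_triangle)
  show "snorm N (c *\<^sub>R \<phi>) = \<bar>c\<bar> * snorm N \<phi>"
    unfolding snorm_schwartz_def sum_distrib_left schwartz_seminorm_scaleR ..
  show "snorm M \<phi> \<le> snorm N \<phi>" if "M \<le> N"
    using that by (rule snorm_schwartz_mono)
  show "open U \<longleftrightarrow> (\<forall>x\<in>U. \<exists>N. \<exists>e>0. \<forall>y. snorm N (y - x) < e \<longrightarrow> y \<in> U)"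
    unfolding open_schwartz_def by (rule seminorm_open_def)
  show "fun_of \<phi> = fun_of \<psi> \<longleftrightarrow> \<phi> = \<psi>"
    unfolding fun_of_schwartz_def by (rule schwartz_fun_inject)
  show "fun_of (\<phi> + \<psi>) x = fun_of \<phi> x + fun_of \<psi> x"
    "fun_of (c *\<^sub>R \<phi>) x = c * fun_of \<phi> x"
    "fun_of (translate a \<phi>) x = fun_of \<phi> (x - a)"
    unfolding fun_of_schwartz_def by (transfer, simp)+
  show "\<bar>fun_of \<phi> x\<bar> \<le> snorm 0 \<phi>"
    using schwartz_seminorm_upper[of x 0 0 \<phi>] by (simp add: snorm_schwartz_def fun_of_schwartz_def)
  have "snorm N (translate a \<phi>) \<le> (1 + \<bar>a\<bar>) ^ N * snorm N \<phi>" for \<phi> :: schwartz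
    unfolding snorm_schwartz_def sum_distrib_left by (intro sum_mono schwartz_seminorm_translate)
  then show "\<exists>C M. \<forall>\<phi> :: schwartz. snorm N (translate a \<phi>) \<le> C * snorm M \<phi>" by blast
  show "integrable (dom_measure TYPE(schwartz)) (fun_of \<phi>)"
    unfolding dom_measure_schwartz_def fun_of_schwartz_def by (rule integrable_schwartz_fun)
qed

end

section \<open>Smooth 1-periodic functions\<close>

typedef circle_test = "{f. smooth f \<and> (\<forall>x. f (x + 1) = f x)}"
  morphisms circle_fun Circle_test
  by (intro exI[of _ "\<lambda>_. 0"]) (simp add: smooth_zero)

setup_lifting type_definition_circle_test

instantiation circle_test :: real_vector
begin

lift_definition zero_circle_test :: circle_test is "\<lambda>_. 0"
  by (simp add: smooth_zero)

lift_definition plus_circle_test :: "circle_test \<Rightarrow> circle_test \<Rightarrow> circle_test" is "\<lambda>f g x. f x + g x"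
  by (simp add: smooth_add)

lift_definition scaleR_circle_test :: "real \<Rightarrow> circle_test \<Rightarrow> circle_test" is "\<lambda>c f x. c * f x"
  by (simp add: smooth_cmult)

definition uminus_circle_test :: "circle_test \<Rightarrow> circle_test" where "- (f :: circle_test) = (-1) *\<^sub>R f"

definition minus_circle_test :: "circle_test \<Rightarrow> circle_test \<Rightarrow> circle_test"
  where "(f :: circle_test) - g = f + (-1) *\<^sub>R g"

instance
  by (standard; (unfold uminus_circle_test_def minus_circle_test_def)?; transfer)
     (auto simp: algebra_simps)

end

lemma circle_smooth: "smooth (circle_fun \<theta>)"
  using circle_fun by blast

lemma circle_periodic: "(deriv ^^ n) (circle_fun \<theta>) (x + 1) = (deriv ^^ n) (circle_fun \<theta>) x"
proof -
  have "(\<lambda>x. circle_fun \<theta> (x - (-1))) = circle_fun \<theta>"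
    using circle_fun[of \<theta>] by (auto simp: fun_eq_iff)
  then show ?thesis
    using fun_cong[OF smooth_translate(2)[OF circle_smooth, of n \<theta> "-1"], of x] by simp
qed

lemma periodic_frac:
  fixes f :: "real \<Rightarrow> 'b"
  assumes per: "\<And>x. f (x + 1) = f x"
  shows "f x = f (frac x)"
proof -
  have nat: "f (x + real n) = f x" for x n
  proof (induction n)
    case (Suc n)
    then show ?case using per[of "x + real n"] by (simp add: add_ac)
  qed simp
  have "f (x + of_int k) = f x" for x k
  proof (cases "k \<ge> 0")
    case True
    then show ?thesis using nat[of x "nat k"] by simp
  next
    case False
    then show ?thesis using nat[of "x + of_int k" "nat (- k)"] by simp
  qed
  from this[of "frac x" "\<lfloor>x\<rfloor>"] show ?thesis by (simp add: frac_def)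
qed

lemma circle_bdd: "bdd_above (range (\<lambda>x. \<bar>(deriv ^^ n) (circle_fun \<theta>) x\<bar>))"
proof -
  let ?f = "(deriv ^^ n) (circle_fun \<theta>)"
  have "compact (?f ` {0..1})"
    by (intro compact_continuous_image smooth_continuous circle_smooth compact_Icc)
  then have "bounded (?f ` {0..1})" by (rule compact_imp_bounded)
  then obtain B where B: "\<And>x. x \<in> {0..1} \<Longrightarrow> \<bar>?f x\<bar> \<le> B"
    unfolding bounded_iff by (metis imageI real_norm_def)
  have "\<bar>?f x\<bar> \<le> B" for x
    using B[of "frac x"] periodic_frac[of ?f x, OF circle_periodic] frac_lt_1[of x]
    by (simp add: less_imp_le)
  then show ?thesis by (rule bdd_above_rangeI)
qed

definition circle_seminorm :: "nat \<Rightarrow> circle_test \<Rightarrow> real"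
  where "circle_seminorm n \<theta> = (SUP x. \<bar>(deriv ^^ n) (circle_fun \<theta>) x\<bar>)"

lemma circle_seminorm_upper: "\<bar>(deriv ^^ n) (circle_fun \<theta>) x\<bar> \<le> circle_seminorm n \<theta>"
  unfolding circle_seminorm_def by (intro cSUP_upper circle_bdd) simp

lemma circle_seminorm_least:
  "(\<And>x. \<bar>(deriv ^^ n) (circle_fun \<theta>) x\<bar> \<le> B) \<Longrightarrow> circle_seminorm n \<theta> \<le> B"
  unfolding circle_seminorm_def by (intro cSUP_least) auto

lemma circle_seminorm_nonneg: "0 \<le> circle_seminorm n \<theta>"
  using circle_seminorm_upper[of n \<theta> 0] by linarith

lemma circle_seminorm_triangle:
  "circle_seminorm n (\<theta> + \<eta>) \<le> circle_seminorm n \<theta> + circle_seminorm n \<eta>"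
proof (rule circle_seminorm_least)
  fix x
  show "\<bar>(deriv ^^ n) (circle_fun (\<theta> + \<eta>)) x\<bar> \<le> circle_seminorm n \<theta> + circle_seminorm n \<eta>"
    unfolding plus_circle_test.rep_eq smooth_add(2)[OF circle_smooth circle_smooth]
    using circle_seminorm_upper[of n \<theta> x] circle_seminorm_upper[of n \<eta> x] by linarith
qed

lemma circle_seminorm_scaleR: "circle_seminorm n (c *\<^sub>R \<theta>) = \<bar>c\<bar> * circle_seminorm n \<theta>"
proof -
  have le: "circle_seminorm n (c *\<^sub>R \<theta>) \<le> \<bar>c\<bar> * circle_seminorm n \<theta>" for c \<theta>
  proof (rule circle_seminorm_least)
    fix x
    show "\<bar>(deriv ^^ n) (circle_fun (c *\<^sub>R \<theta>)) x\<bar> \<le> \<bar>c\<bar> * circle_seminorm n \<theta>"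
      unfolding scaleR_circle_test.rep_eq smooth_cmult(2)[OF circle_smooth]
      using mult_left_mono[OF circle_seminorm_upper[of n \<theta> x], of "\<bar>c\<bar>"] by (simp add: abs_mult)
  qed
  show ?thesis
  proof (cases "c = 0")
    case True
    then show ?thesis
      using le[of 0 \<theta>] circle_seminorm_nonneg[of n "0 *\<^sub>R \<theta>"] by simp
  next
    case False
    then have "\<bar>c\<bar> * circle_seminorm n \<theta> \<le> \<bar>c\<bar> * (\<bar>inverse c\<bar> * circle_seminorm n (c *\<^sub>R \<theta>))"
      using le[of "inverse c" "c *\<^sub>R \<theta>"] by (intro mult_left_mono) auto
    also have "\<dots> = circle_seminorm n (c *\<^sub>R \<theta>)"
      using False by (simp add: field_simps abs_inverse)
    finally show ?thesis using le[of c \<theta>] by simp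
  qed
qed

instantiation circle_test :: test_space
begin

definition snorm_circle_test :: "nat \<Rightarrow> circle_test \<Rightarrow> real"
  where "snorm_circle_test N \<theta> = (\<Sum>n\<le>N. circle_seminorm n \<theta>)"

lemma snorm_circle_test_mono: "M \<le> N \<Longrightarrow> snorm M \<theta> \<le> snorm N (\<theta> :: circle_test)"
  unfolding snorm_circle_test_def by (intro sum_mono2 circle_seminorm_nonneg) auto

definition open_circle_test :: "circle_test set \<Rightarrow> bool"
  where "open_circle_test = seminorm_open (snorm :: nat \<Rightarrow> circle_test \<Rightarrow> real)"

definition fun_of_circle_test :: "circle_test \<Rightarrow> real \<Rightarrow> real"
  where "fun_of_circle_test = circle_fun"

definition dom_measure_circle_test :: "circle_test itself \<Rightarrow> real measure"
  where "dom_measure_circle_test _ = restrict_space lborel {0..<1}"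

lift_definition translate_circle_test :: "real \<Rightarrow> circle_test \<Rightarrow> circle_test"
  is "\<lambda>a f x. f (x - a)"
  by (simp add: smooth_translate) (metis add_diff_eq diff_add_eq)

lemma circle_seminorm_translate: "circle_seminorm n (translate a \<theta>) \<le> circle_seminorm n \<theta>"
  by (rule circle_seminorm_least)
     (simp add: translate_circle_test.rep_eq smooth_translate(2)[OF circle_smooth] circle_seminorm_upper)

lemma integrable_circle_fun: "integrable (restrict_space lborel {0..<1}) (circle_fun \<theta>)"
proof (rule finite_measure.integrable_const_bound)
  show "finite_measure (restrict_space lborel {0..<1::real})"
    by (intro finite_measureI) (simp add: emeasure_restrict_space space_restrict_space)
  show "AE x in restrict_space lborel {0..<1}. norm (circle_fun \<theta> x) \<le> circle_seminorm 0 \<theta>"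
    using circle_seminorm_upper[of 0 \<theta>] by (intro AE_I2) simp
  have "circle_fun \<theta> \<in> borel_measurable lborel"
    using smooth_continuous[OF circle_smooth, of UNIV 0 \<theta>]
    by (simp add: borel_measurable_continuous_onI)
  then show "circle_fun \<theta> \<in> borel_measurable (restrict_space lborel {0..<1})"
    by (rule measurable_restrict_space1)
qed

instance
proof
  fix \<theta> \<eta> :: circle_test and a c x :: real and M N :: nat and U :: "circle_test set"
  show "open (UNIV :: circle_test set)"
    unfolding open_circle_test_def by (rule seminorm_open_UNIV)
  show "open (U \<inter> V)" if "open U" "open V" for V
    using that unfolding open_circle_test_def by (intro seminorm_open_Int snorm_circle_test_mono)
  show "open (\<Union>K)" if "\<forall>U\<in>K. open U" for K :: "circle_test set set"
    using that unfolding open_circle_test_def by (rule seminorm_open_Union)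
  show "snorm N (\<theta> + \<eta>) \<le> snorm N \<theta> + snorm N \<eta>"
    unfolding snorm_circle_test_def sum.distrib[symmetric]
    by (intro sum_mono circle_seminorm_triangle)
  show "snorm N (c *\<^sub>R \<theta>) = \<bar>c\<bar> * snorm N \<theta>"
    unfolding snorm_circle_test_def sum_distrib_left circle_seminorm_scaleR ..
  show "snorm M \<theta> \<le> snorm N \<theta>" if "M \<le> N"
    using that by (rule snorm_circle_test_mono)
  show "open U \<longleftrightarrow> (\<forall>x\<in>U. \<exists>N. \<exists>e>0. \<forall>y. snorm N (y - x) < e \<longrightarrow> y \<in> U)"
    unfolding open_circle_test_def by (rule seminorm_open_def)
  show "fun_of \<theta> = fun_of \<eta> \<longleftrightarrow> \<theta> = \<eta>"
    unfolding fun_of_circle_test_def by (rule circle_fun_inject)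
  show "fun_of (\<theta> + \<eta>) x = fun_of \<theta> x + fun_of \<eta> x"
    "fun_of (c *\<^sub>R \<theta>) x = c * fun_of \<theta> x"
    "fun_of (translate a \<theta>) x = fun_of \<theta> (x - a)"
    unfolding fun_of_circle_test_def by (transfer, simp)+
  show "\<bar>fun_of \<theta> x\<bar> \<le> snorm 0 \<theta>"
    using circle_seminorm_upper[of 0 \<theta> x] by (simp add: snorm_circle_test_def fun_of_circle_test_def)
  have "snorm N (translate a \<theta>) \<le> 1 * snorm N \<theta>" for \<theta> :: circle_test
    unfolding snorm_circle_test_def mult_1 by (intro sum_mono circle_seminorm_translate)
  then show "\<exists>C M. \<forall>\<theta> :: circle_test. snorm N (translate a \<theta>) \<le> C * snorm M \<theta>" by blast
  show "integrable (dom_measure TYPE(circle_test)) (fun_of \<theta>)"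
    unfolding dom_measure_circle_test_def fun_of_circle_test_def by (rule integrable_circle_fun)
qed

end

type_synonym tempered = "schwartz distribution"
type_synonym periodic = "circle_test distribution"

section \<open>Periodization\<close>

definition is_periodization :: "schwartz \<Rightarrow> circle_test \<Rightarrow> bool"
  where "is_periodization \<psi> \<theta> \<longleftrightarrow>
    (\<forall>x. ((\<lambda>n. fun_of \<psi> (x - of_int n)) has_sum fun_of \<theta> x) (UNIV :: int set))"

text \<open>
  The identification of a 1-periodic tempered distribution \<open>w\<close> with a continuous linear functional
  \<open>v\<close> on the smooth periodic functions: \<open>v\<close> acts by integration over one period, hence
  \<open>\<langle>w, \<psi>\<rangle> = \<langle>v, \<Sum>\<^sub>n \<psi>(\<cdot> - n)\<rangle>\<close> for every Schwartz function \<open>\<psi>\<close>. Every smooth periodic function is the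
  periodization of some Schwartz function, so \<open>v\<close> is determined by \<open>w\<close>.
\<close>

definition same_periodic :: "tempered \<Rightarrow> periodic \<Rightarrow> bool"
  where "same_periodic w v \<longleftrightarrow>
    (\<forall>\<psi> \<theta>. is_periodization \<psi> \<theta> \<longrightarrow> dapply w \<psi> = dapply v \<theta>)"

definition shift_sum :: "tempered \<Rightarrow> nat \<Rightarrow> tempered"
  where "shift_sum u N = (\<Sum>n\<in>{- int N..int N}. shift (of_int n) u)"

definition periodizable :: "tempered \<Rightarrow> bool"
  where "periodizable u \<longleftrightarrow> convergent (shift_sum u)"

definition Per :: "tempered \<Rightarrow> periodic"
  where "Per u = (THE v. same_periodic (lim (shift_sum u)) v)"

lemma dapply_sum: "dapply (sum f A) \<phi> = (\<Sum>i\<in>A. dapply (f i) \<phi>)"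
  by (induction A rule: infinite_finite_induct)
     (simp_all add: zero_distribution.rep_eq plus_distribution.rep_eq)

text \<open>Under this identification \<open>delta :: periodic\<close> is the Dirac comb \<open>\<Sum>\<^sub>k \<delta>(\<cdot> - k)\<close>.\<close>

lemma periodic_delta_is_dirac_comb:
  assumes "is_periodization \<psi> \<theta>"
  shows "(\<lambda>N. dapply (shift_sum delta N) \<psi>) \<longlonglongrightarrow> dapply (delta :: periodic) \<theta>"
proof -
  have "((\<lambda>n. fun_of \<psi> (- of_int n)) has_sum fun_of \<theta> 0) (UNIV :: int set)"
    using assms[unfolded is_periodization_def, rule_format, of 0] by simp
  then have "((\<lambda>n. fun_of \<psi> (of_int n)) has_sum fun_of \<theta> 0) (UNIV :: int set)"
    using has_sum_reindex[of uminus "UNIV :: int set" "\<lambda>n. fun_of \<psi> (of_int n)" "fun_of \<theta> 0"]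
    by (simp add: o_def inj_on_def)
  then have lim: "(sum (\<lambda>n. fun_of \<psi> (of_int n)) \<longlongrightarrow> fun_of \<theta> 0) (finite_subsets_at_top (UNIV :: int set))"
    unfolding has_sum_def .
  have "filterlim (\<lambda>N. {- int N..int N}) (finite_subsets_at_top UNIV) sequentially"
    unfolding filterlim_finite_subsets_at_top
  proof (intro allI impI)
    fix X :: "int set"
    assume "finite X \<and> X \<subseteq> UNIV"
    then have "finite X" by simp
    then have B: "\<bar>k\<bar> \<le> Max (abs ` X)" if "k \<in> X" for k
      using that by (intro Max_ge) auto
    have "X \<subseteq> {- int N..int N}" if "nat (Max (abs ` X)) \<le> N" for N
    proof
      fix k assume "k \<in> X"
      then have "\<bar>k\<bar> \<le> int N" using B that by fastforce
      then show "k \<in> {- int N..int N}" by auto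
    qed
    then show "\<forall>\<^sub>F N in sequentially. finite {- int N..int N} \<and> X \<subseteq> {- int N..int N} \<and> {- int N..int N} \<subseteq> UNIV"
      unfolding eventually_sequentially by (intro exI[of _ "nat (Max (abs ` X))"]) auto
  qed
  from filterlim_compose[OF lim this]
  show ?thesis
    by (simp add: shift_sum_def dapply_sum shift.rep_eq delta.rep_eq fun_of_translate o_def)
qed

section \<open>The optimization problem\<close>

definition native_space ::
    "(tempered \<Rightarrow> tempered) \<Rightarrow> (periodic \<Rightarrow> periodic) \<Rightarrow> (tempered \<times> periodic) set"
  where "native_space L\<^sub>T L\<^sub>S = (inv L\<^sub>T ` L2) \<times> (inv L\<^sub>S ` L2)"

definition measurement ::
    "(tempered \<Rightarrow> tempered) \<Rightarrow> (periodic \<Rightarrow> periodic) \<Rightarrow> tempered \<Rightarrow> tempered \<times> periodic \<Rightarrow> real"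
  where "measurement L\<^sub>T L\<^sub>S \<phi> = (\<lambda>(fT, fS).
    L2_inner (L\<^sub>T fT) (lsi_adjoint (inv L\<^sub>T) \<phi>) + L2_inner (L\<^sub>S fS) (lsi_adjoint (inv L\<^sub>S) (Per \<phi>)))"

definition cost ::
    "(tempered \<Rightarrow> tempered) \<Rightarrow> (periodic \<Rightarrow> periodic) \<Rightarrow> ('l::finite \<Rightarrow> tempered)
      \<Rightarrow> real ^ 'l \<Rightarrow> real \<Rightarrow> tempered \<times> periodic \<Rightarrow> real"
  where "cost L\<^sub>T L\<^sub>S \<phi> y lam = (\<lambda>(fT, fS).
    (norm (y - (\<chi> l. measurement L\<^sub>T L\<^sub>S (\<phi> l) (fT, fS))))\<^sup>2
      + lam * ((L2_norm (L\<^sub>T fT))\<^sup>2 + (L2_norm (L\<^sub>S fS))\<^sup>2))"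

definition gram ::
    "(tempered \<Rightarrow> tempered) \<Rightarrow> (periodic \<Rightarrow> periodic) \<Rightarrow> ('l::finite \<Rightarrow> tempered) \<Rightarrow> real ^ 'l ^ 'l"
  where "gram L\<^sub>T L\<^sub>S \<phi> = (\<chi> l\<^sub>1 l\<^sub>2.
    L2_inner (lsi_adjoint (inv L\<^sub>T) (\<phi> l\<^sub>1)) (lsi_adjoint (inv L\<^sub>T) (\<phi> l\<^sub>2))
      + L2_inner (lsi_adjoint (inv L\<^sub>S) (Per (\<phi> l\<^sub>1))) (lsi_adjoint (inv L\<^sub>S) (Per (\<phi> l\<^sub>2))))"

end

theory Submission
  imports Defs
begin

text \<open>
  Substituting \<open>w = (L\<^sub>T f\<^sub>T, L\<^sub>S f\<^sub>S)\<close> turns the problem into regularized least squares on the Hilbert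
  space \<open>L\<^sub>2(\<real>) \<times> L\<^sub>2(T)\<close>, where the minimizer is read off by completing the square. It remains to see
  that the objects of the statement are the expected ones. An LSI continuous operator \<open>A\<close> satisfies
  \<open>\<langle>A \<phi>, \<psi>\<rangle> = \<langle>g, \<phi> \<star> \<psi>\<rangle>\<close>, with \<open>g = A \<delta>\<close> and \<open>\<star>\<close> the correlation of test functions. As
  \<open>\<phi> \<star> \<psi> = R \<psi> \<star> R \<phi>\<close> for the reflection \<open>(R \<phi>)(x) = \<phi>(-x)\<close>, the adjoint of \<open>A\<close> is the conjugate
  \<open>R A R\<close>. Hence taking adjoints commutes with taking inverses, and convolution with the Green's
  function of \<open>L\<^sup>*L\<close> is the operator \<open>L\<^sup>-\<^sup>1L\<^sup>-\<^sup>1\<^sup>*\<close>. Finally, du Bois-Reymond's lemma makes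
  the representing function of a square-integrable distribution unique, so that \<open>L2_inner\<close> is an
  inner product.
\<close>

section \<open>Distributions and their test functions\<close>

text \<open>Adjoint and convolution are given by \<open>THE\<close>, so everything about them rests
  on existence and uniqueness for LSI operators. Both start from weak* continuity:
  \<open>\<lambda>u. dapply (A u) \<phi>\<close> is evaluation at a test function, the transpose of
  \<phi>, and shifted deltas reveal its values. The obstacle is the correlation formula, which
  requires pulling the distribution \<open>A delta\<close> out of an integral of translates in a
  space topologized by seminorms. In place of an integral with values in the test space,
  \<open>dapply_convolve\<close> works with seminorm bounds and differentiates in a cutoff point.
  The cutoff destroys smoothness of the weight, so weights are only asked to be measurable and
  rapidly decreasing. The same generality admits weights cut off to one period, so that
  \<open>convolution_space\<close> covers line and circle with all convolutions taken over the line.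
  The uniqueness of representing functions needs test functions concentrating on intervals, which
  are built from a quadratic on the line and from a cosine on the circle.\<close>

definition rapidly_decreasing :: "(real \<Rightarrow> real) \<Rightarrow> bool"
  where "rapidly_decreasing w \<longleftrightarrow>
    w \<in> borel_measurable borel \<and> (\<forall>m. \<exists>K. \<forall>x. (1 + \<bar>x\<bar>) ^ m * \<bar>w x\<bar> \<le> K)"

lemma rapidly_decreasing_measurable: "rapidly_decreasing w \<Longrightarrow> w \<in> borel_measurable borel"
  by (simp add: rapidly_decreasing_def)

lemma rapidly_decreasing_mult_indicator:
  assumes "rapidly_decreasing w" "A \<in> sets borel"
  shows "rapidly_decreasing (\<lambda>x. w x * indicator A x)"
proof -
  have [measurable]: "w \<in> borel_measurable borel" "A \<in> sets borel"
    using assms by (auto simp: rapidly_decreasing_def)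
  have "\<exists>K. \<forall>x. (1 + \<bar>x\<bar>) ^ m * \<bar>w x * indicator A x\<bar> \<le> K" for m
  proof -
    obtain K where K: "\<And>x. (1 + \<bar>x\<bar>) ^ m * \<bar>w x\<bar> \<le> K"
      using assms(1) unfolding rapidly_decreasing_def by metis
    have "(1 + \<bar>x\<bar>) ^ m * \<bar>w x * indicator A x\<bar> \<le> K" for x
    proof -
      have "\<bar>w x * indicator A x\<bar> \<le> \<bar>w x\<bar>" by (simp add: indicator_def)
      then have "(1 + \<bar>x\<bar>) ^ m * \<bar>w x * indicator A x\<bar> \<le> (1 + \<bar>x\<bar>) ^ m * \<bar>w x\<bar>"
        by (intro mult_left_mono) auto
      with K[of x] show ?thesis by linarith
    qed
    then show ?thesis by blast
  qed
  then show ?thesis unfolding rapidly_decreasing_def by simp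
qed

lemma integrable_rapidly_decreasing_weight:
  assumes "rapidly_decreasing w"
  shows "integrable lborel (\<lambda>x. \<bar>w x\<bar> * (1 + \<bar>x\<bar>) ^ m)"
proof -
  have [measurable]: "w \<in> borel_measurable borel"
    using assms by (rule rapidly_decreasing_measurable)
  \<comment> \<open>Two extra powers of the weight pay for the integrable factor
    \<open>inverse (1 + x\<^sup>2)\<close>.\<close>
  obtain K where K: "\<And>x. (1 + \<bar>x\<bar>) ^ (m + 2) * \<bar>w x\<bar> \<le> K"
    using assms unfolding rapidly_decreasing_def by metis
  show ?thesis
  proof (rule Bochner_Integration.integrable_bound)
    show "integrable lborel (\<lambda>x. K * inverse (1 + x\<^sup>2))"
      using integrable_inverse_1_plus_square
      by (intro integrable_mult_right) (simp add: set_integrable_def)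
    show "(\<lambda>x. \<bar>w x\<bar> * (1 + \<bar>x\<bar>) ^ m) \<in> borel_measurable lborel" by simp
    show "AE x in lborel. norm (\<bar>w x\<bar> * (1 + \<bar>x\<bar>) ^ m) \<le> norm (K * inverse (1 + x\<^sup>2))"
    proof (rule AE_I2)
      fix x :: real
      let ?u = "\<bar>w x\<bar> * (1 + \<bar>x\<bar>) ^ m"
      have pos: "0 < 1 + x\<^sup>2" by (simp add: add_pos_nonneg)
      have "(1 + x\<^sup>2) * ?u \<le> (1 + \<bar>x\<bar>)\<^sup>2 * ?u"
        by (intro mult_right_mono) (auto simp: power2_sum)
      also have "\<dots> \<le> K" using K[of x] by (simp add: power_add power2_eq_square mult_ac)
      finally have "?u \<le> K * inverse (1 + x\<^sup>2)"
        using pos by (simp add: field_simps)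
      then show "norm ?u \<le> norm (K * inverse (1 + x\<^sup>2))" by simp
    qed
  qed
qed

lemma integrable_rapidly_decreasing_mult:
  assumes "rapidly_decreasing w" "f \<in> borel_measurable borel"
    and "\<And>x. \<bar>f x\<bar> \<le> C * (1 + \<bar>x\<bar>) ^ m"
  shows "integrable lborel (\<lambda>x. w x * f x)"
proof (rule Bochner_Integration.integrable_bound)
  have [measurable]: "w \<in> borel_measurable borel" "f \<in> borel_measurable borel"
    using assms by (auto simp: rapidly_decreasing_def)
  show "integrable lborel (\<lambda>x. C * (\<bar>w x\<bar> * (1 + \<bar>x\<bar>) ^ m))"
    by (intro integrable_mult_right integrable_rapidly_decreasing_weight assms)
  show "(\<lambda>x. w x * f x) \<in> borel_measurable lborel" by simp
  show "AE x in lborel. norm (w x * f x) \<le> norm (C * (\<bar>w x\<bar> * (1 + \<bar>x\<bar>) ^ m))"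
  proof (rule AE_I2)
    fix x
    have "\<bar>w x\<bar> * \<bar>f x\<bar> \<le> \<bar>w x\<bar> * (C * (1 + \<bar>x\<bar>) ^ m)"
      by (intro mult_left_mono assms) simp
    then show "norm (w x * f x) \<le> norm (C * (\<bar>w x\<bar> * (1 + \<bar>x\<bar>) ^ m))"
      by (simp add: abs_mult mult_ac) (smt (verit) mult_right_mono mult_nonneg_nonneg zero_le_power abs_ge_zero abs_ge_self)
  qed
qed

text \<open>
  \<open>convolution_ex\<close> bounds \<open>\<integral> w(x) (\<phi>(\<cdot> + x) - \<eta>) dx\<close> by the integral of the seminorms of the integrand,
  up to the number of derivatives involved. With \<open>\<eta> = 0\<close> it controls the tails of the convolution, and
  with \<open>\<eta> = \<phi>(\<cdot> + t)\<close> its behaviour for weights supported near \<open>t\<close>. In \<open>kernel_ex\<close>, the weight is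
  \<open>\<phi>\<close> cut off to the fundamental domain.
\<close>

class convolution_space = test_space +
  assumes reflection_ex: "\<exists>\<psi>. (\<forall>x. fun_of \<psi> x = fun_of \<phi> (- x)) \<and> (\<forall>N. snorm N \<psi> \<le> snorm N \<phi>)"
    and continuous_fun_of: "continuous_on UNIV (fun_of \<phi>)"
    and snorm_translate: "snorm N (translate (- x) \<phi>) \<le> (1 + \<bar>x\<bar>) ^ N * snorm N \<phi>"
    and snorm_translate_diff: "snorm N (translate (- x) \<phi> - translate (- t) \<phi>)
      \<le> \<bar>x - t\<bar> * (1 + \<bar>x\<bar> + \<bar>t\<bar>) ^ N * snorm (Suc N) \<phi>"
    and convolution_ex: "rapidly_decreasing w \<Longrightarrow>
      \<exists>\<psi>. (\<forall>y. fun_of \<psi> y = (\<integral>x. w x * fun_of \<phi> (y + x) \<partial>lborel)) \<and>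
        (\<forall>N \<eta> B. (\<forall>x. w x \<noteq> 0 \<longrightarrow> snorm N (translate (- x) \<phi> - \<eta>) \<le> B x) \<longrightarrow>
          integrable lborel (\<lambda>x. \<bar>w x\<bar> * B x) \<longrightarrow>
          snorm N (\<psi> - (\<integral>x. w x \<partial>lborel) *\<^sub>R \<eta>) \<le> real (Suc N) * (\<integral>x. \<bar>w x\<bar> * B x \<partial>lborel))"
    and kernel_ex: "\<exists>w. rapidly_decreasing w \<and>
      (\<forall>f. (\<integral>x. fun_of \<phi> x * f x \<partial>dom_measure TYPE('a)) = (\<integral>x. w x * f x \<partial>lborel))"
    and integral_dom_shift: "(\<integral>x. fun_of \<phi> (x + a) * fun_of \<psi> (x + a) \<partial>dom_measure TYPE('a))
      = (\<integral>x. fun_of \<phi> x * fun_of \<psi> x \<partial>dom_measure TYPE('a))"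
    and integral_dom_reflect: "(\<integral>x. fun_of \<phi> (- x) * fun_of \<psi> (- x) \<partial>dom_measure TYPE('a))
      = (\<integral>x. fun_of \<phi> x * fun_of \<psi> x \<partial>dom_measure TYPE('a))"
    and integral_dom_square_eq_0: "(\<integral>x. fun_of \<phi> x * fun_of \<phi> x \<partial>dom_measure TYPE('a)) = 0 \<Longrightarrow> \<phi> = 0"
    and du_bois_reymond: "f \<in> borel_measurable (dom_measure TYPE('a)) \<Longrightarrow>
      integrable (dom_measure TYPE('a)) (\<lambda>x. (f x)\<^sup>2) \<Longrightarrow>
      (\<And>\<phi>. (\<integral>x. f x * fun_of \<phi> x \<partial>dom_measure TYPE('a)) = 0) \<Longrightarrow>
      AE x in dom_measure TYPE('a). f x = 0"

lemma fun_of_zero [simp]: "fun_of 0 x = 0"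
  using fun_of_scaleR[of 0 0 x] by simp

lemma fun_of_diff: "fun_of (\<phi> - \<psi>) x = fun_of \<phi> x - fun_of (\<psi> :: 'a::test_space) x"
  using linear_diff[OF linear_fun_of[of x]] by blast

lemma fun_of_eqI: "(\<And>x. fun_of \<phi> x = fun_of \<psi> x) \<Longrightarrow> \<phi> = (\<psi> :: 'a::test_space)"
  by (subst fun_of_inject[symmetric]) (rule ext)

lemma linear_dapply: "linear (dapply u)"
  using dapply[of u] by simp

text \<open>The preimage of the interval (-1, 1) contains a seminorm ball around 0, and homogeneity
  turns this into a bound on the whole space.\<close>

lemma dapply_bound:
  fixes u :: "'a::seminormed_space distribution"
  shows "\<exists>C N. C \<ge> 0 \<and> (\<forall>\<phi>. \<bar>dapply u \<phi>\<bar> \<le> C * snorm N \<phi>)"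
proof -
  have cont: "continuous_on UNIV (dapply u)"
    using dapply[of u] by simp
  have "open (dapply u -` {-1<..<1} \<inter> UNIV)"
    using cont open_greaterThanLessThan unfolding continuous_on_open_vimage[OF open_UNIV] by blast
  moreover have "0 \<in> dapply u -` {-1<..<1} \<inter> UNIV"
    by (simp add: linear_0[OF linear_dapply])
  ultimately obtain N e where e: "e > 0"
    and N: "\<And>\<phi>. snorm N (\<phi> - 0) < e \<Longrightarrow> \<phi> \<in> dapply u -` {-1<..<1} \<inter> UNIV"
    unfolding open_snorm by meson
  have scale: "\<bar>dapply u \<phi>\<bar> * c \<le> 1" if "c > 0" "c * snorm N \<phi> < e" for c \<phi>
  proof -
    have "\<bar>dapply u (c *\<^sub>R \<phi>)\<bar> < 1"
      using N[of "c *\<^sub>R \<phi>"] that by (auto simp: snorm_scaleR)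
    then show ?thesis
      using that by (simp add: linear_cmul[OF linear_dapply] abs_mult mult.commute)
  qed
  \<comment> \<open>The factor 2 keeps the rescaled \<phi> strictly inside the ball. If the seminorm
    of \<phi> is 0, all multiples of \<phi> lie in the ball, which forces the value 0.\<close>
  have "\<bar>dapply u \<phi>\<bar> \<le> (2 / e) * snorm N \<phi>" for \<phi>
  proof (cases "snorm N \<phi> = 0")
    case True
    have "\<bar>dapply u \<phi>\<bar> \<le> 0"
    proof (rule ccontr)
      assume "\<not> \<bar>dapply u \<phi>\<bar> \<le> 0"
      then show False
        using scale[of "2 / \<bar>dapply u \<phi>\<bar>" \<phi>] True e by simp
    qed
    then show ?thesis using True by simp
  next
    case False
    then have pos: "snorm N \<phi> > 0"
      using snorm_nonneg[of N \<phi>] by linarith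
    then show ?thesis
      using scale[of "e / (2 * snorm N \<phi>)" \<phi>] e by (simp add: field_simps)
  qed
  then show ?thesis
    using e by (intro exI[of _ "2 / e"] exI[of _ N]) simp
qed

section \<open>Weak* continuous functionals on distributions\<close>

lemma dapply_zero [simp]: "dapply 0 \<phi> = 0"
  by (simp add: zero_distribution.rep_eq)

lemma dapply_eqI: "(\<And>\<phi>. dapply u \<phi> = dapply v \<phi>) \<Longrightarrow> u = v"
  by (metis dapply_inject ext)

text \<open>The classical fact that a functional vanishing on a finite intersection of kernels is a
  combination of the corresponding functionals. A combination of evaluations at test functions is
  again the evaluation at one test function.\<close>

lemma finite_kernel_representation:
  fixes f :: "'a::seminormed_space distribution \<Rightarrow> real"
  assumes "finite S" "linear f" "\<And>u. \<forall>\<phi>\<in>S. dapply u \<phi> = 0 \<Longrightarrow> f u = 0"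
  shows "\<exists>\<phi>. \<forall>u. f u = dapply u \<phi>"
  using assms
proof (induction S arbitrary: f rule: finite_induct)
  case empty
  then show ?case
    by (intro exI[of _ 0]) (simp add: linear_0[OF linear_dapply])
next
  case (insert \<psi> S)
  show ?case
  proof (cases "\<forall>u. (\<forall>\<phi>\<in>S. dapply u \<phi> = 0) \<longrightarrow> dapply u \<psi> = 0")
    case True
    then show ?thesis
      using insert by (metis insert_iff)
  next
    case False
    then obtain v where v: "\<And>\<phi>. \<phi> \<in> S \<Longrightarrow> dapply v \<phi> = 0" "dapply v \<psi> \<noteq> 0"
      by blast
    \<comment> \<open>This choice makes \<open>?f\<close> vanish at \<open>v\<close>. Any
      \<open>u\<close> that kills \<open>S\<close> differs by a multiple of \<open>v\<close> from
      one that kills \<psi> as well, so \<open>?f\<close> falls under the induction hypothesis for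
      \<open>S\<close>.\<close>
    define c where "c = f v / dapply v \<psi>"
    let ?f = "\<lambda>u. f u - c * dapply u \<psi>"
    have lin: "linear ?f"
      by (intro linearI)
         (simp_all add: linear_add[OF \<open>linear f\<close>] linear_cmul[OF \<open>linear f\<close>]
            plus_distribution.rep_eq scaleR_distribution.rep_eq algebra_simps)
    have "?f u = 0" if u: "\<forall>\<phi>\<in>S. dapply u \<phi> = 0" for u
    proof -
      let ?u = "u - (dapply u \<psi> / dapply v \<psi>) *\<^sub>R v"
      have "\<forall>\<phi>\<in>insert \<psi> S. dapply ?u \<phi> = 0"
        using u v by (simp add: minus_distribution.rep_eq scaleR_distribution.rep_eq)
      then have "f ?u = 0" by (rule insert.prems(2))
      then show ?thesis
        using v(2)
        by (simp add: linear_diff[OF \<open>linear f\<close>] linear_cmul[OF \<open>linear f\<close>] c_def field_simps)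
    qed
    then obtain \<phi> where \<phi>: "\<And>u. ?f u = dapply u \<phi>"
      using insert.IH[OF lin] by auto
    have "f u = dapply u (\<phi> + c *\<^sub>R \<psi>)" for u
      using \<phi>[of u] by (simp add: linear_add[OF linear_dapply] linear_cmul[OF linear_dapply])
    then show ?thesis by blast
  qed
qed

text \<open>A basic neighbourhood of 0 in the product topology constrains the values at finitely
  many test functions only. A distribution vanishing at these stays in the neighbourhood under all
  scalings, so a functional that is bounded there vanishes on it, and the finite case
  applies.\<close>

lemma weak_star_dual:
  fixes f :: "'a::seminormed_space distribution \<Rightarrow> real"
  assumes lin: "linear f" and cont: "continuous_on UNIV f"
  shows "\<exists>\<phi>. \<forall>u. f u = dapply u \<phi>"
proof -
  have "open (f -` {-1<..<1} \<inter> UNIV)"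
    using cont open_greaterThanLessThan unfolding continuous_on_open_vimage[OF open_UNIV] by blast
  then obtain V where V: "open V" "f -` {-1<..<1} = dapply -` V"
    unfolding open_distribution_def by auto
  have "dapply 0 \<in> V"
    using V(2) linear_0[OF lin] by (metis greaterThanLessThan_iff neg_less_0_iff_less vimageE vimageI2 zero_less_one)
  moreover have "openin (product_topology (\<lambda>_. euclidean) UNIV) V"
    using V(1) by (simp add: open_fun_def)
  ultimately obtain X where X: "dapply 0 \<in> Pi\<^sub>E UNIV X" "\<And>i. open (X i)"
      "finite {i. X i \<noteq> UNIV}" "Pi\<^sub>E UNIV X \<subseteq> V"
    using product_topology_open_contains_basis[of "\<lambda>_. euclidean" UNIV V "dapply 0"] by auto
  let ?S = "{i. X i \<noteq> UNIV}"
  have "f u = 0" if u: "\<forall>\<phi>\<in>?S. dapply u \<phi> = 0" for u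
  proof (rule ccontr)
    assume "f u \<noteq> 0"
    \<comment> \<open>Scaled so that \<open>f\<close> takes the value 2, outside the interval (-1,
      1).\<close>
    let ?u = "(2 / f u) *\<^sub>R u"
    have "dapply ?u \<in> Pi\<^sub>E UNIV X"
    proof -
      have "dapply ?u \<phi> \<in> X \<phi>" for \<phi>
      proof (cases "\<phi> \<in> ?S")
        case True
        then show ?thesis
          using u X(1) by (auto simp: PiE_iff scaleR_distribution.rep_eq)
      qed auto
      then show ?thesis by auto
    qed
    then have "?u \<in> f -` {-1<..<1}"
      using X(4) V(2) by auto
    then show False
      using \<open>f u \<noteq> 0\<close> by (simp add: linear_cmul[OF lin])
  qed
  then show ?thesis
    using X(3) by (intro finite_kernel_representation[of ?S] lin) auto
qed

section \<open>LSI operators and their adjoints\<close>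

definition reflection :: "'a::convolution_space \<Rightarrow> 'a"
  where "reflection \<phi> = (SOME \<psi>. (\<forall>x. fun_of \<psi> x = fun_of \<phi> (- x)) \<and> (\<forall>N. snorm N \<psi> \<le> snorm N \<phi>))"

lemma fun_of_reflection [simp]: "fun_of (reflection \<phi>) x = fun_of \<phi> (- x)"
  and snorm_reflection: "snorm N (reflection \<phi>) \<le> snorm N \<phi>"
  using someI_ex[OF reflection_ex[of \<phi>]] unfolding reflection_def by auto

lemma linear_reflection: "linear (reflection :: 'a::convolution_space \<Rightarrow> 'a)"
  by (intro linearI fun_of_eqI) (simp_all add: fun_of_add fun_of_scaleR)

lemma reflection_reflection [simp]: "reflection (reflection \<phi>) = \<phi>"
  by (intro fun_of_eqI) simp

lemma reflection_translate: "reflection (translate a \<phi>) = translate (- a) (reflection \<phi>)"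
  by (intro fun_of_eqI) (simp add: fun_of_translate)

lift_definition dreflect :: "'a::convolution_space distribution \<Rightarrow> 'a distribution"
  is "\<lambda>u \<phi>. u (reflection \<phi>)"
proof -
  fix u :: "'a \<Rightarrow> real"
  assume u: "linear u \<and> continuous_on UNIV u"
  have "\<exists>C M. \<forall>\<phi>::'a. snorm N (reflection \<phi>) \<le> C * snorm M \<phi>" for N
    using snorm_reflection[of N] by (intro exI[of _ 1] exI[of _ N] allI) simp
  then have "continuous_on UNIV (reflection :: 'a \<Rightarrow> 'a)"
    by (intro continuous_on_linear_snorm linear_reflection)
  then have "continuous_on UNIV (\<lambda>\<phi>. u (reflection \<phi>))"
    using continuous_on_compose2[of UNIV u UNIV reflection] u by auto
  moreover have "linear (\<lambda>\<phi>. u (reflection \<phi>))"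
    using linear_compose[OF linear_reflection, of u] u by (simp add: o_def)
  ultimately show "linear (\<lambda>\<phi>. u (reflection \<phi>)) \<and> continuous_on UNIV (\<lambda>\<phi>. u (reflection \<phi>))"
    by blast
qed

lemma dreflect_dreflect [simp]: "dreflect (dreflect u) = u"
  by (intro dapply_eqI) (simp add: dreflect.rep_eq)

lemma linear_dreflect: "linear dreflect"
  by (intro linearI dapply_eqI)
     (simp_all add: dreflect.rep_eq plus_distribution.rep_eq scaleR_distribution.rep_eq)

lemma dreflect_shift: "dreflect (shift a u) = shift (- a) (dreflect u)"
  by (intro dapply_eqI) (simp add: dreflect.rep_eq shift.rep_eq reflection_translate)

lemma dreflect_of_test: "dreflect (of_test \<phi>) = of_test (reflection \<phi>)"
proof (rule dapply_eqI)
  fix \<psi> :: 'a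
  show "dapply (dreflect (of_test \<phi>)) \<psi> = dapply (of_test (reflection \<phi>)) \<psi>"
    using integral_dom_reflect[of "reflection \<phi>" \<psi>] by (simp add: dreflect.rep_eq of_test.rep_eq)
qed

lemma continuous_dapply: "continuous_on UNIV (\<lambda>u. dapply u \<phi>)"
  unfolding continuous_on_open_vimage[OF open_UNIV]
proof (intro allI impI)
  fix B :: "real set"
  assume "open B"
  then have "open ((\<lambda>f. f \<phi>) -` B)"
    by (intro open_vimage) auto
  then show "open ((\<lambda>u. dapply u \<phi>) -` B \<inter> UNIV)"
    unfolding open_distribution_def by auto
qed

lemma continuous_on_distributionI:
  fixes A :: "'a::topological_space \<Rightarrow> 'b::seminormed_space distribution"
  assumes "\<And>\<phi>. continuous_on UNIV (\<lambda>u. dapply (A u) \<phi>)"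
  shows "continuous_on UNIV A"
proof -
  have cont: "continuous_on UNIV (\<lambda>u. dapply (A u))"
    using assms by (rule continuous_on_coordinatewise_then_product)
  show ?thesis
    unfolding continuous_on_open_vimage[OF open_UNIV]
  proof (intro allI impI)
    fix U :: "'b distribution set"
    assume "open U"
    then obtain V where "open V" "U = dapply -` V"
      unfolding open_distribution_def by blast
    then show "open (A -` U \<inter> UNIV)"
      using cont unfolding continuous_on_open_vimage[OF open_UNIV]
      by (auto simp: vimage_def)
  qed
qed

lemma continuous_dreflect: "continuous_on UNIV dreflect"
  by (intro continuous_on_distributionI) (simp add: dreflect.rep_eq continuous_dapply)

lemma lsi_continuous_compose:
  assumes "lsi_continuous A" "lsi_continuous B"
  shows "lsi_continuous (A \<circ> B)"
  using assms linear_compose[of B A] continuous_on_compose[of UNIV B A] continuous_on_subset[of UNIV A]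
  by (simp add: lsi_continuous_def)

lemma lsi_continuous_reflect_conjugate:
  assumes "lsi_continuous A"
  shows "lsi_continuous (dreflect \<circ> A \<circ> dreflect)"
proof -
  have lin: "linear A" and cont: "continuous_on UNIV A"
    and sh: "\<And>a u. A (shift a u) = shift a (A u)"
    using assms by (auto simp: lsi_continuous_def)
  have "continuous_on UNIV (dreflect \<circ> A \<circ> dreflect)"
    by (intro continuous_on_compose continuous_dreflect
        continuous_on_subset[OF cont] continuous_on_subset[OF continuous_dreflect]) auto
  then show ?thesis
    using linear_compose[OF linear_dreflect linear_compose[OF lin linear_dreflect]]
    by (simp add: lsi_continuous_def sh dreflect_shift o_assoc)
qed

lemma shift_delta: "dapply (shift a delta) \<phi> = fun_of \<phi> a"
  by (simp add: shift.rep_eq delta.rep_eq fun_of_translate)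

text \<open>The value of \<open>A u\<close> at \<phi> depends weak* continuously on
  \<open>u\<close>, hence is evaluation at some \<psi>. Taking for \<open>u\<close> the delta at
  \<open>x\<close> reads off \<psi> at \<open>x\<close>, and shift invariance moves the shift from
  \<open>A\<close> to \<phi>.\<close>

lemma lsi_continuous_transpose:
  fixes A :: "'a::test_space distribution \<Rightarrow> 'a distribution"
  assumes "lsi_continuous A"
  shows "\<exists>\<psi>. (\<forall>u. dapply (A u) \<phi> = dapply u \<psi>) \<and>
    (\<forall>x. fun_of \<psi> x = dapply (A delta) (translate (- x) \<phi>))"
proof -
  have lin: "linear A" and cont: "continuous_on UNIV A"
    and sh: "\<And>a u. A (shift a u) = shift a (A u)"
    using assms by (auto simp: lsi_continuous_def)
  have "linear (\<lambda>u. dapply (A u) \<phi>)"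
    by (intro linearI)
       (simp_all add: linear_add[OF lin] linear_cmul[OF lin] plus_distribution.rep_eq scaleR_distribution.rep_eq)
  moreover have "continuous_on UNIV (\<lambda>u. dapply (A u) \<phi>)"
    using continuous_on_compose2[OF continuous_dapply cont] by simp
  ultimately obtain \<psi> where \<psi>: "\<And>u. dapply (A u) \<phi> = dapply u \<psi>"
    using weak_star_dual by metis
  have "fun_of \<psi> x = dapply (A delta) (translate (- x) \<phi>)" for x
    using \<psi>[of "shift x delta"] by (simp add: sh shift_delta) (simp add: shift.rep_eq)
  with \<psi> show ?thesis by blast
qed

text \<open>The transpose is expressed through the impulse response alone. This makes the
  \<open>THE\<close> in \<open>lsi_convolution\<close> well defined.\<close>

lemma lsi_continuous_eqI:
  fixes A B :: "'a::test_space distribution \<Rightarrow> 'a distribution"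
  assumes A: "lsi_continuous A" and B: "lsi_continuous B" and eq: "A delta = B delta"
  shows "A = B"
proof (rule ext, rule dapply_eqI)
  fix u and \<phi> :: 'a
  obtain \<psi> where \<psi>: "\<And>u. dapply (A u) \<phi> = dapply u \<psi>"
      "\<And>x. fun_of \<psi> x = dapply (A delta) (translate (- x) \<phi>)"
    using lsi_continuous_transpose[OF A, of \<phi>] by auto
  obtain \<eta> where \<eta>: "\<And>u. dapply (B u) \<phi> = dapply u \<eta>"
      "\<And>x. fun_of \<eta> x = dapply (B delta) (translate (- x) \<phi>)"
    using lsi_continuous_transpose[OF B, of \<phi>] by auto
  have "\<psi> = \<eta>"
    using \<psi>(2) \<eta>(2) eq by (intro fun_of_eqI) simp
  then show "dapply (A u) \<phi> = dapply (B u) \<phi>"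
    by (simp add: \<psi>(1) \<eta>(1))
qed

lemma lsi_convolution_eq:
  assumes "lsi_continuous K"
  shows "lsi_convolution u (K delta) = K u"
proof -
  have "(THE K'. lsi_continuous K' \<and> K' delta = K delta) = K"
    using assms lsi_continuous_eqI by (intro the_equality) auto
  then show ?thesis by (simp add: lsi_convolution_def)
qed

text \<open>A single test function decides: applied to the difference of the two transposes, the
  hypothesis says that this difference has vanishing square integral. It supplies the uniqueness
  behind the \<open>THE\<close> in \<open>lsi_adjoint\<close>.\<close>

lemma lsi_continuous_eq_of_test:
  fixes A B :: "'a::convolution_space distribution \<Rightarrow> 'a distribution"
  assumes A: "lsi_continuous A" and B: "lsi_continuous B" and eq: "\<And>\<phi>. A (of_test \<phi>) = B (of_test \<phi>)"
  shows "A = B"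
proof (rule ext, rule dapply_eqI)
  fix u and \<phi> :: 'a
  obtain \<psi> where \<psi>: "\<And>u. dapply (A u) \<phi> = dapply u \<psi>"
    using lsi_continuous_transpose[OF A, of \<phi>] by auto
  obtain \<eta> where \<eta>: "\<And>u. dapply (B u) \<phi> = dapply u \<eta>"
    using lsi_continuous_transpose[OF B, of \<phi>] by auto
  have "dapply (of_test (\<psi> - \<eta>)) \<psi> = dapply (of_test (\<psi> - \<eta>)) \<eta>"
    unfolding \<psi>[symmetric] \<eta>[symmetric] eq ..
  then have "dapply (of_test (\<psi> - \<eta>)) (\<psi> - \<eta>) = 0"
    by (simp add: linear_diff[OF linear_dapply])
  then have "\<psi> - \<eta> = 0"
    by (intro integral_dom_square_eq_0) (simp add: of_test.rep_eq)
  then show "dapply (A u) \<phi> = dapply (B u) \<phi>"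
    by (simp add: \<psi>(1) \<eta>(1))
qed

section \<open>Weighted superpositions of translates, and their interchange with a
  distribution\<close>

definition convolve :: "(real \<Rightarrow> real) \<Rightarrow> 'a::convolution_space \<Rightarrow> 'a"
  where "convolve w \<phi> = (SOME \<psi>. (\<forall>y. fun_of \<psi> y = (\<integral>x. w x * fun_of \<phi> (y + x) \<partial>lborel)) \<and>
        (\<forall>N \<eta> B. (\<forall>x. w x \<noteq> 0 \<longrightarrow> snorm N (translate (- x) \<phi> - \<eta>) \<le> B x) \<longrightarrow>
          integrable lborel (\<lambda>x. \<bar>w x\<bar> * B x) \<longrightarrow>
          snorm N (\<psi> - (\<integral>x. w x \<partial>lborel) *\<^sub>R \<eta>) \<le> real (Suc N) * (\<integral>x. \<bar>w x\<bar> * B x \<partial>lborel)))"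

context
  fixes w :: "real \<Rightarrow> real" and \<phi> :: "'a::convolution_space"
  assumes w: "rapidly_decreasing w"
begin

lemma fun_of_convolve: "fun_of (convolve w \<phi>) y = (\<integral>x. w x * fun_of \<phi> (y + x) \<partial>lborel)"
  using someI_ex[OF convolution_ex[OF w, of \<phi>]] unfolding convolve_def[symmetric] by blast

lemma snorm_convolve_diff:
  assumes "\<And>x. w x \<noteq> 0 \<Longrightarrow> snorm N (translate (- x) \<phi> - \<eta>) \<le> B x"
    and "integrable lborel (\<lambda>x. \<bar>w x\<bar> * B x)"
  shows "snorm N (convolve w \<phi> - (\<integral>x. w x \<partial>lborel) *\<^sub>R \<eta>) \<le> real (Suc N) * (\<integral>x. \<bar>w x\<bar> * B x \<partial>lborel)"
  using someI_ex[OF convolution_ex[OF w, of \<phi>]] assms unfolding convolve_def[symmetric] by blast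

lemma snorm_convolve:
  "snorm N (convolve w \<phi>) \<le> real (Suc N) * snorm N \<phi> * (\<integral>x. \<bar>w x\<bar> * (1 + \<bar>x\<bar>) ^ N \<partial>lborel)"
  using snorm_convolve_diff[of N 0 "\<lambda>x. (1 + \<bar>x\<bar>) ^ N * snorm N \<phi>"] snorm_translate[of N _ \<phi>]
    integrable_mult_left[OF integrable_rapidly_decreasing_weight[OF w, of N], of "snorm N \<phi>"]
  by (simp add: mult_ac)

end

lemma integrable_mult_fun_of:
  fixes \<phi> :: "'a::convolution_space"
  assumes "rapidly_decreasing w"
  shows "integrable lborel (\<lambda>x. w x * fun_of \<phi> (y + x))"
proof (rule integrable_rapidly_decreasing_mult[OF assms, of _ "snorm 0 \<phi>" 0])
  show "(\<lambda>x. fun_of \<phi> (y + x)) \<in> borel_measurable borel"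
    by (intro borel_measurable_continuous_onI continuous_on_compose2[OF continuous_fun_of]) (auto intro: continuous_intros)
qed (simp add: fun_of_bound)

lemma convolve_add:
  fixes \<phi> :: "'a::convolution_space"
  assumes "rapidly_decreasing v" "rapidly_decreasing w" "rapidly_decreasing (\<lambda>x. v x + w x)"
  shows "convolve (\<lambda>x. v x + w x) \<phi> = convolve v \<phi> + convolve w \<phi>"
  using assms
  by (intro fun_of_eqI) (simp add: fun_of_convolve fun_of_add distrib_right integrable_mult_fun_of)

text \<open>
  The defect of the interchange is additive in the weight and quadratically small
  on short intervals, so cutting the weight off at a moving point gives a function with
  vanishing derivative.
\<close>

lemma dapply_convolve:
  fixes u :: "'a::convolution_space distribution"
  assumes w: "rapidly_decreasing w"
  shows "dapply u (convolve w \<phi>) = (\<integral>x. w x * dapply u (translate (- x) \<phi>) \<partial>lborel)"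
proof -
  obtain C N where C: "C \<ge> 0" and CN: "\<And>\<phi>. \<bar>dapply u \<phi>\<bar> \<le> C * snorm N \<phi>"
    using dapply_bound[of u] by auto
  define h where "h x = dapply u (translate (- x) \<phi>)" for x
  \<comment> \<open>One constant for two bounds: the size of \<open>h\<close> costs the seminorm of
    order \<open>N\<close>, its increments the one of order \<open>Suc N\<close>.\<close>
  define S where "S = snorm N \<phi> + snorm (Suc N) \<phi>"
  have S: "0 \<le> snorm N \<phi>" "snorm N \<phi> \<le> S" "snorm (Suc N) \<phi> \<le> S" "S \<ge> 0"
    using snorm_nonneg[of N \<phi>] snorm_nonneg[of "Suc N" \<phi>] by (auto simp: S_def)
  have h_bound: "\<bar>h x\<bar> \<le> C * S * (1 + \<bar>x\<bar>) ^ N" for x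
  proof -
    have "\<bar>h x\<bar> \<le> C * ((1 + \<bar>x\<bar>) ^ N * snorm N \<phi>)"
      unfolding h_def by (rule order_trans[OF CN mult_left_mono[OF snorm_translate C]])
    also have "\<dots> \<le> C * ((1 + \<bar>x\<bar>) ^ N * S)"
      using C S by (intro mult_left_mono) auto
    finally show ?thesis by (simp add: mult_ac)
  qed
  \<comment> \<open>Staying within distance 1 of \<open>t\<close> gives \<open>1 + \<bar>x\<bar> +
    \<bar>t\<bar> \<le> 2 + 2 * \<bar>t\<bar>\<close>, so the Lipschitz constant depends on
    \<open>t\<close> only.\<close>
  have tr: "snorm N (translate (- x) \<phi> - translate (- t) \<phi>) \<le> \<bar>x - t\<bar> * (2 + 2 * \<bar>t\<bar>) ^ N * S"
    if "\<bar>x - t\<bar> \<le> 1" for x t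
  proof -
    have "snorm N (translate (- x) \<phi> - translate (- t) \<phi>) \<le> \<bar>x - t\<bar> * (1 + \<bar>x\<bar> + \<bar>t\<bar>) ^ N * snorm (Suc N) \<phi>"
      by (rule snorm_translate_diff)
    also have "\<dots> \<le> \<bar>x - t\<bar> * (2 + 2 * \<bar>t\<bar>) ^ N * S"
      using that S snorm_nonneg by (intro mult_mono power_mono) auto
    finally show ?thesis .
  qed
  have h_diff: "\<bar>h x - h t\<bar> \<le> C * (\<bar>x - t\<bar> * (2 + 2 * \<bar>t\<bar>) ^ N * S)" if "\<bar>x - t\<bar> \<le> 1" for x t
    using CN[of "translate (- x) \<phi> - translate (- t) \<phi>"] mult_left_mono[OF tr[OF that] C]
    by (simp add: h_def linear_diff[OF linear_dapply])
  have "isCont h t" for t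
  proof -
    have "((\<lambda>x. C * (\<bar>x - t\<bar> * (2 + 2 * \<bar>t\<bar>) ^ N * S)) \<longlongrightarrow> C * (\<bar>t - t\<bar> * (2 + 2 * \<bar>t\<bar>) ^ N * S)) (at t)"
      by (intro tendsto_intros)
    then have "((\<lambda>x. C * (\<bar>x - t\<bar> * (2 + 2 * \<bar>t\<bar>) ^ N * S)) \<longlongrightarrow> 0) (at t)" by simp
    moreover have "\<forall>\<^sub>F x in at t. norm (h x - h t) \<le> C * (\<bar>x - t\<bar> * (2 + 2 * \<bar>t\<bar>) ^ N * S)"
      unfolding eventually_at using h_diff
      by (intro exI[of _ 1]) (auto simp: dist_real_def)
    ultimately have "((\<lambda>x. h x - h t) \<longlongrightarrow> 0) (at t)"
      by (rule Lim_null_comparison[rotated])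
    then show ?thesis
      unfolding isCont_def by (subst Lim_null)
  qed
  then have h_meas [measurable]: "h \<in> borel_measurable borel"
    by (intro borel_measurable_continuous_onI continuous_at_imp_continuous_on) auto
  \<comment> \<open>The defect of the interchange for the weight \<open>v\<close>; the goal is
    \<open>D w = 0\<close>.\<close>
  define D where "D v = dapply u (convolve v \<phi>) - (\<integral>x. v x * h x \<partial>lborel)" for v
  have h_int: "integrable lborel (\<lambda>x. v x * h x)" if "rapidly_decreasing v" for v
    using that h_meas h_bound by (rule integrable_rapidly_decreasing_mult)
  have D_bound: "\<bar>D v\<bar> \<le> (real (Suc N) + 1) * C * S * (\<integral>x. \<bar>v x\<bar> * (1 + \<bar>x\<bar>) ^ N \<partial>lborel)"
    if v: "rapidly_decreasing v" for v
  proof -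
    let ?I = "\<integral>x. \<bar>v x\<bar> * (1 + \<bar>x\<bar>) ^ N \<partial>lborel"
    have I: "?I \<ge> 0" by simp
    have "\<bar>dapply u (convolve v \<phi>)\<bar> \<le> C * (real (Suc N) * snorm N \<phi> * ?I)"
      by (rule order_trans[OF CN mult_left_mono[OF snorm_convolve[OF v] C]])
    also have "\<dots> \<le> C * (real (Suc N) * S * ?I)"
      using C S I by (intro mult_left_mono mult_right_mono) auto
    finally have 1: "\<bar>dapply u (convolve v \<phi>)\<bar> \<le> C * (real (Suc N) * S * ?I)" .
    have "\<bar>\<integral>x. v x * h x \<partial>lborel\<bar> \<le> (\<integral>x. \<bar>v x * h x\<bar> \<partial>lborel)"
      by (rule integral_abs_bound)
    also have "\<dots> \<le> (\<integral>x. C * S * (\<bar>v x\<bar> * (1 + \<bar>x\<bar>) ^ N) \<partial>lborel)"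
    proof (intro integral_mono integrable_abs h_int v integrable_mult_right integrable_rapidly_decreasing_weight)
      fix x
      show "\<bar>v x * h x\<bar> \<le> C * S * (\<bar>v x\<bar> * (1 + \<bar>x\<bar>) ^ N)"
        using mult_left_mono[OF h_bound[of x], of "\<bar>v x\<bar>"] by (simp add: abs_mult mult_ac)
    qed
    finally show ?thesis
      using 1 by (simp add: D_def algebra_simps)
  qed
  have D_add: "D (\<lambda>x. v x + v' x) = D v + D v'"
    if "rapidly_decreasing v" "rapidly_decreasing v'" "rapidly_decreasing (\<lambda>x. v x + v' x)" for v v'
    using that h_int by (simp add: D_def convolve_add linear_add[OF linear_dapply] distrib_right)
  obtain K where K: "\<And>x. \<bar>w x\<bar> \<le> K"
    using w unfolding rapidly_decreasing_def by (metis mult_1 power_0)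
  \<comment> \<open>Both terms of \<open>D v\<close> are compared with the integral of
    \<open>v\<close> times \<open>h t\<close>. On the support of \<open>v\<close> the translates
    differ from the one at \<open>t\<close> by a multiple of \<open>d\<close>, and the mass of
    \<open>v\<close> is at most \<open>K * d\<close>; together this is quadratic in
    \<open>d\<close>. The set \<open>A\<close> will be an interval on either side of
    \<open>t\<close>.\<close>
  have D_local: "\<bar>D v\<bar> \<le> (real (Suc N) + 1) * (C * (2 + 2 * \<bar>t\<bar>) ^ N * S) * K * d\<^sup>2"
    if v: "rapidly_decreasing v" and d: "0 \<le> d" "d \<le> 1" and A: "A \<subseteq> {t-d..t+d}" "A \<in> sets borel"
      "emeasure lborel A = ennreal d"
      and vA: "\<And>x. \<bar>v x\<bar> \<le> K * indicator A x" for v d t A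
  proof -
    define b where "b = d * (2 + 2 * \<bar>t\<bar>) ^ N * S"
    have B0: "b \<ge> 0" using d S by (simp add: b_def)
    have out: "x \<in> A" if "v x \<noteq> 0" for x
      using vA[of x] that by (cases "x \<in> A") auto
    have meas: "measure lborel A = d"
      using A(3) d by (simp add: measure_def)
    have iA: "integrable lborel (indicator A :: real \<Rightarrow> real)"
      using A by simp
    have v1: "integrable lborel (\<lambda>x. \<bar>v x\<bar>)"
      using integrable_rapidly_decreasing_weight[OF v, of 0] by simp
    then have v1': "integrable lborel v"
      using v by (subst integrable_abs_iff[symmetric]) (auto simp: rapidly_decreasing_def)
    have intv: "(\<integral>x. \<bar>v x\<bar> \<partial>lborel) \<le> K * d"
    proof -
      have "(\<integral>x. \<bar>v x\<bar> \<partial>lborel) \<le> (\<integral>x. K * indicator A x \<partial>lborel)"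
        using vA v1 iA by (intro integral_mono) auto
      then show ?thesis by (simp add: meas)
    qed
    have near: "\<bar>x - t\<bar> \<le> d" "\<bar>x - t\<bar> \<le> 1" if "v x \<noteq> 0" for x
    proof -
      have "x \<in> {t - d..t + d}" using out[OF that] A(1) by blast
      then show "\<bar>x - t\<bar> \<le> d" by (simp add: abs_le_iff)
      then show "\<bar>x - t\<bar> \<le> 1" using d by linarith
    qed
    have trB: "snorm N (translate (- x) \<phi> - translate (- t) \<phi>) \<le> b" if "v x \<noteq> 0" for x
    proof -
      have "\<bar>x - t\<bar> * (2 + 2 * \<bar>t\<bar>) ^ N * S \<le> b"
        unfolding b_def using near[OF that] S by (intro mult_right_mono) auto
      then show ?thesis using tr[OF near(2)[OF that]] by linarith
    qed
    let ?\<eta> = "translate (- t) \<phi>"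
    have "snorm N (convolve v \<phi> - (\<integral>x. v x \<partial>lborel) *\<^sub>R ?\<eta>) \<le> real (Suc N) * (\<integral>x. \<bar>v x\<bar> * b \<partial>lborel)"
      using v1 trB by (intro snorm_convolve_diff v integrable_mult_left) auto
    then have "snorm N (convolve v \<phi> - (\<integral>x. v x \<partial>lborel) *\<^sub>R ?\<eta>) \<le> real (Suc N) * (b * (\<integral>x. \<bar>v x\<bar> \<partial>lborel))"
      by (simp add: mult.commute)
    also have "\<dots> \<le> real (Suc N) * (b * (K * d))"
      using intv B0 by (intro mult_left_mono) auto
    finally have "\<bar>dapply u (convolve v \<phi> - (\<integral>x. v x \<partial>lborel) *\<^sub>R ?\<eta>)\<bar> \<le> C * (real (Suc N) * (b * (K * d)))"
      by (intro order_trans[OF CN mult_left_mono] C)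
    then have 1: "\<bar>dapply u (convolve v \<phi>) - (\<integral>x. v x \<partial>lborel) * h t\<bar> \<le> C * (real (Suc N) * (b * (K * d)))"
      by (simp add: linear_diff[OF linear_dapply] linear_cmul[OF linear_dapply] h_def)
    have "\<bar>(\<integral>x. v x * h x \<partial>lborel) - (\<integral>x. v x \<partial>lborel) * h t\<bar> = \<bar>\<integral>x. v x * (h x - h t) \<partial>lborel\<bar>"
      using h_int[OF v] v1' by (simp add: right_diff_distrib)
    also have "\<dots> \<le> (\<integral>x. \<bar>v x * (h x - h t)\<bar> \<partial>lborel)"
      by (rule integral_abs_bound)
    also have "\<dots> \<le> (\<integral>x. \<bar>v x\<bar> * (C * b) \<partial>lborel)"
    proof (rule integral_mono)
      show "integrable lborel (\<lambda>x. \<bar>v x\<bar> * (C * b))"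
        using v1 by (rule integrable_mult_left)
      show "integrable lborel (\<lambda>x. \<bar>v x * (h x - h t)\<bar>)"
        using h_int[OF v] v1' by (intro integrable_abs) (simp add: right_diff_distrib)
      fix x
      show "\<bar>v x * (h x - h t)\<bar> \<le> \<bar>v x\<bar> * (C * b)"
      proof (cases "v x = 0")
        case False
        have "C * (\<bar>x - t\<bar> * (2 + 2 * \<bar>t\<bar>) ^ N * S) \<le> C * b"
          unfolding b_def using near[OF False] S C by (intro mult_right_mono mult_left_mono) auto
        then have "\<bar>h x - h t\<bar> \<le> C * b"
          using h_diff[OF near(2)[OF False]] by linarith
        then show ?thesis
          unfolding abs_mult by (intro mult_left_mono) auto
      qed simp
    qed
    also have "\<dots> = C * b * (\<integral>x. \<bar>v x\<bar> \<partial>lborel)" by (simp add: mult.commute)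
    also have "\<dots> \<le> C * b * (K * d)"
      using intv B0 C by (intro mult_left_mono) auto
    finally have 2: "\<bar>(\<integral>x. v x * h x \<partial>lborel) - (\<integral>x. v x \<partial>lborel) * h t\<bar> \<le> C * b * (K * d)" .
    have "\<bar>D v\<bar> \<le> C * (real (Suc N) * (b * (K * d))) + C * b * (K * d)"
      unfolding D_def using 1 2 by linarith
    also have "\<dots> = (real (Suc N) + 1) * (C * (2 + 2 * \<bar>t\<bar>) ^ N * S) * K * d\<^sup>2"
      by (simp add: b_def algebra_simps power2_eq_square)
    finally show ?thesis .
  qed
  define G where "G t = D (\<lambda>x. w x * indicator {..<t} x)" for t
  have rd: "rapidly_decreasing (\<lambda>x. w x * indicator A x)" if "A \<in> sets borel" for A
    using w that by (rule rapidly_decreasing_mult_indicator)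
  have G_diff: "G s - G t = D (\<lambda>x. w x * indicator {t..<s} x)" if "t \<le> s" for s t
  proof -
    have "(\<lambda>x. w x * indicator {..<s} x) = (\<lambda>x. w x * indicator {..<t} x + w x * indicator {t..<s} x)"
      using that by (auto simp: indicator_def fun_eq_iff)
    then show ?thesis
      using D_add[of "\<lambda>x. w x * indicator {..<t} x" "\<lambda>x. w x * indicator {t..<s} x"] rd[of "{..<s}"] rd
      by (simp add: G_def)
  qed
  have "DERIV G t :> 0" for t
  proof -
    define M where "M = (real (Suc N) + 1) * (C * (2 + 2 * \<bar>t\<bar>) ^ N * S) * K"
    have dom: "\<bar>w x * indicator A x\<bar> \<le> K * indicator A x" for x A
      using K[of x] by (simp add: indicator_def)
    have quad: "\<bar>G s - G t\<bar> \<le> M * \<bar>s - t\<bar>\<^sup>2" if "\<bar>s - t\<bar> \<le> 1" for s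
    proof (cases "t \<le> s")
      case True
      have "\<bar>D (\<lambda>x. w x * indicator {t..<s} x)\<bar> \<le> M * \<bar>s - t\<bar>\<^sup>2"
        unfolding M_def by (rule D_local[where A = "{t..<s}"]) (use True that dom rd[of "{t..<s}"] in auto)
      then show ?thesis
        using G_diff[OF True] by simp
    next
      case False
      then have st: "s \<le> t" by simp
      have "\<bar>D (\<lambda>x. w x * indicator {s..<t} x)\<bar> \<le> M * \<bar>s - t\<bar>\<^sup>2"
        unfolding M_def by (rule D_local[where A = "{s..<t}"]) (use st that dom rd[of "{s..<t}"] in auto)
      then show ?thesis
        using G_diff[OF st] by linarith
    qed
    have "((\<lambda>k. M * \<bar>k\<bar>) \<longlongrightarrow> M * \<bar>0\<bar>) (at (0::real))"
      by (intro tendsto_intros)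
    then have lim: "((\<lambda>k. M * \<bar>k\<bar>) \<longlongrightarrow> 0) (at (0::real))" by simp
    have bnd: "norm ((G (t + k) - G t) / k) \<le> M * \<bar>k\<bar>" if "\<bar>k\<bar> < 1" "k \<noteq> 0" for k
    proof -
      have "\<bar>G (t + k) - G t\<bar> \<le> M * \<bar>k\<bar> * \<bar>k\<bar>"
        using quad[of "t + k"] that by (simp add: power2_eq_square)
      then show ?thesis
        using that by (simp add: abs_divide divide_le_eq)
    qed
    have "\<forall>\<^sub>F k in at 0. norm ((G (t + k) - G t) / k) \<le> M * \<bar>k\<bar>"
      unfolding eventually_at
    proof (intro exI[of _ 1] conjI ballI impI)
      fix k :: real
      assume "k \<noteq> 0 \<and> dist k 0 < 1"
      then show "norm ((G (t + k) - G t) / k) \<le> M * \<bar>k\<bar>"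
        by (intro bnd) (simp_all add: dist_real_def)
    qed simp
    from Lim_null_comparison[OF this lim] show ?thesis
      unfolding DERIV_def .
  qed
  then have G_const: "G s = G t" for s t
    using DERIV_isconst_all by blast
  let ?W = "\<lambda>x. \<bar>w x\<bar> * (1 + \<bar>x\<bar>) ^ N"
  define c where "c = (real (Suc N) + 1) * C * S"
  have [measurable]: "w \<in> borel_measurable borel"
    using w by (rule rapidly_decreasing_measurable)
  \<comment> \<open>Needed at both ends of the line: for the part of \<open>w\<close> left of
    \<open>- real n\<close> and for the part right of \<open>real n\<close>. Dominated convergence
    applies to the majorant in \<open>D_bound\<close>.\<close>
  have tail: "(\<lambda>n. D (\<lambda>x. w x * indicator (A n) x)) \<longlonglongrightarrow> 0"
    if A[measurable]: "\<And>n. A n \<in> sets borel" and lim: "\<And>x. (\<lambda>n. indicator (A n) x :: real) \<longlonglongrightarrow> 0" for A :: "nat \<Rightarrow> real set"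
  proof -
    have "(\<lambda>n. \<integral>x. ?W x * indicator (A n) x \<partial>lborel) \<longlonglongrightarrow> integral\<^sup>L lborel (\<lambda>_::real. 0)"
    proof (rule integral_dominated_convergence[where w = ?W and f = "\<lambda>_. 0" and s = "\<lambda>n x. ?W x * indicator (A n) x"])
      show "integrable lborel ?W" by (rule integrable_rapidly_decreasing_weight[OF w])
      show "AE x in lborel. (\<lambda>n. ?W x * indicator (A n) x) \<longlonglongrightarrow> 0"
        using tendsto_mult_right_zero[OF lim] by simp
      show "AE x in lborel. norm (?W x * indicator (A n) x) \<le> ?W x" for n
        by (simp add: indicator_def)
    qed simp_all
    then have lim': "(\<lambda>n. c * (\<integral>x. ?W x * indicator (A n) x \<partial>lborel)) \<longlonglongrightarrow> 0"
      by (intro tendsto_mult_right_zero) simp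
    have bd: "norm (D (\<lambda>x. w x * indicator (A n) x)) \<le> c * (\<integral>x. ?W x * indicator (A n) x \<partial>lborel)" for n
    proof -
      have "(\<lambda>x. \<bar>w x * indicator (A n) x\<bar> * (1 + \<bar>x\<bar>) ^ N) = (\<lambda>x. ?W x * indicator (A n) x)"
        by (rule ext) (simp add: indicator_def)
      then show ?thesis
        using D_bound[OF rd[OF A], of n] unfolding c_def real_norm_def by metis
    qed
    show ?thesis
      by (rule Lim_null_comparison[OF always_eventually lim']) (rule allI, rule bd)
  qed
  have ind_lim: "(\<lambda>n. indicator (A n) x :: real) \<longlonglongrightarrow> 0"
    if "\<And>n. real n > \<bar>x\<bar> \<Longrightarrow> x \<notin> A n" for A :: "nat \<Rightarrow> real set" and x
  proof (rule tendsto_eventually)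
    obtain n0 where "real n0 > \<bar>x\<bar>" using reals_Archimedean2 by blast
    then show "\<forall>\<^sub>F n in sequentially. indicator (A n) x = (0::real)"
      unfolding eventually_sequentially using that
      by (intro exI[of _ n0] allI impI) simp
  qed
  have G0: "G 0 = 0"
  proof -
    have "(\<lambda>n. G (- real n)) \<longlonglongrightarrow> 0"
      unfolding G_def by (rule tail, simp, rule ind_lim, auto)
    moreover have "G (- real n) = G 0" for n
      by (rule G_const)
    ultimately have "(\<lambda>n::nat. G 0) \<longlonglongrightarrow> 0" by (simp only:)
    then show ?thesis by (simp only: LIMSEQ_const_iff)
  qed
  \<comment> \<open>Being constant and tending to 0 at minus infinity, \<open>G\<close> vanishes.
    What remains of \<open>D w\<close> is the part beyond \<open>t\<close>, which tends to 0 as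
    \<open>t\<close> grows.\<close>
  have Dw: "D w = G t + D (\<lambda>x. w x * indicator {t..} x)" for t
  proof -
    have split: "(\<lambda>x. w x * indicator {..<t} x + w x * indicator {t..} x) = w"
      by (auto simp: indicator_def fun_eq_iff)
    show ?thesis
      using D_add[of "\<lambda>x. w x * indicator {..<t} x" "\<lambda>x. w x * indicator {t..} x"]
      unfolding split G_def using rd[of "{..<t}"] rd[of "{t..}"] w by simp
  qed
  have "(\<lambda>n. D (\<lambda>x. w x * indicator {real n..} x)) \<longlonglongrightarrow> 0"
    by (rule tail, simp, rule ind_lim, auto)
  moreover have "D (\<lambda>x. w x * indicator {real n..} x) = D w" for n
    using Dw[of "real n"] G0 G_const[of "real n" 0] by simp
  ultimately have "(\<lambda>n::nat. D w) \<longlonglongrightarrow> 0" by (simp only:)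
  then have "D w = 0" by (simp only: LIMSEQ_const_iff)
  then show ?thesis by (simp add: D_def h_def)
qed

section \<open>Correlation of test functions, adjoints and Green's functions\<close>

definition correlate :: "'a::convolution_space \<Rightarrow> 'a \<Rightarrow> 'a"
  where "correlate \<phi> \<psi> = convolve (SOME w. rapidly_decreasing w \<and>
    (\<forall>f. (\<integral>x. fun_of \<phi> x * f x \<partial>dom_measure TYPE('a)) = (\<integral>x. w x * f x \<partial>lborel))) \<psi>"

lemma correlate:
  fixes \<phi> \<psi> :: "'a::convolution_space"
  shows fun_of_correlate: "fun_of (correlate \<phi> \<psi>) y = (\<integral>x. fun_of \<phi> x * fun_of \<psi> (y + x) \<partial>dom_measure TYPE('a))"
    and dapply_correlate: "dapply u (correlate \<phi> \<psi>)
      = (\<integral>x. fun_of \<phi> x * dapply u (translate (- x) \<psi>) \<partial>dom_measure TYPE('a))"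
proof -
  define w where "w = (SOME w. rapidly_decreasing w \<and>
    (\<forall>f. (\<integral>x. fun_of \<phi> x * f x \<partial>dom_measure TYPE('a)) = (\<integral>x. w x * f x \<partial>lborel)))"
  then have eq: "correlate \<phi> \<psi> = convolve w \<psi>"
    by (simp only: correlate_def)
  have w: "rapidly_decreasing w"
    and int: "(\<integral>x. fun_of \<phi> x * f x \<partial>dom_measure TYPE('a)) = (\<integral>x. w x * f x \<partial>lborel)" for f
    using someI_ex[OF kernel_ex[of \<phi>], folded w_def] by blast+
  show "fun_of (correlate \<phi> \<psi>) y = (\<integral>x. fun_of \<phi> x * fun_of \<psi> (y + x) \<partial>dom_measure TYPE('a))"
    unfolding eq int by (rule fun_of_convolve[OF w])
  show "dapply u (correlate \<phi> \<psi>)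
      = (\<integral>x. fun_of \<phi> x * dapply u (translate (- x) \<psi>) \<partial>dom_measure TYPE('a))"
    unfolding eq int by (rule dapply_convolve[OF w])
qed

text \<open>Two substitutions, \<open>x\<close> to \<open>- x\<close> and then a shift by
  \<open>y\<close>, exchange the factors. On the circle they preserve the integral over the
  fundamental domain because the integrands are periodic.\<close>

lemma correlate_reflection:
  fixes \<phi> \<psi> :: "'a::convolution_space"
  shows "correlate (reflection \<psi>) (reflection \<phi>) = correlate \<phi> \<psi>"
proof (rule fun_of_eqI)
  fix y
  have "fun_of (correlate (reflection \<psi>) (reflection \<phi>)) y
      = (\<integral>x. fun_of \<psi> (- x) * fun_of (translate y \<phi>) (- x) \<partial>dom_measure TYPE('a))"
    by (simp add: fun_of_correlate fun_of_translate minus_diff_commute)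
  also have "\<dots> = (\<integral>x. fun_of \<psi> x * fun_of (translate y \<phi>) x \<partial>dom_measure TYPE('a))"
    by (rule integral_dom_reflect)
  also have "\<dots> = (\<integral>x. fun_of \<psi> (x + y) * fun_of (translate y \<phi>) (x + y) \<partial>dom_measure TYPE('a))"
    by (rule integral_dom_shift[symmetric])
  also have "\<dots> = fun_of (correlate \<phi> \<psi>) y"
    by (simp add: fun_of_correlate fun_of_translate add.commute mult.commute)
  finally show "fun_of (correlate (reflection \<psi>) (reflection \<phi>)) y = fun_of (correlate \<phi> \<psi>) y" .
qed

text \<open>The transpose of \<psi> at \<open>x\<close> is the value of \<open>A delta\<close> at
  the translate of \<psi> by \<open>- x\<close>. Pairing it with \<phi> gives an integral of such
  values, and \<open>dapply_correlate\<close> moves \<open>A delta\<close> outside.\<close>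

lemma lsi_continuous_of_test:
  fixes A :: "'a::convolution_space distribution \<Rightarrow> 'a distribution"
  assumes "lsi_continuous A"
  shows "dapply (A (of_test \<phi>)) \<psi> = dapply (A delta) (correlate \<phi> \<psi>)"
proof -
  obtain \<eta> where "\<And>u. dapply (A u) \<psi> = dapply u \<eta>"
    and "\<And>x. fun_of \<eta> x = dapply (A delta) (translate (- x) \<psi>)"
    using lsi_continuous_transpose[OF assms, of \<psi>] by auto
  then show ?thesis
    by (simp add: of_test.rep_eq dapply_correlate)
qed

text \<open>Conjugating by the reflection turns the correlation of \<psi> and \<phi> into that of
  their reflections in the opposite order, which is the same function by
  \<open>correlate_reflection\<close>. Uniqueness is
  \<open>lsi_continuous_eq_of_test\<close>.\<close>

lemma lsi_adjoint_eq:
  fixes A :: "'a::convolution_space distribution \<Rightarrow> 'a distribution"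
  assumes A: "lsi_continuous A"
  shows "lsi_adjoint A = dreflect \<circ> A \<circ> dreflect"
  unfolding lsi_adjoint_def
proof (rule the_equality)
  let ?B = "dreflect \<circ> A \<circ> dreflect"
  have B: "dapply (A (of_test \<phi>)) \<psi> = dapply (?B (of_test \<psi>)) \<phi>" for \<phi> \<psi>
    by (simp add: dreflect_of_test dreflect.rep_eq lsi_continuous_of_test[OF A] correlate_reflection)
  then show "lsi_continuous ?B \<and> (\<forall>\<phi> \<psi>. dapply (A (of_test \<phi>)) \<psi> = dapply (?B (of_test \<psi>)) \<phi>)"
    using lsi_continuous_reflect_conjugate[OF A] by blast
  fix B'
  assume B': "lsi_continuous B' \<and> (\<forall>\<phi> \<psi>. dapply (A (of_test \<phi>)) \<psi> = dapply (B' (of_test \<psi>)) \<phi>)"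
  show "B' = ?B"
  proof (rule lsi_continuous_eq_of_test)
    show "lsi_continuous B'" using B' by simp
    show "lsi_continuous ?B" using A by (rule lsi_continuous_reflect_conjugate)
    show "B' (of_test \<psi>) = ?B (of_test \<psi>)" for \<psi>
      by (rule dapply_eqI) (simp only: B'[THEN conjunct2, rule_format, symmetric] B)
  qed
qed

lemma lsi_adjoint_inv:
  fixes A :: "'a::convolution_space distribution \<Rightarrow> 'a distribution"
  assumes "invertible_admissible A"
  shows "lsi_adjoint (inv A) (lsi_adjoint A u) = u" "lsi_adjoint A (lsi_adjoint (inv A) u) = u"
proof -
  have bij: "bij A" and lsi: "lsi_continuous A" "lsi_continuous (inv A)"
    using assms by (auto simp: invertible_admissible_def)
  show "lsi_adjoint (inv A) (lsi_adjoint A u) = u" "lsi_adjoint A (lsi_adjoint (inv A) u) = u"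
    by (simp_all add: lsi_adjoint_eq[OF lsi(1)] lsi_adjoint_eq[OF lsi(2)]
        inv_f_f[OF bij_is_inj[OF bij]] surj_f_inv_f[OF bij_is_surj[OF bij]])
qed

lemma lsi_convolution_green:
  fixes A :: "'a::convolution_space distribution \<Rightarrow> 'a distribution"
  assumes A: "invertible_admissible A"
  shows "lsi_convolution u (green (lsi_adjoint A \<circ> A)) = inv A (lsi_adjoint (inv A) u)"
proof -
  have bij: "bij A" and lsi: "lsi_continuous A" "lsi_continuous (inv A)"
    using A by (auto simp: invertible_admissible_def)
  \<comment> \<open>This operator is LSI and its impulse response is the Green's function, so it is
    the one that \<open>lsi_convolution\<close> selects.\<close>
  have K: "lsi_continuous (inv A \<circ> lsi_adjoint (inv A))"
    unfolding lsi_adjoint_eq[OF lsi(2)]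
    by (intro lsi_continuous_compose[OF lsi(2)] lsi_continuous_reflect_conjugate lsi(2))
  have "inv (lsi_adjoint A \<circ> A) = inv A \<circ> lsi_adjoint (inv A)"
  proof (rule inv_unique_comp)
    show "(lsi_adjoint A \<circ> A) \<circ> (inv A \<circ> lsi_adjoint (inv A)) = id"
      by (rule ext) (simp add: lsi_adjoint_inv[OF A] surj_f_inv_f[OF bij_is_surj[OF bij]])
    show "(inv A \<circ> lsi_adjoint (inv A)) \<circ> (lsi_adjoint A \<circ> A) = id"
      by (rule ext) (simp add: lsi_adjoint_inv[OF A] inv_f_f[OF bij_is_inj[OF bij]])
  qed
  then show ?thesis
    using lsi_convolution_eq[OF K, of u] by (simp add: green_def)
qed

section \<open>Smooth functions\<close>

text \<open>A class of functions closed under differentiation settles all orders at once, with no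
  formula for the n-th derivative.\<close>

lemma smooth_coinduct:
  assumes "P f" and step: "\<And>f. P f \<Longrightarrow> \<exists>f'. (\<forall>x. DERIV f x :> f' x) \<and> P f'"
  shows "smooth f"
proof -
  have "P ((deriv ^^ n) f)" for n
  proof (induction n)
    case (Suc n)
    from step[OF this] obtain f' where f': "\<And>x. DERIV ((deriv ^^ n) f) x :> f' x" "P f'"
      by blast
    then have "deriv ((deriv ^^ n) f) = f'"
      by (intro ext DERIV_imp_deriv)
    then show ?case using f'(2) by simp
  qed (simp add: assms(1))
  then show ?thesis
    unfolding smooth_def using step real_differentiable_def by blast
qed

text \<open>
  The functions built from smooth functions and their compositions with \<open>g\<close> are closed under
  differentiation, so products and compositions are smooth by coinduction, without the formulas of
  Leibniz and Faa di Bruno.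
\<close>

inductive smooth_closure :: "(real \<Rightarrow> real) \<Rightarrow> (real \<Rightarrow> real) \<Rightarrow> bool" for g where
  base: "smooth f \<Longrightarrow> smooth_closure g f"
| comp: "smooth f \<Longrightarrow> smooth_closure g (\<lambda>x. f (g x))"
| add: "smooth_closure g f \<Longrightarrow> smooth_closure g h \<Longrightarrow> smooth_closure g (\<lambda>x. f x + h x)"
| mult: "smooth_closure g f \<Longrightarrow> smooth_closure g h \<Longrightarrow> smooth_closure g (\<lambda>x. f x * h x)"

lemma smooth_deriv: "smooth f \<Longrightarrow> smooth (deriv f)"
  unfolding smooth_def by (metis funpow_Suc_right o_apply)

lemma smooth_DERIV_deriv: "smooth f \<Longrightarrow> DERIV f x :> deriv f x"
  using smooth_DERIV[of f 0 x] by simp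

lemma smooth_closure_DERIV:
  assumes "smooth_closure g f" "smooth g"
  shows "\<exists>f'. (\<forall>x. DERIV f x :> f' x) \<and> smooth_closure g f'"
  using assms(1)
proof induction
  case (base f)
  then show ?case
    using smooth_DERIV_deriv smooth_deriv smooth_closure.base by blast
next
  case (comp f)
  have "DERIV (\<lambda>x. f (g x)) x :> deriv f (g x) * deriv g x" for x
    using DERIV_chain2[OF smooth_DERIV_deriv[OF comp] smooth_DERIV_deriv[OF assms(2)]] .
  moreover have "smooth_closure g (\<lambda>x. deriv f (g x) * deriv g x)"
    by (intro smooth_closure.mult smooth_closure.comp smooth_closure.base smooth_deriv comp assms(2))
  ultimately show ?case
    by (intro exI[of _ "\<lambda>x. deriv f (g x) * deriv g x"] conjI allI)
next
  case (add f h)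
  then obtain f' h' where "\<And>x. DERIV f x :> f' x" "\<And>x. DERIV h x :> h' x"
      "smooth_closure g f'" "smooth_closure g h'"
    by blast
  then show ?case
    by (intro exI[of _ "\<lambda>x. f' x + h' x"] conjI allI DERIV_add smooth_closure.add) auto
next
  case (mult f h)
  then obtain f' h' where d: "\<And>x. DERIV f x :> f' x" "\<And>x. DERIV h x :> h' x"
      "smooth_closure g f'" "smooth_closure g h'"
    by blast
  then have "smooth_closure g (\<lambda>x. f' x * h x + h' x * f x)"
    using mult.hyps by (intro smooth_closure.add smooth_closure.mult)
  then show ?case
    using d by (intro exI[of _ "\<lambda>x. f' x * h x + h' x * f x"] conjI allI DERIV_mult) auto
qed

lemma smooth_closure_smooth: "smooth_closure g f \<Longrightarrow> smooth g \<Longrightarrow> smooth f"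
  by (rule smooth_coinduct[of "smooth_closure g"]) (auto intro: smooth_closure_DERIV)

lemma smooth_compose: "smooth f \<Longrightarrow> smooth g \<Longrightarrow> smooth (\<lambda>x. f (g x))"
  by (rule smooth_closure_smooth[OF smooth_closure.comp])

lemma smooth_mult: "smooth f \<Longrightarrow> smooth g \<Longrightarrow> smooth (\<lambda>x. f x * g x)"
  by (rule smooth_closure_smooth[OF smooth_closure.mult, of g])
     (auto intro: smooth_closure.base)

lemma smooth_affine: "smooth (\<lambda>x. a * x + b)"
proof (rule smooth_coinduct[of "\<lambda>f. \<exists>a b. f = (\<lambda>x. a * x + b)"])
  fix f :: "real \<Rightarrow> real"
  assume "\<exists>a b. f = (\<lambda>x. a * x + b)"
  then obtain a b where f: "f = (\<lambda>x. a * x + b)" by blast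
  have "DERIV f x :> a" for x
    unfolding f by (auto intro!: derivative_eq_intros)
  then show "\<exists>f'. (\<forall>x. DERIV f x :> f' x) \<and> (\<exists>a b. f' = (\<lambda>x. a * x + b))"
    by (intro exI[of _ "\<lambda>_. a"] conjI exI[of _ 0] exI[of _ a]) auto
qed blast

lemma smooth_cos: "smooth cos"
proof (rule smooth_coinduct[of "\<lambda>f. \<exists>a b. f = (\<lambda>x. a * cos x + b * sin x)"])
  show "\<exists>a b. cos = (\<lambda>x. a * cos x + b * sin x :: real)"
    by (intro exI[of _ 1] exI[of _ 0]) simp
  fix f :: "real \<Rightarrow> real"
  assume "\<exists>a b. f = (\<lambda>x. a * cos x + b * sin x)"
  then obtain a b where f: "f = (\<lambda>x. a * cos x + b * sin x)" by blast
  have "DERIV f x :> b * cos x + (- a) * sin x" for x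
    unfolding f by (auto intro!: derivative_eq_intros)
  then show "\<exists>f'. (\<forall>x. DERIV f x :> f' x) \<and> (\<exists>a b. f' = (\<lambda>x. a * cos x + b * sin x))"
    by (intro exI[of _ "\<lambda>x. b * cos x + (- a) * sin x"] conjI exI[of _ b] exI[of _ "- a"]) auto
qed

text \<open>\<open>flat 0\<close> is the classical smooth function that is flat at 0. The powers of
  \<open>1 / x\<close> are included because they appear in its derivatives, so that the span of the
  family is closed under differentiation.\<close>

definition flat :: "nat \<Rightarrow> real \<Rightarrow> real"
  where "flat n x = (if 0 < x then (1 / x) ^ n * exp (- (1 / x)) else 0)"

lemma flat_tendsto_0: "(flat n \<longlongrightarrow> 0) (at 0)"
  unfolding filterlim_split_at_real
proof (intro filterlim_split_at)
  have "filterlim (\<lambda>x::real. 1 / x) at_top (at_right 0)"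
    using filterlim_inverse_at_top_right by (simp add: inverse_eq_divide)
  then have "((\<lambda>x. (1 / x) ^ n / exp (1 / x)) \<longlongrightarrow> 0) (at_right (0::real))"
    by (rule filterlim_compose[OF tendsto_power_div_exp_0])
  moreover have "\<forall>\<^sub>F x in at_right 0. (1 / x) ^ n / exp (1 / x) = flat n x"
    unfolding eventually_at_right_field
    by (intro exI[of _ 1]) (simp add: flat_def exp_minus field_simps)
  ultimately show "(flat n \<longlongrightarrow> 0) (at_right 0)"
    by (rule Lim_transform_eventually)
  have "\<forall>\<^sub>F x in at_left 0. 0 = flat n x"
    unfolding eventually_at_left_field by (intro exI[of _ "-1"]) (simp add: flat_def)
  then show "(flat n \<longlongrightarrow> 0) (at_left 0)"
    by (rule Lim_transform_eventually[OF tendsto_const])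
qed

lemma DERIV_flat: "DERIV (flat n) x :> flat (n + 2) x - real n * flat (n + 1) x"
proof (cases x "0 :: real" rule: linorder_cases)
  case less
  have "DERIV (\<lambda>_. 0) x :> 0" by simp
  then have "DERIV (flat n) x :> 0"
    by (rule has_field_derivative_transform_within_open[of _ _ _ "{..<0}"]) (use less in \<open>auto simp: flat_def\<close>)
  then show ?thesis using less by (simp add: flat_def)
next
  case equal
  \<comment> \<open>At 0 the difference quotient of \<open>flat n\<close> is exactly
    \<open>flat (n + 1)\<close>, which tends to 0.\<close>
  have "((\<lambda>k. (flat n (0 + k) - flat n 0) / k) \<longlongrightarrow> 0) (at 0)"
  proof (rule Lim_transform_eventually[OF flat_tendsto_0[of "n + 1"]])
    show "\<forall>\<^sub>F k in at 0. flat (n + 1) k = (flat n (0 + k) - flat n 0) / k"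
      unfolding eventually_at by (intro exI[of _ 1]) (simp add: flat_def)
  qed
  then show ?thesis
    unfolding DERIV_def equal by (simp add: flat_def)
next
  case greater
  have pos: "DERIV (\<lambda>x. (1 / x) ^ n * exp (- (1 / x))) x :> flat (n + 2) x - real n * flat (n + 1) x"
    using greater
    by (auto intro!: derivative_eq_intros simp: flat_def field_simps power2_eq_square)
       (cases n; simp add: field_simps)
  show ?thesis
    by (rule has_field_derivative_transform_within_open[OF pos, of "{0<..}"])
       (use greater in \<open>auto simp: flat_def\<close>)
qed

inductive flat_span :: "(real \<Rightarrow> real) \<Rightarrow> bool" where
  flat: "flat_span (flat n)"
| lincomb: "flat_span f \<Longrightarrow> flat_span g \<Longrightarrow> flat_span (\<lambda>x. f x - c * g x)"

lemma smooth_flat: "smooth (flat n)"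
proof (rule smooth_coinduct[of flat_span])
  fix f
  assume "flat_span f"
  then show "\<exists>f'. (\<forall>x. DERIV f x :> f' x) \<and> flat_span f'"
  proof induction
    case (flat n)
    show ?case
      by (intro exI[of _ "\<lambda>x. flat (n + 2) x - real n * flat (n + 1) x"] conjI allI DERIV_flat
          flat_span.lincomb flat_span.flat)
  next
    case (lincomb f g c)
    then obtain f' g' where d: "\<And>x. DERIV f x :> f' x" "\<And>x. DERIV g x :> g' x"
        "flat_span f'" "flat_span g'"
      by blast
    then show ?case
      by (intro exI[of _ "\<lambda>x. f' x - c * g' x"] conjI allI DERIV_diff DERIV_cmult flat_span.lincomb) auto
  qed
qed (rule flat_span.flat)

lemma flat_0_bounds: "0 \<le> flat 0 x" "flat 0 x \<le> 1"
  by (auto simp: flat_def)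

lemma flat_0_tendsto_indicator:
  "(\<lambda>n. flat 0 (real n * t)) \<longlonglongrightarrow> (if 0 < t then 1 else 0)"
proof (cases "0 < t")
  case True
  have "(\<lambda>n. exp (- (1 / t * (1 / real n)))) \<longlonglongrightarrow> exp (- (1 / t * 0))"
    by (intro tendsto_intros lim_1_over_n)
  moreover have "\<forall>\<^sub>F n in sequentially. exp (- (1 / t * (1 / real n))) = flat 0 (real n * t)"
    using True unfolding eventually_sequentially by (intro exI[of _ 1]) (simp add: flat_def)
  ultimately show ?thesis
    using True Lim_transform_eventually by fastforce
next
  case False
  then have "flat 0 (real n * t) = 0" for n
    by (simp add: flat_def zero_less_mult_iff)
  then show ?thesis using False by simp
qed

lemma borel_measurable_flat [measurable]: "flat n \<in> borel_measurable borel"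
  using smooth_continuous[OF smooth_flat, of UNIV 0 n] by (simp add: borel_measurable_continuous_onI)

text \<open>The functions \<open>flat 0 (real n * q x)\<close> vanish off the set where
  \<open>q\<close> is positive, lie between 0 and 1, and tend to its indicator. So one smooth
  function \<open>q\<close> with the right positivity set replaces a construction of mollified
  indicators.\<close>

lemma integral_indicator_pos_eq_0:
  fixes f q :: "real \<Rightarrow> real"
  assumes [measurable]: "f \<in> borel_measurable M" "q \<in> borel_measurable M"
    and int: "integrable M (\<lambda>x. f x * indicator {x. 0 < q x} x)"
    and zero: "\<And>n. (\<integral>x. f x * flat 0 (real n * q x) \<partial>M) = 0"
  shows "(\<integral>x. f x * indicator {x. 0 < q x} x \<partial>M) = 0"
proof -
  have "(\<lambda>n. \<integral>x. f x * flat 0 (real n * q x) \<partial>M) \<longlonglongrightarrow> (\<integral>x. f x * indicator {x. 0 < q x} x \<partial>M)"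
  proof (rule integral_dominated_convergence[where w = "\<lambda>x. \<bar>f x * indicator {x. 0 < q x} x\<bar>"])
    show "(\<lambda>x. f x * indicator {x. 0 < q x} x) \<in> borel_measurable M"
      using int by simp
    show "integrable M (\<lambda>x. \<bar>f x * indicator {x. 0 < q x} x\<bar>)"
      using int by simp
    show "(\<lambda>x. f x * flat 0 (real n * q x)) \<in> borel_measurable M" for n
      by measurable
    show "AE x in M. (\<lambda>n. f x * flat 0 (real n * q x)) \<longlonglongrightarrow> f x * indicator {x. 0 < q x} x"
    proof (rule AE_I2)
      fix x
      show "(\<lambda>n. f x * flat 0 (real n * q x)) \<longlonglongrightarrow> f x * indicator {x. 0 < q x} x"
        using tendsto_mult_left[OF flat_0_tendsto_indicator[of "q x"], of "f x"]
        by (cases "0 < q x") simp_all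
    qed
    show "AE x in M. norm (f x * flat 0 (real n * q x)) \<le> \<bar>f x * indicator {x. 0 < q x} x\<bar>" for n
    proof (rule AE_I2)
      fix x
      have "\<bar>flat 0 (real n * q x)\<bar> \<le> indicator {x. 0 < q x} x"
        using flat_0_bounds[of "real n * q x"]
        by (auto simp: flat_def indicator_def zero_less_mult_iff)
      then have "\<bar>f x\<bar> * \<bar>flat 0 (real n * q x)\<bar> \<le> \<bar>f x\<bar> * indicator {x. 0 < q x} x"
        by (intro mult_left_mono) auto
      then show "norm (f x * flat 0 (real n * q x)) \<le> \<bar>f x * indicator {x. 0 < q x} x\<bar>"
        by (simp add: abs_mult indicator_def split: if_splits)
    qed
  qed
  then show ?thesis
    by (simp add: zero LIMSEQ_const_iff)
qed

text \<open>Open intervals are stable under intersection and generate the Borel sets. By Dynkin's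
  argument the integral of \<open>f\<close> over every Borel subset of a bounded interval
  vanishes.\<close>

lemma AE_eq_0_of_intervals:
  fixes f :: "real \<Rightarrow> real"
  assumes f [measurable]: "f \<in> borel_measurable borel"
    and int: "\<And>a b. integrable lborel (\<lambda>x. f x * indicator {a<..<b} x)"
    and zero: "\<And>a b. a < b \<Longrightarrow> (\<integral>x. f x * indicator {a<..<b} x \<partial>lborel) = 0"
  shows "AE x in lborel. f x = 0"
proof -
  have zero': "(\<integral>x. f x * indicator {a<..<b} x \<partial>lborel) = 0" for a b
    using zero[of a b] by (cases "a < b") auto
  \<comment> \<open>Cutting off to a bounded interval makes \<open>f\<close> integrable, and its
    total integral is then 0 by \<open>zero'\<close>, as the complement step of the induction
    requires.\<close>
  have "AE x in lborel. f x * indicator {- real n<..<real n} x = 0" for n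
  proof (rule sigma_finite_measure.density_zero[OF lborel.sigma_finite_measure_axioms int])
    let ?g = "\<lambda>x. f x * indicator {- real n<..<real n} x"
    have borel: "sets borel = sigma_sets UNIV (range (\<lambda>(a, b). {a<..<b::real}))"
    proof -
      have eq: "(\<lambda>(a, b). {a<..<b::real}) = (\<lambda>(a, b). box a b)" by auto
      show ?thesis unfolding eq borel_eq_box by (rule sets_measure_of) simp
    qed
    fix A :: "real set"
    assume "A \<in> sets lborel"
    moreover have "sets lborel = sigma_sets UNIV (range (\<lambda>(a, b). {a<..<b::real}))"
      by (simp add: borel)
    ultimately have A: "A \<in> sigma_sets UNIV (range (\<lambda>(a, b). {a<..<b::real}))"
      by simp
    have meas: "S \<in> sets borel" if "S \<in> sigma_sets UNIV (range (\<lambda>(a, b). {a<..<b::real}))" for S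
      using that by (simp add: borel)
    have set_int: "set_integrable lborel S ?g" if "S \<in> sets borel" for S
      using integrable_mult_indicator[OF _ int, of S "- real n" "real n"] that
      by (simp add: set_integrable_def)
    show "set_lebesgue_integral lborel A ?g = 0"
      using A
    proof (induction rule: sigma_sets_induct_disjoint[rotated 2, consumes 1, case_names basic empty compl union])
      case (basic S)
      then obtain a b where S: "S = {a<..<b}" by auto
      have "(\<lambda>x. indicator S x *\<^sub>R ?g x) = (\<lambda>x. f x * indicator {max a (- real n)<..<min b (real n)} x)"
        by (auto simp: S indicator_def fun_eq_iff)
      then show ?case
        unfolding set_lebesgue_integral_def by (simp only: zero')
    next
      case empty
      then show ?case by (simp add: set_lebesgue_integral_def)
    next
      case (compl S)
      have "set_lebesgue_integral lborel (S \<union> (UNIV - S)) ?g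
          = set_lebesgue_integral lborel S ?g + set_lebesgue_integral lborel (UNIV - S) ?g"
        using meas[OF compl(1)] by (intro set_integral_Un set_int) auto
      moreover have "set_lebesgue_integral lborel (S \<union> (UNIV - S)) ?g = 0"
        using zero' by (simp add: set_lebesgue_integral_def)
      ultimately show ?case using compl by simp
    next
      case (union S)
      then have S: "S i \<in> sets borel" for i using meas by auto
      have "set_lebesgue_integral lborel (\<Union>i. S i) ?g = (\<Sum>i. set_lebesgue_integral lborel (S i) ?g)"
        using union S
        by (intro lebesgue_integral_countable_add set_int) (auto simp: disjoint_family_on_def)
      then show ?case using union by simp
    next
      show "Int_stable (range (\<lambda>(a, b). {a<..<b::real}))"
        by (auto simp: Int_stable_def image_iff)
    qed auto
  qed
  then have "AE x in lborel. \<forall>n. f x * indicator {- real n<..<real n} x = 0"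
    unfolding AE_all_countable by blast
  then show ?thesis
  proof eventually_elim
    case (elim x)
    obtain n where "real n > \<bar>x\<bar>" using reals_Archimedean2 by blast
    then show ?case using elim[rule_format, of n] by (auto simp: abs_less_iff)
  qed
qed

lemma integrable_mult_of_squares:
  fixes f g :: "'a \<Rightarrow> real"
  assumes [measurable]: "f \<in> borel_measurable M" "g \<in> borel_measurable M"
    and "integrable M (\<lambda>x. (f x)\<^sup>2)" "integrable M (\<lambda>x. (g x)\<^sup>2)"
  shows "integrable M (\<lambda>x. f x * g x)"
proof (rule Bochner_Integration.integrable_bound)
  show "integrable M (\<lambda>x. (f x)\<^sup>2 + (g x)\<^sup>2)"
    using assms by auto
  show "AE x in M. norm (f x * g x) \<le> norm ((f x)\<^sup>2 + (g x)\<^sup>2)"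
  proof (rule AE_I2)
    fix x
    have "2 * (\<bar>f x\<bar> * \<bar>g x\<bar>) \<le> (f x)\<^sup>2 + (g x)\<^sup>2"
      using sum_squares_bound[of "\<bar>f x\<bar>" "\<bar>g x\<bar>"] by (simp add: mult_ac)
    moreover have "0 \<le> \<bar>f x\<bar> * \<bar>g x\<bar>" by simp
    ultimately show "norm (f x * g x) \<le> norm ((f x)\<^sup>2 + (g x)\<^sup>2)"
      unfolding real_norm_def abs_mult by linarith
  qed
qed simp

section \<open>Differentiation under the integral sign\<close>

lemma DERIV_mean_value:
  fixes p :: "real \<Rightarrow> real"
  assumes "\<And>x. DERIV p x :> p' x"
  obtains \<xi> where "min a b \<le> \<xi>" "\<xi> \<le> max a b" "p b - p a = (b - a) * p' \<xi>"
proof (cases a b rule: linorder_cases)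
  case less
  obtain \<xi> where "a < \<xi>" "\<xi> < b" "p b - p a = (b - a) * p' \<xi>"
    using MVT2[OF less, of p p'] assms by blast
  then show thesis by (intro that[of \<xi>]) auto
next
  case equal
  then show thesis by (intro that[of a]) auto
next
  case greater
  obtain \<xi> where "b < \<xi>" "\<xi> < a" "p a - p b = (a - b) * p' \<xi>"
    using MVT2[OF greater, of p p'] assms by blast
  then show thesis by (intro that[of \<xi>]) (auto simp: algebra_simps)
qed

text \<open>By the mean value theorem the difference quotients of \<open>p\<close> are bounded by
  \<open>B'\<close>, so dominated convergence applies. The limit is taken along arbitrary null
  sequences \<open>k\<close>, the form in which dominated convergence is available for
  integrals.\<close>

lemma DERIV_convolution:
  fixes w p :: "real \<Rightarrow> real"
  assumes w: "integrable lborel w"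
    and p: "\<And>x. DERIV p x :> p' x"
    and bound: "\<And>x. \<bar>p x\<bar> \<le> B" "\<And>x. \<bar>p' x\<bar> \<le> B'"
    and cont: "continuous_on UNIV p'"
  shows "DERIV (\<lambda>y. \<integral>x. w x * p (y + x) \<partial>lborel) y :> (\<integral>x. w x * p' (y + x) \<partial>lborel)"
proof -
  have p_cont: "continuous_on UNIV p"
    using p DERIV_isCont by (blast intro: continuous_at_imp_continuous_on)
  have [measurable]: "p \<in> borel_measurable borel" "p' \<in> borel_measurable borel"
    using p_cont cont by (auto intro: borel_measurable_continuous_onI)
  have [measurable]: "w \<in> borel_measurable borel" using w by simp
  have int: "integrable lborel (\<lambda>x. w x * p (z + x))" for z
  proof (rule Bochner_Integration.integrable_bound)
    show "integrable lborel (\<lambda>x. B * w x)" using w by simp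
    show "AE x in lborel. norm (w x * p (z + x)) \<le> norm (B * w x)"
    proof (rule AE_I2)
      fix x
      have "\<bar>w x\<bar> * \<bar>p (z + x)\<bar> \<le> \<bar>w x\<bar> * \<bar>B\<bar>"
        using bound(1)[of "z + x"] by (intro mult_left_mono) auto
      then show "norm (w x * p (z + x)) \<le> norm (B * w x)"
        by (simp add: abs_mult mult.commute)
    qed
  qed simp
  have "(\<lambda>n. ((\<integral>x. w x * p (y + k n + x) \<partial>lborel) - (\<integral>x. w x * p (y + x) \<partial>lborel)) / k n)
      \<longlonglongrightarrow> (\<integral>x. w x * p' (y + x) \<partial>lborel)"
    if k: "\<And>n. k n \<noteq> 0" "k \<longlonglongrightarrow> 0" for k :: "nat \<Rightarrow> real"
  proof -
    have "(\<lambda>n. \<integral>x. w x * ((p (y + k n + x) - p (y + x)) / k n) \<partial>lborel)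
        \<longlonglongrightarrow> (\<integral>x. w x * p' (y + x) \<partial>lborel)"
    proof (rule integral_dominated_convergence[where w = "\<lambda>x. \<bar>w x\<bar> * B'"])
      show "integrable lborel (\<lambda>x. \<bar>w x\<bar> * B')" using w by simp
      show "AE x in lborel. (\<lambda>n. w x * ((p (y + k n + x) - p (y + x)) / k n)) \<longlonglongrightarrow> w x * p' (y + x)"
      proof (rule AE_I2)
        fix x
        have "((\<lambda>h. (p (y + x + h) - p (y + x)) / h) \<longlongrightarrow> p' (y + x)) (at 0)"
          using p[of "y + x"] by (simp add: DERIV_def)
        then have "(\<lambda>n. (p (y + x + k n) - p (y + x)) / k n) \<longlonglongrightarrow> p' (y + x)"
          using k by (auto simp: tendsto_at_iff_sequentially o_def)
        then show "(\<lambda>n. w x * ((p (y + k n + x) - p (y + x)) / k n)) \<longlonglongrightarrow> w x * p' (y + x)"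
          by (intro tendsto_mult_left) (simp add: add_ac)
      qed
      show "AE x in lborel. norm (w x * ((p (y + k n + x) - p (y + x)) / k n)) \<le> \<bar>w x\<bar> * B'" for n
      proof (rule AE_I2)
        fix x
        obtain \<xi> where "p (y + k n + x) - p (y + x) = (y + k n + x - (y + x)) * p' \<xi>"
          using DERIV_mean_value[of p p' "y + x" "y + k n + x"] p by metis
        then have "(p (y + k n + x) - p (y + x)) / k n = p' \<xi>"
          using k(1)[of n] by simp
        then have "\<bar>(p (y + k n + x) - p (y + x)) / k n\<bar> \<le> B'"
          using bound(2)[of \<xi>] by simp
        then show "norm (w x * ((p (y + k n + x) - p (y + x)) / k n)) \<le> \<bar>w x\<bar> * B'"
          unfolding real_norm_def abs_mult by (rule mult_left_mono) simp
      qed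
    qed simp_all
    moreover have "(\<integral>x. w x * ((p (y + k n + x) - p (y + x)) / k n) \<partial>lborel)
        = ((\<integral>x. w x * p (y + k n + x) \<partial>lborel) - (\<integral>x. w x * p (y + x) \<partial>lborel)) / k n" for n
      using int[of "y + k n"] int[of y]
      by (simp add: right_diff_distrib diff_divide_distrib)
    ultimately show ?thesis by (simp only:)
  qed
  then show ?thesis
    unfolding DERIV_def tendsto_at_iff_sequentially by (auto simp: o_def)
qed

lemma smooth_convolution:
  assumes w: "integrable lborel w" and f: "smooth f" and bound: "\<And>n. \<exists>B. \<forall>x. \<bar>(deriv ^^ n) f x\<bar> \<le> B"
  shows "smooth (\<lambda>y. \<integral>x. w x * f (y + x) \<partial>lborel)"
    and "(deriv ^^ n) (\<lambda>y. \<integral>x. w x * f (y + x) \<partial>lborel) = (\<lambda>y. \<integral>x. w x * (deriv ^^ n) f (y + x) \<partial>lborel)"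
proof -
  let ?F = "\<lambda>n y. \<integral>x. w x * (deriv ^^ n) f (y + x) \<partial>lborel"
  have "DERIV (?F n) y :> ?F (Suc n) y" for n y
  proof -
    obtain B B' where "\<And>x. \<bar>(deriv ^^ n) f x\<bar> \<le> B" "\<And>x. \<bar>(deriv ^^ Suc n) f x\<bar> \<le> B'"
      using bound[of n] bound[of "Suc n"] by blast
    then show ?thesis
      using smooth_DERIV[OF f] smooth_continuous[OF f] by (intro DERIV_convolution[OF w])
  qed
  moreover have "?F 0 = (\<lambda>y. \<integral>x. w x * f (y + x) \<partial>lborel)" by simp
  ultimately show "smooth (\<lambda>y. \<integral>x. w x * f (y + x) \<partial>lborel)"
    and "(deriv ^^ n) (\<lambda>y. \<integral>x. w x * f (y + x) \<partial>lborel) = (\<lambda>y. \<integral>x. w x * (deriv ^^ n) f (y + x) \<partial>lborel)"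
    using smoothI_DERIV[of ?F] by blast+
qed

lemma smooth_reflect:
  assumes "smooth f"
  shows "smooth (\<lambda>x. f (- x))"
    and "(deriv ^^ n) (\<lambda>x. f (- x)) = (\<lambda>x. (- 1) ^ n * (deriv ^^ n) f (- x))"
proof -
  let ?F = "\<lambda>n x. (- 1) ^ n * (deriv ^^ n) f (- x)"
  have "DERIV (?F n) x :> ?F (Suc n) x" for n x
  proof -
    have "DERIV (\<lambda>x. (deriv ^^ n) f (- x)) x :> (deriv ^^ Suc n) f (- x) * - 1"
      by (rule DERIV_chain2[OF smooth_DERIV[OF assms]]) (auto intro!: derivative_eq_intros)
    from DERIV_cmult[OF this, of "(- 1) ^ n"] show ?thesis by simp
  qed
  moreover have "?F 0 = (\<lambda>x. f (- x))" by simp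
  ultimately show "smooth (\<lambda>x. f (- x))"
    and "(deriv ^^ n) (\<lambda>x. f (- x)) = (\<lambda>x. (- 1) ^ n * (deriv ^^ n) f (- x))"
    using smoothI_DERIV[of ?F] by blast+
qed

text \<open>The topologies of both test spaces come from suprema of weighted derivatives, with
  weight \<open>(1 + \<bar>y\<bar>) ^ N\<close> on the line and 1 on the circle, so the estimates on
  translates and convolutions are proved once. \<open>weight_add\<close> is an inequality of Peetre
  type: it makes the seminorms of translates grow at most polynomially.\<close>

locale weighted_seminorms =
  fixes sem :: "nat \<Rightarrow> nat \<Rightarrow> 'a::test_space \<Rightarrow> real" and weight :: "nat \<Rightarrow> real \<Rightarrow> real"
  assumes smooth: "smooth (fun_of \<phi>)"
    and snorm_eq: "snorm N \<phi> = (\<Sum>n\<le>N. sem N n \<phi>)"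
    and sem_upper: "weight N y * \<bar>(deriv ^^ n) (fun_of \<phi>) y\<bar> \<le> sem N n \<phi>"
    and sem_least: "(\<And>y. weight N y * \<bar>(deriv ^^ n) (fun_of \<phi>) y\<bar> \<le> B) \<Longrightarrow> sem N n \<phi> \<le> B"
    and sem_mono: "sem N n \<phi> \<le> sem (Suc N) n \<phi>"
    and weight_ge_1: "1 \<le> weight N y"
    and weight_even: "weight N (- y) = weight N y"
    and weight_add: "weight N y \<le> (1 + \<bar>x\<bar>) ^ N * weight N (y + x)"
    and reflect_member: "\<exists>\<psi>::'a. fun_of \<psi> = (\<lambda>x. fun_of \<phi> (- x))"
    and convolve_member: "rapidly_decreasing w \<Longrightarrow>
      \<exists>\<psi>::'a. fun_of \<psi> = (\<lambda>y. \<integral>x. w x * fun_of \<phi> (y + x) \<partial>lborel)"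
begin

lemma weight_nonneg: "0 \<le> weight N y"
  using weight_ge_1[of N y] by linarith

lemma sem_nonneg: "0 \<le> sem N n \<phi>"
  using sem_upper[of N 0 n \<phi>] weight_nonneg[of N 0] by (meson abs_ge_zero mult_nonneg_nonneg order_trans)

lemma sem_le_snorm:
  fixes \<phi> :: 'a
  shows "n \<le> N \<Longrightarrow> sem N n \<phi> \<le> snorm N \<phi>"
  unfolding snorm_eq by (rule member_le_sum) (auto simp: sem_nonneg)

lemma deriv_fun_of_bound:
  fixes \<phi> :: 'a
  shows "\<exists>B. \<forall>x. \<bar>(deriv ^^ n) (fun_of \<phi>) x\<bar> \<le> B"
proof (intro exI allI)
  fix x
  have "1 * \<bar>(deriv ^^ n) (fun_of \<phi>) x\<bar> \<le> weight 0 x * \<bar>(deriv ^^ n) (fun_of \<phi>) x\<bar>"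
    by (intro mult_right_mono weight_ge_1) simp
  then show "\<bar>(deriv ^^ n) (fun_of \<phi>) x\<bar> \<le> sem 0 n \<phi>"
    using sem_upper[of 0 x n \<phi>] by linarith
qed

lemma deriv_translate:
  fixes \<phi> :: 'a
  shows "(deriv ^^ n) (fun_of (translate (- x) \<phi>)) y = (deriv ^^ n) (fun_of \<phi>) (y + x)"
proof -
  have "fun_of (translate (- x) \<phi>) = (\<lambda>y. fun_of \<phi> (y - (- x)))"
    by (simp add: fun_eq_iff fun_of_translate)
  then show ?thesis
    using smooth_translate(2)[OF smooth, of n \<phi> "- x"] by simp
qed

lemma deriv_diff:
  fixes \<phi> \<psi> :: 'a
  shows "(deriv ^^ n) (fun_of (\<phi> - \<psi>)) y = (deriv ^^ n) (fun_of \<phi>) y - (deriv ^^ n) (fun_of \<psi>) y"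
proof -
  have "fun_of (\<phi> - \<psi>) = (\<lambda>y. fun_of \<phi> y + (- 1) * fun_of \<psi> y)"
    by (simp add: fun_eq_iff fun_of_diff)
  then show ?thesis
    using smooth_add(2)[OF smooth smooth_cmult(1)[OF smooth], of n \<phi> "- 1" \<psi>]
      smooth_cmult(2)[OF smooth, of n "- 1" \<psi>] by simp
qed

lemma deriv_scaleR:
  fixes \<phi> :: 'a
  shows "(deriv ^^ n) (fun_of (c *\<^sub>R \<phi>)) y = c * (deriv ^^ n) (fun_of \<phi>) y"
proof -
  have "fun_of (c *\<^sub>R \<phi>) = (\<lambda>y. c * fun_of \<phi> y)"
    by (simp add: fun_eq_iff fun_of_scaleR)
  then show ?thesis
    using smooth_cmult(2)[OF smooth, of n c \<phi>] by simp
qed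

lemma reflection_exists:
  fixes \<phi> :: 'a
  shows "\<exists>\<psi>::'a. (\<forall>x. fun_of \<psi> x = fun_of \<phi> (- x)) \<and> (\<forall>N. snorm N \<psi> \<le> snorm N \<phi>)"
proof -
  obtain \<psi> :: 'a where \<psi>: "fun_of \<psi> = (\<lambda>x. fun_of \<phi> (- x))"
    using reflect_member[of \<phi>] by blast
  have "sem N n \<psi> \<le> sem N n \<phi>" for N n
  proof (rule sem_least)
    fix y
    show "weight N y * \<bar>(deriv ^^ n) (fun_of \<psi>) y\<bar> \<le> sem N n \<phi>"
      using sem_upper[of N "- y" n \<phi>]
      by (simp add: \<psi> smooth_reflect(2)[OF smooth] weight_even abs_mult power_abs)
  qed
  then have "snorm N \<psi> \<le> snorm N \<phi>" for N
    unfolding snorm_eq by (rule sum_mono)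
  with \<psi> show ?thesis by (intro exI[of _ \<psi>]) simp
qed

lemma sem_translate:
  fixes \<phi> :: 'a
  shows "sem N n (translate (- x) \<phi>) \<le> (1 + \<bar>x\<bar>) ^ N * sem N n \<phi>"
proof (rule sem_least)
  fix y
  have "weight N y * \<bar>(deriv ^^ n) (fun_of (translate (- x) \<phi>)) y\<bar>
      \<le> ((1 + \<bar>x\<bar>) ^ N * weight N (y + x)) * \<bar>(deriv ^^ n) (fun_of \<phi>) (y + x)\<bar>"
    unfolding deriv_translate by (intro mult_right_mono weight_add) simp
  also have "\<dots> \<le> (1 + \<bar>x\<bar>) ^ N * sem N n \<phi>"
    unfolding mult.assoc by (intro mult_left_mono sem_upper) simp
  finally show "weight N y * \<bar>(deriv ^^ n) (fun_of (translate (- x) \<phi>)) y\<bar> \<le> (1 + \<bar>x\<bar>) ^ N * sem N n \<phi>" .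
qed

lemma snorm_translate_le:
  fixes \<phi> :: 'a
  shows "snorm N (translate (- x) \<phi>) \<le> (1 + \<bar>x\<bar>) ^ N * snorm N \<phi>"
  unfolding snorm_eq sum_distrib_left by (intro sum_mono sem_translate)

text \<open>The mean value theorem costs one derivative and evaluates it at a point \<xi> between
  \<open>y + t\<close> and \<open>y + x\<close>. Moving the weight from \<open>y\<close> to \<xi>
  costs the power of \<open>1 + \<bar>x\<bar> + \<bar>t\<bar>\<close>, since
  \<open>\<bar>\<xi> - y\<bar>\<close> is at most
  \<open>\<bar>x\<bar> + \<bar>t\<bar>\<close>.\<close>

lemma sem_translate_diff:
  fixes \<phi> :: 'a
  shows "sem N n (translate (- x) \<phi> - translate (- t) \<phi>) \<le> \<bar>x - t\<bar> * (1 + \<bar>x\<bar> + \<bar>t\<bar>) ^ N * sem (Suc N) (Suc n) \<phi>"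
proof (rule sem_least)
  fix y
  let ?D = "\<lambda>n. (deriv ^^ n) (fun_of \<phi>)"
  obtain \<xi> where \<xi>: "min (y + t) (y + x) \<le> \<xi>" "\<xi> \<le> max (y + t) (y + x)"
      "?D n (y + x) - ?D n (y + t) = (y + x - (y + t)) * ?D (Suc n) \<xi>"
    using DERIV_mean_value[of "?D n" "?D (Suc n)" "y + t" "y + x"] smooth_DERIV[OF smooth] by metis
  have "weight N y \<le> (1 + \<bar>\<xi> - y\<bar>) ^ N * weight N \<xi>"
    using weight_add[of N y "\<xi> - y"] by simp
  also have "\<dots> \<le> (1 + \<bar>x\<bar> + \<bar>t\<bar>) ^ N * weight N \<xi>"
    using \<xi>(1,2) by (intro mult_right_mono power_mono weight_nonneg) auto
  finally have "weight N y * (\<bar>x - t\<bar> * \<bar>?D (Suc n) \<xi>\<bar>)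
      \<le> ((1 + \<bar>x\<bar> + \<bar>t\<bar>) ^ N * weight N \<xi>) * (\<bar>x - t\<bar> * \<bar>?D (Suc n) \<xi>\<bar>)"
    by (rule mult_right_mono) simp
  also have "\<dots> = \<bar>x - t\<bar> * (1 + \<bar>x\<bar> + \<bar>t\<bar>) ^ N * (weight N \<xi> * \<bar>?D (Suc n) \<xi>\<bar>)"
    by (simp only: mult_ac)
  also have "\<dots> \<le> \<bar>x - t\<bar> * (1 + \<bar>x\<bar> + \<bar>t\<bar>) ^ N * sem (Suc N) (Suc n) \<phi>"
    by (intro mult_left_mono order_trans[OF sem_upper sem_mono]) simp
  finally show "weight N y * \<bar>(deriv ^^ n) (fun_of (translate (- x) \<phi> - translate (- t) \<phi>)) y\<bar>
      \<le> \<bar>x - t\<bar> * (1 + \<bar>x\<bar> + \<bar>t\<bar>) ^ N * sem (Suc N) (Suc n) \<phi>"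
    unfolding deriv_diff deriv_translate \<xi>(3) by (simp add: abs_mult)
qed

lemma snorm_translate_diff_le:
  fixes \<phi> :: 'a
  shows "snorm N (translate (- x) \<phi> - translate (- t) \<phi>) \<le> \<bar>x - t\<bar> * (1 + \<bar>x\<bar> + \<bar>t\<bar>) ^ N * snorm (Suc N) \<phi>"
proof -
  have "snorm N (translate (- x) \<phi> - translate (- t) \<phi>)
      \<le> (\<Sum>n\<le>N. \<bar>x - t\<bar> * (1 + \<bar>x\<bar> + \<bar>t\<bar>) ^ N * sem (Suc N) (Suc n) \<phi>)"
    unfolding snorm_eq by (intro sum_mono sem_translate_diff)
  also have "\<dots> = \<bar>x - t\<bar> * (1 + \<bar>x\<bar> + \<bar>t\<bar>) ^ N * (\<Sum>n\<le>N. sem (Suc N) (Suc n) \<phi>)"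
    by (simp only: sum_distrib_left)
  also have "\<dots> \<le> \<bar>x - t\<bar> * (1 + \<bar>x\<bar> + \<bar>t\<bar>) ^ N * snorm (Suc N) \<phi>"
  proof (intro mult_left_mono)
    show "(\<Sum>n\<le>N. sem (Suc N) (Suc n) \<phi>) \<le> snorm (Suc N) \<phi>"
      unfolding snorm_eq sum.atMost_Suc_shift by (simp add: sem_nonneg)
  qed simp
  finally show ?thesis .
qed

lemma convolution_exists:
  fixes \<phi> :: 'a
  assumes w: "rapidly_decreasing w"
  shows "\<exists>\<psi>. (\<forall>y. fun_of \<psi> y = (\<integral>x. w x * fun_of \<phi> (y + x) \<partial>lborel)) \<and>
    (\<forall>N \<eta> B. (\<forall>x. w x \<noteq> 0 \<longrightarrow> snorm N (translate (- x) \<phi> - \<eta>) \<le> B x) \<longrightarrow>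
      integrable lborel (\<lambda>x. \<bar>w x\<bar> * B x) \<longrightarrow>
      snorm N (\<psi> - (\<integral>x. w x \<partial>lborel) *\<^sub>R \<eta>) \<le> real (Suc N) * (\<integral>x. \<bar>w x\<bar> * B x \<partial>lborel))"
proof -
  let ?D = "\<lambda>n \<phi>. (deriv ^^ n) (fun_of \<phi>)"
  have [measurable]: "w \<in> borel_measurable borel"
    using w by (rule rapidly_decreasing_measurable)
  have w_int: "integrable lborel w"
    using integrable_rapidly_decreasing_mult[OF w, of "\<lambda>_. 1" 1 0] by simp
  obtain \<psi> :: 'a where \<psi>: "fun_of \<psi> = (\<lambda>y. \<integral>x. w x * fun_of \<phi> (y + x) \<partial>lborel)"
    using convolve_member[OF w, of \<phi>] by blast
  have D\<psi>: "?D n \<psi> y = (\<integral>x. w x * ?D n \<phi> (y + x) \<partial>lborel)" for n y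
    unfolding \<psi> smooth_convolution(2)[OF w_int smooth deriv_fun_of_bound] ..
  have D_int: "integrable lborel (\<lambda>x. w x * ?D n \<phi> (y + x))" for n y
  proof -
    obtain B where "\<And>x. \<bar>?D n \<phi> x\<bar> \<le> B" using deriv_fun_of_bound by blast
    then show ?thesis
      by (intro integrable_rapidly_decreasing_mult[OF w, of _ B 0])
         (auto intro!: borel_measurable_continuous_onI continuous_on_compose2[OF smooth_continuous[OF smooth]]
           continuous_intros)
  qed
  have "snorm N (\<psi> - (\<integral>x. w x \<partial>lborel) *\<^sub>R \<eta>) \<le> real (Suc N) * (\<integral>x. \<bar>w x\<bar> * B x \<partial>lborel)"
    if near: "\<And>x. w x \<noteq> 0 \<Longrightarrow> snorm N (translate (- x) \<phi> - \<eta>) \<le> B x"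
      and int: "integrable lborel (\<lambda>x. \<bar>w x\<bar> * B x)" for N \<eta> B
  proof -
    have "sem N n (\<psi> - (\<integral>x. w x \<partial>lborel) *\<^sub>R \<eta>) \<le> (\<integral>x. \<bar>w x\<bar> * B x \<partial>lborel)" if "n \<le> N" for n
    proof (rule sem_least)
      fix y
      \<comment> \<open>With the multiple of \<eta> written under the same integral, only the
        distance of each single translate to \<eta> enters.\<close>
      have eq: "?D n (\<psi> - (\<integral>x. w x \<partial>lborel) *\<^sub>R \<eta>) y = (\<integral>x. w x * (?D n \<phi> (y + x) - ?D n \<eta> y) \<partial>lborel)"
        using D_int[of n y] w_int by (simp add: deriv_diff deriv_scaleR D\<psi> right_diff_distrib)
      have "weight N y * \<bar>\<integral>x. w x * (?D n \<phi> (y + x) - ?D n \<eta> y) \<partial>lborel\<bar>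
          \<le> weight N y * (\<integral>x. \<bar>w x * (?D n \<phi> (y + x) - ?D n \<eta> y)\<bar> \<partial>lborel)"
        by (intro mult_left_mono integral_abs_bound weight_nonneg)
      also have "\<dots> = (\<integral>x. weight N y * \<bar>w x * (?D n \<phi> (y + x) - ?D n \<eta> y)\<bar> \<partial>lborel)"
        by simp
      also have "\<dots> \<le> (\<integral>x. \<bar>w x\<bar> * B x \<partial>lborel)"
      proof (rule integral_mono[OF _ int])
        show "integrable lborel (\<lambda>x. weight N y * \<bar>w x * (?D n \<phi> (y + x) - ?D n \<eta> y)\<bar>)"
          using D_int[of n y] w_int by (intro integrable_mult_right integrable_abs) (simp add: right_diff_distrib)
        fix x
        show "weight N y * \<bar>w x * (?D n \<phi> (y + x) - ?D n \<eta> y)\<bar> \<le> \<bar>w x\<bar> * B x"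
        proof (cases "w x = 0")
          case False
          have "weight N y * \<bar>?D n \<phi> (y + x) - ?D n \<eta> y\<bar> \<le> sem N n (translate (- x) \<phi> - \<eta>)"
            using sem_upper[of N y n "translate (- x) \<phi> - \<eta>"] by (simp add: deriv_diff deriv_translate)
          also have "\<dots> \<le> B x"
            using sem_le_snorm[OF \<open>n \<le> N\<close>] near[OF False] by (rule order_trans)
          finally have "\<bar>w x\<bar> * (weight N y * \<bar>?D n \<phi> (y + x) - ?D n \<eta> y\<bar>) \<le> \<bar>w x\<bar> * B x"
            by (rule mult_left_mono) simp
          then show ?thesis by (simp only: abs_mult mult_ac)
        qed simp
      qed
      finally show "weight N y * \<bar>?D n (\<psi> - (\<integral>x. w x \<partial>lborel) *\<^sub>R \<eta>) y\<bar> \<le> (\<integral>x. \<bar>w x\<bar> * B x \<partial>lborel)"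
        unfolding eq .
    qed
    \<comment> \<open>Each of the \<open>Suc N\<close> summands is bounded by the same integral,
      hence the factor.\<close>
    then have "snorm N (\<psi> - (\<integral>x. w x \<partial>lborel) *\<^sub>R \<eta>) \<le> (\<Sum>n\<le>N. \<integral>x. \<bar>w x\<bar> * B x \<partial>lborel)"
      unfolding snorm_eq by (intro sum_mono) auto
    then show ?thesis by simp
  qed
  with \<psi> show ?thesis by (intro exI[of _ \<psi>]) auto
qed

end

section \<open>The two spaces of test functions\<close>

lemma smooth_compact_support_schwartz:
  assumes f: "smooth f" and supp: "\<And>x. R < \<bar>x\<bar> \<Longrightarrow> f x = 0"
  shows "schwartz_function f"
proof -
  have zero: "(deriv ^^ n) f x = 0" if "R < \<bar>x\<bar>" for n x
    using that
  proof (induction n arbitrary: x)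
    case (Suc n)
    have "open {x::real. R < \<bar>x\<bar>}"
      by (intro open_Collect_less continuous_intros)
    then have "\<forall>\<^sub>F y in nhds x. (deriv ^^ n) f y = 0"
      using Suc by (auto simp: eventually_nhds intro!: exI[of _ "{x. R < \<bar>x\<bar>}"])
    then have "deriv ((deriv ^^ n) f) x = deriv (\<lambda>_. 0) x"
      by (intro deriv_cong_ev) auto
    then show ?case by simp
  qed (simp add: supp)
  have "bdd_above (range (\<lambda>x. (1 + \<bar>x\<bar>) ^ m * \<bar>(deriv ^^ n) f x\<bar>))" for m n
  proof -
    let ?g = "\<lambda>x. (1 + \<bar>x\<bar>) ^ m * \<bar>(deriv ^^ n) f x\<bar>"
    have "compact (?g ` {-\<bar>R\<bar>..\<bar>R\<bar>})"
      by (intro compact_continuous_image continuous_intros smooth_continuous f compact_Icc)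
    then have "bdd_above (?g ` {-\<bar>R\<bar>..\<bar>R\<bar>})"
      by (intro bounded_imp_bdd_above compact_imp_bounded)
    then have "\<exists>B. \<forall>x\<in>{-\<bar>R\<bar>..\<bar>R\<bar>}. ?g x \<le> B"
      by (simp add: bdd_above_def)
    then obtain B where B: "\<And>x. x \<in> {-\<bar>R\<bar>..\<bar>R\<bar>} \<Longrightarrow> ?g x \<le> B"
      by blast
    have "?g x \<le> max B 0" for x
    proof (cases "x \<in> {-\<bar>R\<bar>..\<bar>R\<bar>}")
      case True
      then show ?thesis using B[of x] by simp
    next
      case False
      then have "R < \<bar>x\<bar>" by auto
      then show ?thesis by (simp add: zero)
    qed
    then show ?thesis by (rule bdd_above_rangeI)
  qed
  with f show ?thesis unfolding schwartz_function_def by blast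
qed

lemma schwartz_function_reflect:
  assumes "schwartz_function f"
  shows "schwartz_function (\<lambda>x. f (- x))"
proof -
  have s: "smooth f" and b: "\<And>m n. bdd_above (range (\<lambda>x. (1 + \<bar>x\<bar>) ^ m * \<bar>(deriv ^^ n) f x\<bar>))"
    using assms unfolding schwartz_function_def by auto
  have "bdd_above (range (\<lambda>x. (1 + \<bar>x\<bar>) ^ m * \<bar>(deriv ^^ n) (\<lambda>x. f (- x)) x\<bar>))" for m n
  proof -
    obtain A where A: "\<And>x. (1 + \<bar>x\<bar>) ^ m * \<bar>(deriv ^^ n) f x\<bar> \<le> A"
      using bdd_above_rangeD[OF b] by metis
    have "(1 + \<bar>x\<bar>) ^ m * \<bar>(deriv ^^ n) (\<lambda>x. f (- x)) x\<bar> \<le> A" for x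
      using A[of "- x"] by (simp add: smooth_reflect(2)[OF s] abs_mult power_abs)
    then show ?thesis by (rule bdd_above_rangeI)
  qed
  then show ?thesis
    unfolding schwartz_function_def using smooth_reflect(1)[OF s] by blast
qed

text \<open>The weight at \<open>y\<close> is at most the product of the weights at \<open>x\<close>
  and at \<open>y + x\<close>. The first is absorbed by the decay of \<open>w\<close>, the second by
  that of \<open>f\<close>.\<close>

lemma schwartz_function_convolution:
  assumes "schwartz_function f" and w: "rapidly_decreasing w"
  shows "schwartz_function (\<lambda>y. \<integral>x. w x * f (y + x) \<partial>lborel)"
proof -
  have s: "smooth f" and b: "\<And>m n. bdd_above (range (\<lambda>x. (1 + \<bar>x\<bar>) ^ m * \<bar>(deriv ^^ n) f x\<bar>))"
    using assms unfolding schwartz_function_def by auto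
  have [measurable]: "w \<in> borel_measurable borel"
    using w by (rule rapidly_decreasing_measurable)
  have w_int: "integrable lborel w"
    using integrable_rapidly_decreasing_mult[OF w, of "\<lambda>_. 1" 1 0] by simp
  have bd: "\<exists>B. \<forall>x. \<bar>(deriv ^^ n) f x\<bar> \<le> B" for n
    using bdd_above_rangeD[OF b[of 0 n]] by simp
  note conv = smooth_convolution[OF w_int s bd]
  have "bdd_above (range (\<lambda>y. (1 + \<bar>y\<bar>) ^ m * \<bar>(deriv ^^ n) (\<lambda>y. \<integral>x. w x * f (y + x) \<partial>lborel) y\<bar>))" for m n
  proof -
    let ?D = "(deriv ^^ n) f"
    obtain A where A: "\<And>x. (1 + \<bar>x\<bar>) ^ m * \<bar>?D x\<bar> \<le> A"
      using bdd_above_rangeD[OF b] by metis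
    have D_int: "integrable lborel (\<lambda>x. w x * ?D (y + x))" for y
    proof -
      obtain B where "\<And>x. \<bar>?D x\<bar> \<le> B" using bd by blast
      then show ?thesis
        by (intro integrable_rapidly_decreasing_mult[OF w, of _ B 0])
           (auto intro!: borel_measurable_continuous_onI continuous_on_compose2[OF smooth_continuous[OF s]]
             continuous_intros)
    qed
    have "(1 + \<bar>y\<bar>) ^ m * \<bar>\<integral>x. w x * ?D (y + x) \<partial>lborel\<bar> \<le> (\<integral>x. \<bar>w x\<bar> * (1 + \<bar>x\<bar>) ^ m * A \<partial>lborel)" for y
    proof -
      have "(1 + \<bar>y\<bar>) ^ m * \<bar>\<integral>x. w x * ?D (y + x) \<partial>lborel\<bar>
          \<le> (1 + \<bar>y\<bar>) ^ m * (\<integral>x. \<bar>w x * ?D (y + x)\<bar> \<partial>lborel)"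
        by (intro mult_left_mono integral_abs_bound) simp
      also have "\<dots> = (\<integral>x. (1 + \<bar>y\<bar>) ^ m * \<bar>w x * ?D (y + x)\<bar> \<partial>lborel)" by simp
      also have "\<dots> \<le> (\<integral>x. \<bar>w x\<bar> * (1 + \<bar>x\<bar>) ^ m * A \<partial>lborel)"
      proof (rule integral_mono)
        show "integrable lborel (\<lambda>x. (1 + \<bar>y\<bar>) ^ m * \<bar>w x * ?D (y + x)\<bar>)"
          by (intro integrable_mult_right integrable_abs D_int)
        show "integrable lborel (\<lambda>x. \<bar>w x\<bar> * (1 + \<bar>x\<bar>) ^ m * A)"
          by (intro integrable_mult_left integrable_rapidly_decreasing_weight w)
        fix x
        have "(1 + \<bar>y\<bar>) ^ m * \<bar>?D (y + x)\<bar> \<le> ((1 + \<bar>x\<bar>) ^ m * (1 + \<bar>y + x\<bar>) ^ m) * \<bar>?D (y + x)\<bar>"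
          using translate_weight[of y m "- x"] by (intro mult_right_mono) auto
        also have "\<dots> \<le> (1 + \<bar>x\<bar>) ^ m * A"
          unfolding mult.assoc by (intro mult_left_mono A) simp
        finally have "\<bar>w x\<bar> * ((1 + \<bar>y\<bar>) ^ m * \<bar>?D (y + x)\<bar>) \<le> \<bar>w x\<bar> * ((1 + \<bar>x\<bar>) ^ m * A)"
          by (rule mult_left_mono) simp
        then show "(1 + \<bar>y\<bar>) ^ m * \<bar>w x * ?D (y + x)\<bar> \<le> \<bar>w x\<bar> * (1 + \<bar>x\<bar>) ^ m * A"
          by (simp only: abs_mult mult_ac)
      qed
      finally show ?thesis .
    qed
    then show ?thesis
      unfolding conv(2) by (rule bdd_above_rangeI)
  qed
  then show ?thesis
    unfolding schwartz_function_def using conv(1) by blast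
qed

interpretation schwartz: weighted_seminorms schwartz_seminorm "\<lambda>N y. (1 + \<bar>y\<bar>) ^ N"
proof
  fix \<phi> :: schwartz and N n :: nat and x y B :: real and w :: "real \<Rightarrow> real"
  show "smooth (fun_of \<phi>)"
    unfolding fun_of_schwartz_def by (rule schwartz_smooth)
  show "snorm N \<phi> = (\<Sum>n\<le>N. schwartz_seminorm N n \<phi>)"
    by (rule snorm_schwartz_def)
  show "(1 + \<bar>y\<bar>) ^ N * \<bar>(deriv ^^ n) (fun_of \<phi>) y\<bar> \<le> schwartz_seminorm N n \<phi>"
    unfolding fun_of_schwartz_def by (rule schwartz_seminorm_upper)
  show "schwartz_seminorm N n \<phi> \<le> B"
    if "\<And>y. (1 + \<bar>y\<bar>) ^ N * \<bar>(deriv ^^ n) (fun_of \<phi>) y\<bar> \<le> B"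
    using that unfolding fun_of_schwartz_def by (rule schwartz_seminorm_least)
  show "schwartz_seminorm N n \<phi> \<le> schwartz_seminorm (Suc N) n \<phi>"
    by (rule schwartz_seminorm_mono) simp
  show "1 \<le> (1 + \<bar>y\<bar>) ^ N" by (rule one_le_power) simp
  show "(1 + \<bar>- y\<bar>) ^ N = (1 + \<bar>y\<bar>) ^ N" by simp
  show "(1 + \<bar>y\<bar>) ^ N \<le> (1 + \<bar>x\<bar>) ^ N * (1 + \<bar>y + x\<bar>) ^ N"
    using translate_weight[of y N "- x"] by simp
  have \<phi>: "schwartz_function (fun_of \<phi>)"
    using schwartz_fun[of \<phi>] by (simp add: fun_of_schwartz_def)
  show "\<exists>\<psi>::schwartz. fun_of \<psi> = (\<lambda>x. fun_of \<phi> (- x))"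
    using Schwartz_inverse[of "\<lambda>x. fun_of \<phi> (- x)"] schwartz_function_reflect[OF \<phi>]
    unfolding fun_of_schwartz_def by auto
  show "\<exists>\<psi>::schwartz. fun_of \<psi> = (\<lambda>y. \<integral>x. w x * fun_of \<phi> (y + x) \<partial>lborel)" if "rapidly_decreasing w"
    using Schwartz_inverse[of "\<lambda>y. \<integral>x. w x * fun_of \<phi> (y + x) \<partial>lborel"]
      schwartz_function_convolution[OF \<phi> that]
    unfolding fun_of_schwartz_def by auto
qed

interpretation circle: weighted_seminorms "\<lambda>_. circle_seminorm" "\<lambda>_ _. 1"
proof
  fix \<theta> :: circle_test and N n :: nat and x y B :: real and w :: "real \<Rightarrow> real"
  show \<theta>: "smooth (fun_of \<theta>)"
    unfolding fun_of_circle_test_def by (rule circle_smooth)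
  show "snorm N \<theta> = (\<Sum>n\<le>N. circle_seminorm n \<theta>)"
    by (rule snorm_circle_test_def)
  show "1 * \<bar>(deriv ^^ n) (fun_of \<theta>) y\<bar> \<le> circle_seminorm n \<theta>"
    unfolding fun_of_circle_test_def mult_1 by (rule circle_seminorm_upper)
  show "circle_seminorm n \<theta> \<le> B" if "\<And>y. 1 * \<bar>(deriv ^^ n) (fun_of \<theta>) y\<bar> \<le> B"
    using that unfolding fun_of_circle_test_def mult_1 by (rule circle_seminorm_least)
  show "1 \<le> (1 + \<bar>x\<bar>) ^ N * 1" by (simp add: one_le_power)
  have per: "fun_of \<theta> (z + 1) = fun_of \<theta> z" for z
    using circle_periodic[of 0 \<theta>] by (simp add: fun_of_circle_test_def)
  have "fun_of \<theta> (- (z + 1)) = fun_of \<theta> (- z)" for z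
    using per[of "- z - 1"] by simp
  then show "\<exists>\<psi>::circle_test. fun_of \<psi> = (\<lambda>x. fun_of \<theta> (- x))"
    using Circle_test_inverse[of "\<lambda>x. fun_of \<theta> (- x)"] smooth_reflect(1)[OF \<theta>]
    unfolding fun_of_circle_test_def by auto
  assume w: "rapidly_decreasing w"
  have w_int: "integrable lborel w"
    using integrable_rapidly_decreasing_mult[OF w, of "\<lambda>_. 1" 1 0] by simp
  have bd: "\<exists>B. \<forall>x. \<bar>(deriv ^^ n) (fun_of \<theta>) x\<bar> \<le> B" for n
    unfolding fun_of_circle_test_def by (intro exI allI) (rule circle_seminorm_upper)
  have "fun_of \<theta> (y + 1 + x) = fun_of \<theta> (y + x)" for x y
    using per[of "y + x"] by (simp add: add_ac)
  then show "\<exists>\<psi>::circle_test. fun_of \<psi> = (\<lambda>y. \<integral>x. w x * fun_of \<theta> (y + x) \<partial>lborel)"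
    using Circle_test_inverse[of "\<lambda>y. \<integral>x. w x * fun_of \<theta> (y + x) \<partial>lborel"]
      smooth_convolution(1)[OF w_int \<theta> bd]
    unfolding fun_of_circle_test_def by auto
qed simp_all

text \<open>A closed set that contains almost every point of an open set contains the whole open
  set. The closure matters for the circle, where the point 0 of the period lies only on the boundary
  of the open interval (0, 1).\<close>

lemma continuous_AE_zero:
  fixes f :: "real \<Rightarrow> real"
  assumes f: "continuous_on UNIV f" and S: "open S" and zero: "AE x in lborel. x \<in> S \<longrightarrow> f x = 0"
    and x: "x \<in> closure S"
  shows "f x = 0"
proof -
  have closed: "closed {x. f x = 0}"
    using f by (intro closed_Collect_eq continuous_on_const)
  have "AE x in lebesgue. x \<in> S \<longrightarrow> x \<in> {x. f x = 0}"
    using AE_completion[OF zero] by simp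
  then have "S \<subseteq> {x. f x = 0}"
    using mem_closed_if_AE_lebesgue_open[OF S closed] by blast
  then show ?thesis
    using closure_minimal[OF _ closed] x by blast
qed

lemma mult_diff_pos_iff:
  fixes a b x :: real
  assumes "a < b"
  shows "0 < (b - x) * (x - a) \<longleftrightarrow> x \<in> {a<..<b}"
proof -
  have "\<not> (b < x \<and> x < a)" using assms by linarith
  then show ?thesis by (auto simp: zero_less_mult_iff)
qed

text \<open>The quadratic is positive exactly between \<open>a\<close> and \<open>b\<close>, which
  gives compact support and, as \<open>n\<close> grows, convergence to the indicator of the
  interval.\<close>

lemma schwartz_function_bump:
  assumes "a < b"
  shows "schwartz_function (\<lambda>x. flat 0 (real n * ((b - x) * (x - a))))"
proof (rule smooth_compact_support_schwartz)
  have "smooth (\<lambda>x. real n * ((- 1 * x + b) * (1 * x + (- a))))"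
    by (intro smooth_cmult smooth_mult smooth_affine)
  then have "smooth (\<lambda>x. real n * ((b - x) * (x - a)))"
    by simp
  then show "smooth (\<lambda>x. flat 0 (real n * ((b - x) * (x - a))))"
    by (rule smooth_compose[OF smooth_flat])
  fix x
  assume "max \<bar>a\<bar> \<bar>b\<bar> < \<bar>x\<bar>"
  then have "x \<notin> {a<..<b}" by auto
  then have "\<not> 0 < (b - x) * (x - a)"
    using mult_diff_pos_iff[OF assms] by blast
  then show "flat 0 (real n * ((b - x) * (x - a))) = 0"
    unfolding flat_def by (simp add: mult_le_0_iff not_less mult_nonneg_nonpos)
qed

lemma integrable_square_mult_interval:
  fixes f :: "real \<Rightarrow> real"
  assumes "f \<in> borel_measurable lborel" "integrable lborel (\<lambda>x. (f x)\<^sup>2)"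
  shows "integrable lborel (\<lambda>x. f x * indicator {a<..<b} x)"
proof (rule integrable_mult_of_squares[OF assms(1) _ assms(2)])
  have "(\<lambda>x. (indicator {a<..<b} x :: real)\<^sup>2) = indicator {a<..<b}"
    by (auto simp: indicator_def fun_eq_iff)
  moreover have "integrable lborel (indicator {a<..<b} :: real \<Rightarrow> real)"
    by (cases "a \<le> b") simp_all
  ultimately show "integrable lborel (\<lambda>x. (indicator {a<..<b} x :: real)\<^sup>2)"
    by (simp only:)
qed simp

lemma du_bois_reymond_lborel:
  fixes f :: "real \<Rightarrow> real"
  assumes f [measurable]: "f \<in> borel_measurable lborel" and f2: "integrable lborel (\<lambda>x. (f x)\<^sup>2)"
    and zero: "\<And>\<phi>. (\<integral>x. f x * schwartz_fun \<phi> x \<partial>lborel) = 0"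
  shows "AE x in lborel. f x = 0"
proof (rule AE_eq_0_of_intervals)
  show "f \<in> borel_measurable borel" using f by simp
  show int: "integrable lborel (\<lambda>x. f x * indicator {a<..<b} x)" for a b
    using f f2 by (rule integrable_square_mult_interval)
  fix a b :: real
  assume "a < b"
  have ind: "{x. 0 < (b - x) * (x - a)} = {a<..<b}"
    unfolding mult_diff_pos_iff[OF \<open>a < b\<close>] by (rule Collect_mem_eq)
  have "(\<integral>x. f x * flat 0 (real n * ((b - x) * (x - a))) \<partial>lborel) = 0" for n
    using zero[of "Schwartz (\<lambda>x. flat 0 (real n * ((b - x) * (x - a))))"]
      schwartz_function_bump[OF \<open>a < b\<close>, of n]
    by (simp add: Schwartz_inverse)
  then have "(\<integral>x. f x * indicator {x. 0 < (b - x) * (x - a)} x \<partial>lborel) = 0"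
    using int[of a b] by (intro integral_indicator_pos_eq_0) (simp_all only: ind, simp_all)
  then show "(\<integral>x. f x * indicator {a<..<b} x \<partial>lborel) = 0"
    by (simp only: ind)
qed

lemma dom_measure_schwartz: "dom_measure TYPE(schwartz) = lborel"
  by (rule dom_measure_schwartz_def)

instance schwartz :: convolution_space
proof
  fix \<phi> \<psi> :: schwartz and a x t :: real and N :: nat and w f :: "real \<Rightarrow> real"
  show cont: "continuous_on UNIV (fun_of \<phi>)" for \<phi> :: schwartz
    using smooth_continuous[OF schwartz.smooth, of UNIV 0 \<phi>] by simp
  show "\<exists>\<psi>::schwartz. (\<forall>x. fun_of \<psi> x = fun_of \<phi> (- x)) \<and> (\<forall>N. snorm N \<psi> \<le> snorm N \<phi>)"
    by (rule schwartz.reflection_exists)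
  show "snorm N (translate (- x) \<phi>) \<le> (1 + \<bar>x\<bar>) ^ N * snorm N \<phi>"
    by (rule schwartz.snorm_translate_le)
  show "snorm N (translate (- x) \<phi> - translate (- t) \<phi>) \<le> \<bar>x - t\<bar> * (1 + \<bar>x\<bar> + \<bar>t\<bar>) ^ N * snorm (Suc N) \<phi>"
    by (rule schwartz.snorm_translate_diff_le)
  show "\<exists>\<psi>. (\<forall>y. fun_of \<psi> y = (\<integral>x. w x * fun_of \<phi> (y + x) \<partial>lborel)) \<and>
    (\<forall>N \<eta> B. (\<forall>x. w x \<noteq> 0 \<longrightarrow> snorm N (translate (- x) \<phi> - \<eta>) \<le> B x) \<longrightarrow>
      integrable lborel (\<lambda>x. \<bar>w x\<bar> * B x) \<longrightarrow>
      snorm N (\<psi> - (\<integral>x. w x \<partial>lborel) *\<^sub>R \<eta>) \<le> real (Suc N) * (\<integral>x. \<bar>w x\<bar> * B x \<partial>lborel))"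
    if "rapidly_decreasing w"
    using that by (rule schwartz.convolution_exists)
  have "\<exists>K. \<forall>x. (1 + \<bar>x\<bar>) ^ m * \<bar>fun_of \<phi> x\<bar> \<le> K" for m
    using schwartz.sem_upper[of _ m 0 \<phi>] by auto
  then have "rapidly_decreasing (fun_of \<phi>)"
    using cont[of \<phi>] unfolding rapidly_decreasing_def by (simp add: borel_measurable_continuous_onI)
  then show "\<exists>w. rapidly_decreasing w \<and>
      (\<forall>f. (\<integral>x. fun_of \<phi> x * f x \<partial>dom_measure TYPE(schwartz)) = (\<integral>x. w x * f x \<partial>lborel))"
    unfolding dom_measure_schwartz by (intro exI[of _ "fun_of \<phi>"] conjI allI refl)
  show "(\<integral>x. fun_of \<phi> (x + a) * fun_of \<psi> (x + a) \<partial>dom_measure TYPE(schwartz))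
      = (\<integral>x. fun_of \<phi> x * fun_of \<psi> x \<partial>dom_measure TYPE(schwartz))"
    using lborel_integral_real_affine[of 1 "\<lambda>x. fun_of \<phi> x * fun_of \<psi> x" a]
    by (simp add: dom_measure_schwartz add.commute)
  show "(\<integral>x. fun_of \<phi> (- x) * fun_of \<psi> (- x) \<partial>dom_measure TYPE(schwartz))
      = (\<integral>x. fun_of \<phi> x * fun_of \<psi> x \<partial>dom_measure TYPE(schwartz))"
    using lborel_integral_real_affine[of "- 1" "\<lambda>x. fun_of \<phi> x * fun_of \<psi> x" 0]
    by (simp add: dom_measure_schwartz)
  show "\<phi> = 0" if zero: "(\<integral>x. fun_of \<phi> x * fun_of \<phi> x \<partial>dom_measure TYPE(schwartz)) = 0"
  proof (rule fun_of_eqI)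
    fix x
    have "AE x in dom_measure TYPE(schwartz). fun_of \<phi> x * fun_of \<phi> x = 0"
      using zero integral_nonneg_eq_0_iff_AE[OF integrable_fun_of_mult[of \<phi> \<phi>]] by simp
    then have "AE x in lborel. x \<in> UNIV \<longrightarrow> fun_of \<phi> x = 0"
      unfolding dom_measure_schwartz by simp
    from continuous_AE_zero[OF cont open_UNIV this, of x] show "fun_of \<phi> x = fun_of 0 x"
      by simp
  qed
  assume f: "f \<in> borel_measurable (dom_measure TYPE(schwartz))"
    and f2: "integrable (dom_measure TYPE(schwartz)) (\<lambda>x. (f x)\<^sup>2)"
    and zero: "\<And>\<phi>::schwartz. (\<integral>x. f x * fun_of \<phi> x \<partial>dom_measure TYPE(schwartz)) = 0"
  note f = f[unfolded dom_measure_schwartz] and f2 = f2[unfolded dom_measure_schwartz]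
    and zero = zero[unfolded dom_measure_schwartz]
  show "AE x in dom_measure TYPE(schwartz). f x = 0"
    unfolding dom_measure_schwartz 
    using f f2 zero[unfolded fun_of_schwartz_def] by (rule du_bois_reymond_lborel)
qed

section \<open>Integration over a period and arcs of the circle\<close>

lemma circle_fun_periodic: "circle_fun \<theta> (x + 1) = circle_fun \<theta> x"
  using circle_periodic[of 0 \<theta>] by simp

lemma circle_fun_measurable [measurable]: "circle_fun \<theta> \<in> borel_measurable borel"
  using smooth_continuous[OF circle_smooth, of UNIV 0 \<theta>] by (simp add: borel_measurable_continuous_onI)

lemma integral_dom_circle:
  "(\<integral>x. f x \<partial>dom_measure TYPE(circle_test)) = (\<integral>x. indicator {0..<1} x * f x \<partial>lborel)"
  for f :: "real \<Rightarrow> real"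
  unfolding dom_measure_circle_test_def by (subst integral_restrict_space) simp_all

text \<open>Only the part of the period moved past \<open>1\<close> has to be moved back, so it suffices to shift by \<open>frac a\<close>.\<close>

lemma integral_period_shift:
  fixes p :: "real \<Rightarrow> real"
  assumes p [measurable]: "p \<in> borel_measurable borel" and per: "\<And>x. p (x + 1) = p x" and bound: "\<And>x. \<bar>p x\<bar> \<le> B"
  shows "(\<integral>x. indicator {0..<1} x * p (x + a) \<partial>lborel) = (\<integral>x. indicator {0..<1} x * p x \<partial>lborel)"
proof -
  define c where "c = frac a"
  have c: "0 \<le> c" "c < 1" by (auto simp: c_def frac_lt_1)
  have pa: "p (x + a) = p (x + c)" for x
    unfolding c_def using periodic_frac[of "\<lambda>a. p (x + a)" a] per[of "x + _"] by (simp add: add.assoc)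
  have shift: "(\<integral>x. indicator {u..<v} x * p (x + t) \<partial>lborel) = (\<integral>x. indicator {u+t..<v+t} x * p x \<partial>lborel)" for u v t
    using lborel_integral_real_affine[of 1 "\<lambda>x. indicator {u+t..<v+t} x * p x" t]
    by (simp add: indicator_def add.commute)
  have int: "integrable lborel (\<lambda>x. indicator {u..<v} x * p x)" if "u \<le> v" for u v
  proof (rule Bochner_Integration.integrable_bound)
    show "integrable lborel (\<lambda>x. B * indicator {u..<v} x)" using that by simp
    show "AE x in lborel. norm (indicator {u..<v} x * p x) \<le> norm (B * indicator {u..<v} x)"
      by (rule AE_I2) (simp add: indicator_def order_trans[OF bound abs_ge_self])
  qed simp
  have split: "(\<integral>x. indicator {u..<w} x * p x \<partial>lborel)
      = (\<integral>x. indicator {u..<v} x * p x \<partial>lborel) + (\<integral>x. indicator {v..<w} x * p x \<partial>lborel)"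
    if "u \<le> v" "v \<le> w" for u v w
  proof -
    have "(\<lambda>x. indicator {u..<w} x * p x) = (\<lambda>x. indicator {u..<v} x * p x + indicator {v..<w} x * p x)"
      using that by (auto simp: indicator_def fun_eq_iff)
    then show ?thesis
      using int that by simp
  qed
  have "(\<integral>x. indicator {0..<1} x * p (x + a) \<partial>lborel) = (\<integral>x. indicator {c..<1+c} x * p x \<partial>lborel)"
    using shift[of 0 1 c] by (simp add: pa)
  also have "\<dots> = (\<integral>x. indicator {c..<1} x * p x \<partial>lborel) + (\<integral>x. indicator {1..<1+c} x * p x \<partial>lborel)"
    using c by (intro split) auto
  also have "(\<integral>x. indicator {1..<1+c} x * p x \<partial>lborel) = (\<integral>x. indicator {0..<c} x * p x \<partial>lborel)"
    using shift[of 0 c 1] by (simp add: per add.commute)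
  also have "(\<integral>x. indicator {c..<1} x * p x \<partial>lborel) + (\<integral>x. indicator {0..<c} x * p x \<partial>lborel)
      = (\<integral>x. indicator {0..<1} x * p x \<partial>lborel)"
    using split[of 0 c 1] c by simp
  finally show ?thesis .
qed

text \<open>Substituting \<open>1 - x\<close> for \<open>x\<close> exchanges the half-open periods
  [0, 1) and (0, 1], which differ by two points.\<close>

lemma integral_period_reflect:
  fixes p :: "real \<Rightarrow> real"
  assumes p [measurable]: "p \<in> borel_measurable borel" and per: "\<And>x. p (x + 1) = p x"
  shows "(\<integral>x. indicator {0..<1} x * p (- x) \<partial>lborel) = (\<integral>x. indicator {0..<1} x * p x \<partial>lborel)"
proof -
  have per': "p (x - 1) = p x" for x using per[of "x - 1"] by simp
  have "(\<integral>x. indicator {0..<1} x * p (- x) \<partial>lborel) = (\<integral>x. indicator {0<..1} x * p x \<partial>lborel)"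
    using lborel_integral_real_affine[of "- 1" "\<lambda>x. indicator {0..<1} x * p (- x)" 1]
    by (simp add: per' indicator_def conj_commute)
  also have "\<dots> = (\<integral>x. indicator {0..<1} x * p x \<partial>lborel)"
  proof (rule integral_cong_AE)
    show "AE x in lborel. indicator {0<..1} x * p x = indicator {0..<1} x * p x"
      using AE_lborel_singleton[of 0] AE_lborel_singleton[of 1]
      by eventually_elim (auto simp: indicator_def)
  qed simp_all
  finally show ?thesis .
qed

text \<open>The periodic counterpart of the quadratic on the line: a cosine of period 1 centred at
  the midpoint of the arc, minus its value at the endpoints.\<close>

lemma cos_arc_pos_iff:
  fixes a b x :: real
  assumes ab: "0 \<le> a" "a < b" "b \<le> 1" and x: "0 \<le> x" "x < 1"
  shows "0 < cos (2 * pi * (x - (a + b) / 2)) - cos (pi * (b - a)) \<longleftrightarrow> x \<in> {a<..<b}"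
proof -
  define u where "u = x - (a + b) / 2"
  define t where "t = \<bar>u\<bar>"
  define r where "r = (b - a) / 2"
  have r: "0 < r" "r \<le> 1 / 2"
    using ab by (simp_all add: r_def)
  \<comment> \<open>As the arc lies inside [0, 1], the distance \<open>1 - t\<close> around the
    other side of the circle is at least \<open>r\<close>. This settles the case
    \<open>t > 1 / 2\<close>, where the cosine is folded back to a monotone branch.\<close>
  have t: "0 \<le> t" "t \<le> 1 - r"
    unfolding t_def abs_le_iff using ab x by (simp_all add: r_def u_def field_simps)
  have cos_t: "cos (2 * pi * (x - (a + b) / 2)) = cos (2 * pi * t)"
    unfolding t_def u_def[symmetric] by (cases "0 \<le> u") simp_all
  have cos_r: "cos (pi * (b - a)) = cos (2 * pi * r)"
    by (simp add: r_def)
  have iff: "x \<in> {a<..<b} \<longleftrightarrow> t < r"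
    unfolding t_def abs_less_iff by (auto simp: r_def u_def field_simps)
  show ?thesis
  proof (cases "t < r")
    case True
    then have "cos (2 * pi * r) < cos (2 * pi * t)"
      using r t by (intro cos_monotone_0_pi) auto
    then show ?thesis unfolding iff cos_t cos_r using True by simp
  next
    case False
    have "cos (2 * pi * t) \<le> cos (2 * pi * r)"
    proof (cases "t \<le> 1 / 2")
      case True
      then show ?thesis using False r by (intro cos_monotone_0_pi_le) auto
    next
      case t_large: False
      have "cos (2 * pi * t) = cos (2 * pi * (1 - t))"
        using cos_2pi_minus[of "2 * pi * t"] by (simp add: algebra_simps)
      also have "\<dots> \<le> cos (2 * pi * r)"
        using t_large t r by (intro cos_monotone_0_pi_le) auto
      finally show ?thesis .
    qed
    then show ?thesis unfolding iff cos_t cos_r using False by simp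
  qed
qed

lemma circle_bump:
  "\<exists>\<theta>. circle_fun \<theta> = (\<lambda>x. flat 0 (real n * (cos (2 * pi * (x - m)) - c)))"
proof -
  have "smooth (\<lambda>x. cos (2 * pi * x + (- (2 * pi * m))))"
    by (rule smooth_compose[OF smooth_cos smooth_affine])
  then have "smooth (\<lambda>x. real n * (1 * cos (2 * pi * x + (- (2 * pi * m))) + (0 * x + - c)))"
    by (intro smooth_cmult smooth_add smooth_affine)
  then have "smooth (\<lambda>x. real n * (cos (2 * pi * (x - m)) - c))"
    by (simp add: algebra_simps)
  then have "smooth (\<lambda>x. flat 0 (real n * (cos (2 * pi * (x - m)) - c)))"
    by (rule smooth_compose[OF smooth_flat])
  moreover have "cos (2 * pi * (x + 1 - m)) = cos (2 * pi * (x - m))" for x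
    using cos_periodic[of "2 * pi * (x - m)"] by (simp add: algebra_simps)
  ultimately show ?thesis
    by (intro exI[of _ "Circle_test (\<lambda>x. flat 0 (real n * (cos (2 * pi * (x - m)) - c)))"])
       (simp add: Circle_test_inverse)
qed

lemma du_bois_reymond_circle:
  fixes f :: "real \<Rightarrow> real"
  assumes f: "f \<in> borel_measurable (restrict_space lborel {0..<1})"
    and f2: "integrable (restrict_space lborel {0..<1}) (\<lambda>x. (f x)\<^sup>2)"
    and zero: "\<And>\<theta>. (\<integral>x. f x * circle_fun \<theta> x \<partial>restrict_space lborel {0..<1}) = 0"
  shows "AE x in restrict_space lborel {0..<1}. f x = 0"
proof -
  \<comment> \<open>Extension by zero carries the problem on one period over to
    \<open>lborel\<close>, where the criterion on intervals applies.\<close>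
  define g where "g x = indicator {0..<1} x * f x" for x :: real
  have g [measurable]: "g \<in> borel_measurable lborel"
    using f unfolding g_def by (subst (asm) borel_measurable_restrict_space_iff) simp_all
  have "(\<lambda>x. (g x)\<^sup>2) = (\<lambda>x. indicator {0..<1} x *\<^sub>R (f x)\<^sup>2)"
    by (auto simp: g_def indicator_def fun_eq_iff)
  moreover have "integrable lborel (\<lambda>x. indicator {0..<1} x *\<^sub>R (f x)\<^sup>2)"
    using f2 by (subst (asm) integrable_restrict_space) simp_all
  ultimately have g2: "integrable lborel (\<lambda>x. (g x)\<^sup>2)"
    by (simp only:)
  have g_zero: "(\<integral>x. g x * circle_fun \<theta> x \<partial>lborel) = 0" for \<theta>
    using zero[of \<theta>] by (subst (asm) integral_restrict_space) (simp_all add: g_def mult.assoc)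
  have int: "integrable lborel (\<lambda>x. g x * indicator {a<..<b} x)" for a b
    using g g2 by (rule integrable_square_mult_interval)
  have inner: "(\<integral>x. g x * indicator {a<..<b} x \<partial>lborel) = 0" if ab: "0 \<le> a" "b \<le> 1" for a b
  proof (cases "a < b")
    case True
    define q where "q x = cos (2 * pi * (x - (a + b) / 2)) - cos (pi * (b - a))" for x
    have [measurable]: "q \<in> borel_measurable lborel"
      unfolding q_def by simp
    have eq: "(\<lambda>x. g x * indicator {x. 0 < q x} x) = (\<lambda>x. g x * indicator {a<..<b} x)"
    proof
      fix x
      show "g x * indicator {x. 0 < q x} x = g x * indicator {a<..<b} x"
      proof (cases "x \<in> {0..<1}")
        case True
        then have "0 < q x \<longleftrightarrow> x \<in> {a<..<b}"
          unfolding q_def using cos_arc_pos_iff[OF ab(1) \<open>a < b\<close> ab(2)] by simp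
        then show ?thesis unfolding indicator_def by simp
      qed (simp add: g_def)
    qed
    have "(\<integral>x. g x * flat 0 (real n * q x) \<partial>lborel) = 0" for n
    proof -
      obtain \<theta> where "circle_fun \<theta> = (\<lambda>x. flat 0 (real n * (cos (2 * pi * (x - (a + b) / 2)) - cos (pi * (b - a)))))"
        using circle_bump[of n "(a + b) / 2" "cos (pi * (b - a))"] by auto
      with g_zero[of \<theta>] show ?thesis by (simp only: q_def)
    qed
    then have "(\<integral>x. g x * indicator {x. 0 < q x} x \<partial>lborel) = 0"
      using int[of a b] by (intro integral_indicator_pos_eq_0) (simp_all only: eq, simp_all)
    then show ?thesis by (simp only: eq)
  qed simp
  have "AE x in lborel. g x = 0"
  proof (rule AE_eq_0_of_intervals)
    show "g \<in> borel_measurable borel" using g by simp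
    show "integrable lborel (\<lambda>x. g x * indicator {a<..<b} x)" for a b by (rule int)
    fix a b :: real
    \<comment> \<open>Since \<open>g\<close> vanishes outside the period, cutting the interval to
      (0, 1) can change the integrand only at the point 0.\<close>
    have "(\<integral>x. g x * indicator {a<..<b} x \<partial>lborel) = (\<integral>x. g x * indicator {max a 0<..<min b 1} x \<partial>lborel)"
    proof (rule integral_cong_AE)
      show "AE x in lborel. g x * indicator {a<..<b} x = g x * indicator {max a 0<..<min b 1} x"
        using AE_lborel_singleton[of 0] by eventually_elim (auto simp: g_def indicator_def)
    qed simp_all
    also have "\<dots> = 0" by (rule inner) auto
    finally show "(\<integral>x. g x * indicator {a<..<b} x \<partial>lborel) = 0" .
  qed
  then show ?thesis
    by (subst AE_restrict_space_iff) (auto simp: g_def elim: eventually_mono)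
qed

instance circle_test :: convolution_space
proof
  fix \<theta> \<eta> :: circle_test and a x t :: real and N :: nat and w f :: "real \<Rightarrow> real"
  show cont: "continuous_on UNIV (fun_of \<theta>)" for \<theta> :: circle_test
    using smooth_continuous[OF circle.smooth, of UNIV 0 \<theta>] by simp
  show "\<exists>\<psi>::circle_test. (\<forall>x. fun_of \<psi> x = fun_of \<theta> (- x)) \<and> (\<forall>N. snorm N \<psi> \<le> snorm N \<theta>)"
    by (rule circle.reflection_exists)
  show "snorm N (translate (- x) \<theta>) \<le> (1 + \<bar>x\<bar>) ^ N * snorm N \<theta>"
    by (rule circle.snorm_translate_le)
  show "snorm N (translate (- x) \<theta> - translate (- t) \<theta>) \<le> \<bar>x - t\<bar> * (1 + \<bar>x\<bar> + \<bar>t\<bar>) ^ N * snorm (Suc N) \<theta>"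
    by (rule circle.snorm_translate_diff_le)
  show "\<exists>\<psi>. (\<forall>y. fun_of \<psi> y = (\<integral>x. w x * fun_of \<theta> (y + x) \<partial>lborel)) \<and>
    (\<forall>N \<eta> B. (\<forall>x. w x \<noteq> 0 \<longrightarrow> snorm N (translate (- x) \<theta> - \<eta>) \<le> B x) \<longrightarrow>
      integrable lborel (\<lambda>x. \<bar>w x\<bar> * B x) \<longrightarrow>
      snorm N (\<psi> - (\<integral>x. w x \<partial>lborel) *\<^sub>R \<eta>) \<le> real (Suc N) * (\<integral>x. \<bar>w x\<bar> * B x \<partial>lborel))"
    if "rapidly_decreasing w"
    using that by (rule circle.convolution_exists)
  let ?w = "\<lambda>x. indicator {0..<1} x * circle_fun \<theta> x"
  have "(1 + \<bar>x\<bar>) ^ m * \<bar>?w x\<bar> \<le> 2 ^ m * circle_seminorm 0 \<theta>" for m x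
  proof (cases "x \<in> {0..<1}")
    case True
    then have "(1 + \<bar>x\<bar>) ^ m * \<bar>circle_fun \<theta> x\<bar> \<le> 2 ^ m * circle_seminorm 0 \<theta>"
      using circle_seminorm_upper[of 0 \<theta> x] by (intro mult_mono power_mono) auto
    then show ?thesis using True by simp
  qed (simp add: circle_seminorm_nonneg)
  then have "rapidly_decreasing ?w"
    unfolding rapidly_decreasing_def by (intro conjI allI exI) simp_all
  moreover have "(\<integral>x. fun_of \<theta> x * f x \<partial>dom_measure TYPE(circle_test)) = (\<integral>x. ?w x * f x \<partial>lborel)" for f
    unfolding integral_dom_circle fun_of_circle_test_def by (simp only: mult.assoc)
  ultimately show "\<exists>w. rapidly_decreasing w \<and>
      (\<forall>f. (\<integral>x. fun_of \<theta> x * f x \<partial>dom_measure TYPE(circle_test)) = (\<integral>x. w x * f x \<partial>lborel))"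
    by (intro exI[of _ ?w] conjI allI)
  let ?p = "\<lambda>x. circle_fun \<theta> x * circle_fun \<eta> x"
  have per: "?p (x + 1) = ?p x" for x
    by (simp only: circle_fun_periodic)
  have bound: "\<bar>?p x\<bar> \<le> circle_seminorm 0 \<theta> * circle_seminorm 0 \<eta>" for x
    unfolding abs_mult using circle_seminorm_upper[of 0 _ x] circle_seminorm_nonneg
    by (intro mult_mono) auto
  show "(\<integral>x. fun_of \<theta> (x + a) * fun_of \<eta> (x + a) \<partial>dom_measure TYPE(circle_test))
      = (\<integral>x. fun_of \<theta> x * fun_of \<eta> x \<partial>dom_measure TYPE(circle_test))"
    unfolding integral_dom_circle fun_of_circle_test_def
    using per bound by (intro integral_period_shift[where p = ?p]) simp_all
  show "(\<integral>x. fun_of \<theta> (- x) * fun_of \<eta> (- x) \<partial>dom_measure TYPE(circle_test))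
      = (\<integral>x. fun_of \<theta> x * fun_of \<eta> x \<partial>dom_measure TYPE(circle_test))"
    unfolding integral_dom_circle fun_of_circle_test_def
    using per by (intro integral_period_reflect[where p = ?p]) simp_all
  show "\<theta> = 0" if zero: "(\<integral>x. fun_of \<theta> x * fun_of \<theta> x \<partial>dom_measure TYPE(circle_test)) = 0"
  proof (rule fun_of_eqI)
    fix x
    have "AE x in dom_measure TYPE(circle_test). fun_of \<theta> x * fun_of \<theta> x = 0"
      using zero integral_nonneg_eq_0_iff_AE[OF integrable_fun_of_mult[of \<theta> \<theta>]] by simp
    then have "AE x in lborel. x \<in> {0..<1} \<longrightarrow> fun_of \<theta> x = 0"
      unfolding dom_measure_circle_test_def by (subst (asm) AE_restrict_space_iff) simp_all
    then have "AE x in lborel. x \<in> {0<..<1} \<longrightarrow> fun_of \<theta> x = 0"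
      by (rule AE_mp) (rule AE_I2, simp)
    then have "fun_of \<theta> (frac x) = 0"
      by (rule continuous_AE_zero[OF cont open_greaterThanLessThan])
         (simp add: closure_greaterThanLessThan frac_lt_1 less_imp_le)
    then show "fun_of \<theta> x = fun_of 0 x"
      using periodic_frac[of "circle_fun \<theta>" x, OF circle_fun_periodic]
      by (simp add: fun_of_circle_test_def)
  qed
  assume "f \<in> borel_measurable (dom_measure TYPE(circle_test))"
    and "integrable (dom_measure TYPE(circle_test)) (\<lambda>x. (f x)\<^sup>2)"
    and zero: "\<And>\<theta>::circle_test. (\<integral>x. f x * fun_of \<theta> x \<partial>dom_measure TYPE(circle_test)) = 0"
  then show "AE x in dom_measure TYPE(circle_test). f x = 0"
    unfolding dom_measure_circle_test_def fun_of_circle_test_def by (rule du_bois_reymond_circle)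
qed

section \<open>Square-integrable distributions as a Hilbert space\<close>

context
  fixes M :: "real measure"
  assumes M: "M = dom_measure TYPE('a::convolution_space)"
begin

lemma integrable_represents_mult:
  fixes u v :: "'a distribution"
  assumes "represents f u" "represents g v"
  shows "integrable M (\<lambda>x. f x * g x)"
  using assms unfolding represents_def M by (intro integrable_mult_of_squares) auto

lemma integrable_represents_fun_of:
  fixes u :: "'a distribution" and \<phi> :: 'a
  assumes "represents f u"
  shows "integrable M (\<lambda>x. f x * fun_of \<phi> x)"
  using assms integrable_fun_of_mult[of \<phi> \<phi>] fun_of_integrable[of \<phi>]
  unfolding represents_def M by (intro integrable_mult_of_squares) (auto simp: power2_eq_square)

lemma represents_add:
  fixes u v :: "'a distribution"
  assumes f: "represents f u" and g: "represents g v"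
  shows "represents (\<lambda>x. f x + g x) (u + v)"
  unfolding represents_def
proof (intro conjI allI)
  show "(\<lambda>x. f x + g x) \<in> borel_measurable (dom_measure TYPE('a))"
    using f g by (auto simp: represents_def)
  show "integrable (dom_measure TYPE('a)) (\<lambda>x. (f x + g x)\<^sup>2)"
    using f g integrable_represents_mult[OF f g]
    by (auto simp: represents_def power2_sum M mult.assoc)
  show "dapply (u + v) \<phi> = (\<integral>x. (f x + g x) * fun_of \<phi> x \<partial>dom_measure TYPE('a))" for \<phi>
    using f g integrable_represents_fun_of[OF f, of \<phi>] integrable_represents_fun_of[OF g, of \<phi>]
    by (simp add: represents_def plus_distribution.rep_eq distrib_right M)
qed

lemma represents_scaleR:
  fixes u :: "'a distribution"
  assumes f: "represents f u"
  shows "represents (\<lambda>x. c * f x) (c *\<^sub>R u)"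
  using f by (auto simp: represents_def power_mult_distrib scaleR_distribution.rep_eq mult.assoc)

lemma represents_unique:
  fixes u :: "'a distribution"
  assumes f: "represents f u" and g: "represents g u"
  shows "AE x in M. f x = g x"
proof -
  have "represents (\<lambda>x. f x + - 1 * g x) (u + (- 1) *\<^sub>R u)"
    by (intro represents_add represents_scaleR f g)
  then have "represents (\<lambda>x. f x - g x) (0 :: 'a distribution)"
    by simp
  then have "AE x in M. f x - g x = 0"
    unfolding represents_def M by (intro du_bois_reymond) auto
  then show ?thesis by auto
qed

lemma L2_inner_eq:
  fixes u v :: "'a distribution"
  assumes f: "represents f u" and g: "represents g v"
  shows "L2_inner u v = (\<integral>x. f x * g x \<partial>M)"
proof -
  define F G where "F = (SOME f. represents f u)" and "G = (SOME g. represents g v)"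
  have F: "represents F u" and G: "represents G v"
    unfolding F_def G_def
    by (rule someI[where P = "\<lambda>f. represents f u", OF f])
       (rule someI[where P = "\<lambda>g. represents g v", OF g])
  have "AE x in M. F x * G x = f x * g x"
    using represents_unique[OF F f] represents_unique[OF G g] by eventually_elim simp
  moreover have "f \<in> borel_measurable M" "g \<in> borel_measurable M"
      "F \<in> borel_measurable M" "G \<in> borel_measurable M"
    using f g F G by (simp_all add: represents_def M)
  ultimately show ?thesis
    unfolding L2_inner_def M[symmetric] F_def[symmetric] G_def[symmetric]
    by (intro integral_cong_AE borel_measurable_times)
qed

end

lemma subspace_L2: "subspace (L2 :: 'a::convolution_space distribution set)"
proof (rule subspaceI)
  show "0 \<in> (L2 :: 'a distribution set)"
    unfolding L2_def by (auto intro!: exI[of _ "\<lambda>_. 0"] simp: represents_def)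
qed (auto simp: L2_def intro: represents_add[OF refl] represents_scaleR[OF refl])

lemma L2_inner_add_left:
  fixes u v w :: "'a::convolution_space distribution"
  assumes "u \<in> L2" "v \<in> L2" "w \<in> L2"
  shows "L2_inner (u + v) w = L2_inner u w + L2_inner v w"
proof -
  obtain f g h where r: "represents f u" "represents g v" "represents h w"
    using assms unfolding L2_def by blast
  show ?thesis
    using integrable_represents_mult[OF refl r(1,3)] integrable_represents_mult[OF refl r(2,3)]
    unfolding L2_inner_eq[OF refl r(1,3)] L2_inner_eq[OF refl r(2,3)]
      L2_inner_eq[OF refl represents_add[OF refl r(1,2)] r(3)]
    by (simp add: distrib_right)
qed

lemma L2_inner_scaleR_left:
  fixes u v :: "'a::convolution_space distribution"
  assumes "u \<in> L2" "v \<in> L2"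
  shows "L2_inner (c *\<^sub>R u) v = c * L2_inner u v"
proof -
  obtain f g where r: "represents f u" "represents g v"
    using assms unfolding L2_def by blast
  show ?thesis
    by (simp add: L2_inner_eq[OF refl r] L2_inner_eq[OF refl represents_scaleR[OF refl r(1)] r(2)] mult.assoc)
qed

lemma L2_inner_commute: "L2_inner u v = L2_inner v u"
  unfolding L2_inner_def by (simp add: mult.commute)

lemma L2_inner_self_nonneg: "0 \<le> L2_inner u u"
  unfolding L2_inner_def by simp

lemma L2_inner_self_eq_0:
  fixes u :: "'a::convolution_space distribution"
  assumes "u \<in> L2" "L2_inner u u = 0"
  shows "u = 0"
proof -
  obtain f where f: "represents f u"
    using assms unfolding L2_def by blast
  then have int: "integrable (dom_measure TYPE('a)) (\<lambda>x. f x * f x)"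
    by (intro integrable_represents_mult[OF refl])
  have "(\<integral>x. f x * f x \<partial>dom_measure TYPE('a)) = 0"
    using assms(2) L2_inner_eq[OF refl f f] by simp
  then have "AE x in dom_measure TYPE('a). f x * f x = 0"
    using integral_nonneg_eq_0_iff_AE[OF int] by simp
  then have zero: "AE x in dom_measure TYPE('a). f x = 0"
    by simp
  show ?thesis
  proof (rule dapply_eqI)
    fix \<phi> :: 'a
    have "AE x in dom_measure TYPE('a). f x * fun_of \<phi> x = 0"
      using zero by eventually_elim simp
    then have "(\<integral>x. f x * fun_of \<phi> x \<partial>dom_measure TYPE('a)) = 0"
      by (rule integral_eq_zero_AE)
    then show "dapply u \<phi> = dapply 0 \<phi>"
      using f by (simp add: represents_def)
  qed
qed

lemma L2_norm_power2: "(L2_norm u)\<^sup>2 = L2_inner u u"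
  by (simp add: L2_norm_def L2_inner_self_nonneg)

section \<open>Regularized least squares\<close>

text \<open>The inner product lives on a subspace \<open>V\<close> because \<open>L2_inner\<close>
  is meaningful on \<open>L2\<close> only. The vectors \<open>v l\<close> represent the
  measurements, and existence of the minimizer comes from solving a finite linear system.\<close>

locale regularized_least_squares =
  fixes V :: "'v::real_vector set" and ip :: "'v \<Rightarrow> 'v \<Rightarrow> real"
    and v :: "'l::finite \<Rightarrow> 'v" and y :: "real ^ 'l" and lam :: real
  assumes subspace: "subspace V"
    and ip_add: "a \<in> V \<Longrightarrow> b \<in> V \<Longrightarrow> c \<in> V \<Longrightarrow> ip (a + b) c = ip a c + ip b c"
    and ip_scaleR: "a \<in> V \<Longrightarrow> b \<in> V \<Longrightarrow> ip (r *\<^sub>R a) b = r * ip a b"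
    and ip_commute: "ip a b = ip b a"
    and ip_nonneg: "0 \<le> ip a a"
    and ip_eq_0: "a \<in> V \<Longrightarrow> ip a a = 0 \<Longrightarrow> a = 0"
    and v_in: "v l \<in> V"
    and lam: "lam > 0"
begin

definition normal_matrix :: "real ^ 'l ^ 'l"
  where "normal_matrix = (\<chi> i j. ip (v i) (v j)) + lam *\<^sub>R mat 1"

definition coefficients :: "real ^ 'l"
  where "coefficients = matrix_inv normal_matrix *v y"

definition combine :: "real ^ 'l \<Rightarrow> 'v"
  where "combine a = (\<Sum>l\<in>UNIV. a $ l *\<^sub>R v l)"

definition sample :: "'v \<Rightarrow> real ^ 'l"
  where "sample x = (\<chi> l. ip x (v l))"

definition objective :: "'v \<Rightarrow> real"
  where "objective x = (norm (y - sample x))\<^sup>2 + lam * ip x x"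

lemma combine_in: "combine a \<in> V"
  unfolding combine_def by (intro subspace_sum[OF subspace] subspace_scale[OF subspace] v_in)

lemma ip_sum_left:
  assumes "finite A" "\<And>i. i \<in> A \<Longrightarrow> f i \<in> V" "b \<in> V"
  shows "ip (\<Sum>i\<in>A. f i) b = (\<Sum>i\<in>A. ip (f i) b)"
  using assms
proof (induction A rule: finite_induct)
  case empty
  then show ?case using ip_scaleR[of 0 b 0] subspace_0[OF subspace] by simp
next
  case (insert i A)
  then show ?case by (simp add: ip_add subspace_sum[OF subspace])
qed

lemma ip_combine: "b \<in> V \<Longrightarrow> ip (combine a) b = a \<bullet> sample b"
  unfolding combine_def sample_def
  by (subst ip_sum_left)
     (auto simp: ip_scaleR v_in subspace_scale[OF subspace] inner_vec_def ip_commute[of b])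

lemma normal_matrix_mult: "normal_matrix *v a = sample (combine a) + lam *\<^sub>R a"
proof -
  have "(\<chi> i j. ip (v i) (v j)) *v a = sample (combine a)"
    by (simp add: vec_eq_iff matrix_vector_mult_def sample_def[of "combine a"] ip_combine v_in)
       (simp add: inner_vec_def sample_def mult.commute)
  moreover have "(lam *\<^sub>R mat 1) *v a = lam *\<^sub>R a"
    by (simp add: scaleR_matrix_vector_assoc[symmetric])
  ultimately show ?thesis
    by (simp add: normal_matrix_def matrix_vector_mult_add_rdistrib)
qed

text \<open>Tested against \<open>a\<close>, the Gram part contributes the squared length of
  \<open>combine a\<close>, so the quadratic form is at least \<open>lam * (a \<bullet> a)\<close>
  and the kernel is trivial.\<close>

lemma invertible_normal_matrix: "invertible normal_matrix"
proof -
  have "a = 0" if "normal_matrix *v a = 0" for a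
  proof -
    have "0 = a \<bullet> (normal_matrix *v a)" using that by simp
    also have "\<dots> = ip (combine a) (combine a) + lam * (a \<bullet> a)"
      by (simp add: normal_matrix_mult inner_add_right ip_combine combine_in)
    finally have "lam * (a \<bullet> a) \<le> 0"
      using ip_nonneg[of "combine a"] by linarith
    then have "a \<bullet> a \<le> 0"
      using lam by (simp add: mult_le_0_iff)
    then show "a = 0" using inner_ge_zero[of a] by (metis inner_eq_zero_iff order_antisym)
  qed
  then show ?thesis
    unfolding invertible_left_inverse matrix_left_invertible_ker by blast
qed

text \<open>By the normal equations the residual at the candidate is \<open>lam\<close> times the
  coefficients. So the term linear in \<open>h\<close> from the data fit is -2 \<open>lam\<close>
  times the inner product of the coefficients with \<open>sample h\<close>, and the one from the
  penalty is its exact opposite.\<close>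

lemma objective_expand:
  assumes x: "x \<in> V"
  defines "h \<equiv> x - combine coefficients"
  shows "objective x = objective (combine coefficients) + (norm (sample h))\<^sup>2 + lam * ip h h"
proof -
  let ?w = "combine coefficients"
  have h: "h \<in> V"
    unfolding h_def by (intro subspace_diff[OF subspace] x combine_in)
  have xwh: "x = ?w + h" by (simp add: h_def)
  have "normal_matrix ** matrix_inv normal_matrix = mat 1"
    using someI_ex[OF invertible_normal_matrix[unfolded invertible_def]] unfolding matrix_inv_def by blast
  then have "normal_matrix *v coefficients = y"
    by (simp add: coefficients_def matrix_vector_mul_assoc)
  then have res: "y - sample ?w = lam *\<^sub>R coefficients"
    by (simp add: normal_matrix_mult algebra_simps)
  have samp: "sample x = sample ?w + sample h"
    unfolding xwh sample_def by (simp add: vec_eq_iff ip_add combine_in h v_in)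
  have diff: "y - sample x = lam *\<^sub>R coefficients - sample h"
    unfolding samp using res by (simp add: algebra_simps)
  have "(norm (y - sample x))\<^sup>2
      = (norm (lam *\<^sub>R coefficients))\<^sup>2 - 2 * lam * (coefficients \<bullet> sample h) + (norm (sample h))\<^sup>2"
    unfolding diff
    by (simp add: power2_norm_eq_inner inner_diff_left inner_diff_right inner_commute algebra_simps)
       (simp add: power2_eq_square)
  moreover have "ip x x = ip ?w ?w + 2 * (coefficients \<bullet> sample h) + ip h h"
  proof -
    have add: "ip x z = ip ?w z + ip h z" if "z \<in> V" for z
      using ip_add[OF combine_in h that, of coefficients] unfolding xwh[symmetric] .
    have "ip x x = ip ?w ?w + 2 * ip ?w h + ip h h"
      using add[OF x] add[OF combine_in, of coefficients] add[OF h]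
        ip_commute[of x ?w] ip_commute[of h ?w] ip_commute[of x h] by linarith
    then show ?thesis by (simp only: ip_combine[OF h])
  qed
  ultimately show ?thesis
    unfolding objective_def res by (simp add: algebra_simps)
qed

lemma objective_less:
  assumes "x \<in> V" "x \<noteq> combine coefficients"
  shows "objective (combine coefficients) < objective x"
proof -
  let ?h = "x - combine coefficients"
  have "?h \<in> V"
    by (intro subspace_diff[OF subspace] assms combine_in)
  then have "ip ?h ?h > 0"
    using ip_eq_0[of ?h] ip_nonneg[of ?h] assms(2) by (auto simp: less_le)
  then have "lam * ip ?h ?h > 0" using lam by simp
  moreover have "(norm (sample ?h))\<^sup>2 \<ge> 0" by simp
  ultimately show ?thesis
    using objective_expand[OF assms(1)] by linarith
qed

end

section \<open>The spline problem as regularized least squares\<close>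

lemma regularized_least_squares_L2:
  fixes v1 :: "'l::finite \<Rightarrow> 'a::convolution_space distribution" and v2 :: "'l \<Rightarrow> 'b::convolution_space distribution"
  assumes "\<And>l. v1 l \<in> L2" "\<And>l. v2 l \<in> L2" "lam > 0"
  shows "regularized_least_squares (L2 \<times> L2) (\<lambda>a b. L2_inner (fst a) (fst b) + L2_inner (snd a) (snd b))
    (\<lambda>l. (v1 l, v2 l)) lam"
proof
  show "subspace ((L2 :: 'a distribution set) \<times> (L2 :: 'b distribution set))"
    by (intro subspace_Times subspace_L2)
  fix a :: "'a distribution \<times> 'b distribution"
  show "0 \<le> L2_inner (fst a) (fst a) + L2_inner (snd a) (snd a)"
    using L2_inner_self_nonneg[of "fst a"] L2_inner_self_nonneg[of "snd a"] by simp
  assume "a \<in> L2 \<times> L2" "L2_inner (fst a) (fst a) + L2_inner (snd a) (snd a) = 0"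
  then have "fst a = 0" "snd a = 0"
    using L2_inner_self_nonneg[of "fst a"] L2_inner_self_nonneg[of "snd a"]
    by (auto intro!: L2_inner_self_eq_0)
  then show "a = 0" by (simp add: prod_eq_iff)
next
  fix a b :: "'a distribution \<times> 'b distribution"
  show "L2_inner (fst a) (fst b) + L2_inner (snd a) (snd b) = L2_inner (fst b) (fst a) + L2_inner (snd b) (snd a)"
    by (simp only: L2_inner_commute)
qed (use assms in \<open>auto simp: L2_inner_add_left L2_inner_scaleR_left algebra_simps\<close>)

lemma is_arg_min_unique:
  assumes "P w" "\<And>x. P x \<Longrightarrow> x \<noteq> w \<Longrightarrow> f w < (f x :: real)"
  shows "(\<exists>!x. is_arg_min f P x) \<and> is_arg_min f P w"
  using assms unfolding is_arg_min_def by (metis less_asym less_irrefl)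

theorem proposition8:
  fixes L\<^sub>T :: "tempered \<Rightarrow> tempered" and L\<^sub>S :: "periodic \<Rightarrow> periodic"
    and \<phi> :: "'l::finite \<Rightarrow> tempered" and y :: "real ^ 'l" and lam :: real
  assumes "invertible_admissible L\<^sub>T" and "invertible_admissible L\<^sub>S"
    and "lam > 0"
    and "\<And>l. \<phi> l \<in> lsi_adjoint L\<^sub>T ` L2"
    and "\<And>l. periodizable (\<phi> l)"
    and "\<And>l. Per (\<phi> l) \<in> lsi_adjoint L\<^sub>S ` L2"
  shows "let
      H = gram L\<^sub>T L\<^sub>S \<phi> + lam *\<^sub>R mat 1;
      \<alpha> = matrix_inv H *v y;
      \<psi> = green (lsi_adjoint L\<^sub>T \<circ> L\<^sub>T);
      \<rho> = green (lsi_adjoint L\<^sub>S \<circ> L\<^sub>S);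
      fT = (\<Sum>l\<in>UNIV. \<alpha> $ l *\<^sub>R lsi_convolution (\<phi> l) \<psi>);
      fS = (\<Sum>l\<in>UNIV. \<alpha> $ l *\<^sub>R lsi_convolution (Per (\<phi> l)) \<rho>);
      solution = is_arg_min (cost L\<^sub>T L\<^sub>S \<phi> y lam) (\<lambda>f. f \<in> native_space L\<^sub>T L\<^sub>S)
    in invertible H \<and> (\<exists>!f. solution f) \<and> solution (fT, fS)"
proof -
  define v1 where "v1 l = lsi_adjoint (inv L\<^sub>T) (\<phi> l)" for l
  define v2 where "v2 l = lsi_adjoint (inv L\<^sub>S) (Per (\<phi> l))" for l
  \<comment> \<open>As \<phi> is the adjoint of an element of \<open>L2\<close>, the adjoint of the
    inverse returns that element.\<close>
  have v1: "v1 l \<in> L2" for l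
    using assms(4)[of l] lsi_adjoint_inv(1)[OF assms(1)] by (auto simp: v1_def)
  have v2: "v2 l \<in> L2" for l
    using assms(6)[of l] lsi_adjoint_inv(1)[OF assms(2)] by (auto simp: v2_def)
  interpret regularized_least_squares "L2 \<times> L2"
    "\<lambda>a b. L2_inner (fst a) (fst b) + L2_inner (snd a) (snd b)" "\<lambda>l. (v1 l, v2 l)" y lam
    by (intro regularized_least_squares_L2 v1 v2 assms(3))
  have bijT: "bij L\<^sub>T" and bijS: "bij L\<^sub>S"
    and lin: "linear (inv L\<^sub>T)" "linear (inv L\<^sub>S)"
    using assms(1,2) by (auto simp: invertible_admissible_def lsi_continuous_def)
  have inv [simp]: "L\<^sub>T (inv L\<^sub>T u) = u" "inv L\<^sub>T (L\<^sub>T u) = u" "L\<^sub>S (inv L\<^sub>S w) = w" "inv L\<^sub>S (L\<^sub>S w) = w" for u w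
    using bijT bijS by (simp_all add: surj_f_inv_f[OF bij_is_surj] inv_f_f[OF bij_is_inj])
  have H: "gram L\<^sub>T L\<^sub>S \<phi> + lam *\<^sub>R mat 1 = normal_matrix"
    unfolding normal_matrix_def unfolding gram_def v1_def v2_def by simp
  let ?fT = "\<Sum>l\<in>UNIV. coefficients $ l *\<^sub>R lsi_convolution (\<phi> l) (green (lsi_adjoint L\<^sub>T \<circ> L\<^sub>T))"
  let ?fS = "\<Sum>l\<in>UNIV. coefficients $ l *\<^sub>R lsi_convolution (Per (\<phi> l)) (green (lsi_adjoint L\<^sub>S \<circ> L\<^sub>S))"
  define w where "w = combine coefficients"
  have w_eq: "w = (\<Sum>l\<in>UNIV. coefficients $ l *\<^sub>R v1 l, \<Sum>l\<in>UNIV. coefficients $ l *\<^sub>R v2 l)"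
    unfolding w_def combine_def by (simp add: prod_eq_iff fst_sum snd_sum)
  \<comment> \<open>Convolution with the Green's function is the inverse applied to
    \<open>v1 l\<close> or \<open>v2 l\<close>, so by linearity the inverse comes out of the sum and
    the combination \<open>w\<close> is left inside.\<close>
  have f: "?fT = inv L\<^sub>T (fst w)" "?fS = inv L\<^sub>S (snd w)"
    unfolding w_eq lsi_convolution_green[OF assms(1)] lsi_convolution_green[OF assms(2)]
    by (simp_all add: linear_sum[OF lin(1)] linear_sum[OF lin(2)] linear_cmul[OF lin(1)] linear_cmul[OF lin(2)]
        v1_def v2_def)
  \<comment> \<open>In the new variable the functionals become inner products with the vectors
    \<open>v1 l\<close> and \<open>v2 l\<close>.\<close>
  have cost: "cost L\<^sub>T L\<^sub>S \<phi> y lam f = objective (L\<^sub>T (fst f), L\<^sub>S (snd f))" for f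
    unfolding objective_def sample_def cost_def measurement_def v1_def[symmetric] v2_def[symmetric]
    by (simp add: L2_norm_power2 split_beta)
  have native: "f \<in> native_space L\<^sub>T L\<^sub>S \<longleftrightarrow> (L\<^sub>T (fst f), L\<^sub>S (snd f)) \<in> L2 \<times> L2" for f
    by (cases f) (force simp: native_space_def image_iff intro: inv(2,4)[symmetric])
  have "w \<in> L2 \<times> L2"
    unfolding w_def by (rule combine_in)
  then have "(?fT, ?fS) \<in> native_space L\<^sub>T L\<^sub>S"
    by (simp add: native f mem_Times_iff)
  moreover have "cost L\<^sub>T L\<^sub>S \<phi> y lam (?fT, ?fS) < cost L\<^sub>T L\<^sub>S \<phi> y lam f"
    if "f \<in> native_space L\<^sub>T L\<^sub>S" "f \<noteq> (?fT, ?fS)" for f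
  proof -
    have "(L\<^sub>T (fst f), L\<^sub>S (snd f)) \<noteq> w"
    proof
      assume "(L\<^sub>T (fst f), L\<^sub>S (snd f)) = w"
      then have "fst w = L\<^sub>T (fst f)" "snd w = L\<^sub>S (snd f)"
        by auto
      then have "f = (inv L\<^sub>T (fst w), inv L\<^sub>S (snd w))"
        by (simp add: prod_eq_iff)
      with that(2) show False unfolding f by blast
    qed
    then show ?thesis
      using objective_less[of "(L\<^sub>T (fst f), L\<^sub>S (snd f))"] that(1)
      by (simp add: cost f native w_def)
  qed
  ultimately have "(\<exists>!f. is_arg_min (cost L\<^sub>T L\<^sub>S \<phi> y lam) (\<lambda>f. f \<in> native_space L\<^sub>T L\<^sub>S) f) \<and>
      is_arg_min (cost L\<^sub>T L\<^sub>S \<phi> y lam) (\<lambda>f. f \<in> native_space L\<^sub>T L\<^sub>S) (?fT, ?fS)"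
    by (rule is_arg_min_unique)
  then show ?thesis
    unfolding Let_def H coefficients_def[symmetric] using invertible_normal_matrix by blast
qed

end
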